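(* Let $i\ge0$ be an integer and let $\mathcal I=(I_n)_{n\ge1}$ be an $\mathrm{Inc}^i$-invariant chain of proper ideals $I_n\subsetneq R_n$. If there is a monomial order $\le$ on $R$ respecting $\mathrm{Inc}^i$ such that $R_n/\mathrm{in}_{\le}(I_n)$ is Cohen-Macaulay for all $n\gg0$, then $$\gamma_i(\mathcal I)=\Gamma_i(\mathrm{in}_{\le}(\mathcal I)).$$
   Context: Fix an integer $c\ge 1$ and a field $K$; let $\mathbb N$ be the set of positive integers and $[c]=\{1,\dots,c\}$. For $n\ge1$ let $R_n=K[x_{k,j}\mid 1\le k\le c,\ 1\le j\le n]$ and $R=\bigcup_{n\ge1}R_n$. For an integer $i\ge0$ let $\mathrm{Inc}^i$ be the monoid of all strictly increasing maps $\pi:\mathbb N\to\mathbb N$ with $\pi(j)=j$ for all $j\le i$; it acts on $R$ by $K$-algebra endomorphisms via $\pi\cdot x_{k,j}=x_{k,\pi(j)}$. For $m\le n$ put $\mathrm{Inc}^i_{m,n}=\{\pi\in\mathrm{Inc}^i\mid \pi(m)\le n\}$. A chain $\mathcal I=(I_n)_{n\ge1}$ of ideals $I_n\subseteq R_n$ is $\mathrm{Inc}^i$-invariant if $\pi(f)\in I_n$ for all $m\le n$, $f\in I_m$, $\pi\in\mathrm{Inc}^i_{m,n}$. For such a chain there is an integer $r\ge1$ such that for all $n\ge r$ the ideal $I_n$ of $R_n$ is generated by $\{\pi(f)\mid f\in I_r,\ \pi\in\mathrm{Inc}^i_{r,n}\}$ (known); the least such $r$ is denoted $\mathrm{ind}^i(\mathcal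 I)$. A monomial order $\le$ on $R$ respects $\mathrm{Inc}^i$ if $\pi(u)\le\pi(v)$ whenever $\pi\in\mathrm{Inc}^i$ and $u\le v$ are monomials of $R$; its restrictions to the $R_n$ are also denoted $\le$. In that case, for an $\mathrm{Inc}^i$-invariant chain $\mathcal I$, the chain of initial ideals $\mathrm{in}_{\le}(\mathcal I)=(\mathrm{in}_{\le}(I_n))_{n\ge1}$ is again $\mathrm{Inc}^i$-invariant (known). For a monomial $u\ne1$, $\min(u)$ is the smallest index $j$ such that some $x_{k,j}$ divides $u$. For a proper monomial ideal $J\subsetneq R_n$ with minimal set of monomial generators $G(J)$, and an integer $j\ge 0$, let $G_j^+(J)=\{u\in G(J)\mid \min(u)>j\}$. A set $C\subseteq[c]$ covers a monomial $u$ if there is $k\in C$ such that $x_{k,l}$ divides $u$ for some $l\ge1$; $C$ is a $j$-cover of $J$ if it covers every element of $G_j^+(J)$. Put $\gamma_j(J)=\min\{\#C\mid C\text{ is a }j\text{-cover of }J\}$, and $\gamma_j(R_n)=\infty$. For an $\mathrm{Inc}^j$-invariant chain $\mathcal J=(J_n)_{n\ge1}$ of monomial ideals, $\gamma_j(J_n)$ is the same for all $n\ge\mathrm{ind}^j(\mathcal J)$, and $\gamma_j(\mathcal J)$ denotes this common value. For an $\mathrm{Inc}^i$-invariant chain $\mathcal I$ of arbitrary ideals, $\gamma_i(\mathcal I)$ is defined as $\gamma_i(\mathrm{in}_{\le}(\mathcal I))$ for any monomial order $\le$ respecting $\mathrm{Inc}^i$; it does not depend on the choice of $\le$. Definition of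 $\Gamma_i(\mathcal H)$ for an $\mathrm{Inc}^i$-invariant chain $\mathcal H=(H_n)_{n\ge1}$ of proper monomial ideals. For an $\mathrm{Inc}^j$-invariant chain $\mathcal J=(J_n)_{n\ge1}$ of monomial ideals and $\mathbf e=(e_1,\dots,e_c)\in\mathbb Z_{\ge0}^c$, let $\mathcal J_{\mathbf e}=(J_{\mathbf e,n})_{n\ge1}$ be given by $$J_{\mathbf e,n}=\big\langle (J_n:x_{1,j+1}^{e_1}\cdots x_{c,j+1}^{e_c}),\ x_{1,j+1},\dots,x_{c,j+1}\big\rangle ;$$ for $n\le j$, where $x_{k,j+1}\notin R_n$, this is read as the intersection with $R_n$ of the corresponding ideal formed in $R$ from $J_nR$. The chain $\mathcal J_{\mathbf e}$ is $\mathrm{Inc}^{j+1}$-invariant (known). Fix an integer $r\ge\mathrm{ind}^i(\mathcal H)$. Starting from $\mathcal H$, iterate: for $k\ge1$, the $\mathrm{Inc}^{i+k}$-invariant chain $\mathcal H_{\mathbf e_1,\dots,\mathbf e_k}=(H_{\mathbf e_1,\dots,\mathbf e_k,n})_{n\ge1}$ is $(\mathcal H_{\mathbf e_1,\dots,\mathbf e_{k-1}})_{\mathbf e_k}$ (formed with $j=i+k-1$), and $$E(\mathcal H_{\mathbf e_1,\dots,\mathbf e_{k-1}})=\{\mathbf e_k\in\mathbb Z_{\ge0}^c\mid H_{\mathbf e_1,\dots,\mathbf e_k,r+k}\ne R_{r+k}\}$$ (for $k=1$ the chain $\mathcal H_{\mathbf e_1,\dots,\mathbf e_{k-1}}$ is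 $\mathcal H$). Put $$\gamma_{i+k}^{\max}(\mathcal H)=\max\{\gamma_{i+k}(\mathcal H_{\mathbf e_1,\dots,\mathbf e_k})\mid \mathbf e_1\in E(\mathcal H),\ \mathbf e_2\in E(\mathcal H_{\mathbf e_1}),\dots,\ \mathbf e_k\in E(\mathcal H_{\mathbf e_1,\dots,\mathbf e_{k-1}})\}.$$ These integers form a non-decreasing sequence in $k$ bounded by $c$, and $\Gamma_i(\mathcal H)=\max\{\gamma_{i+k}^{\max}(\mathcal H)\mid k\ge1\}$. *)

theory Defs
  imports
    "HOL-Library.Poly_Mapping"
    "HOL-Library.Extended_Nat"
    "HOL-Algebra.QuotRing"
    "HOL-Algebra.Ring_Divisibility"
begin

section \<open>Polynomial rings in the variables \<open>x\<^bsub>k,j\<^esub>\<close>\<close>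

text \<open>
  The variable \<open>x\<^bsub>k,j\<^esub>\<close> is encoded as the pair \<open>(k, j)\<close>, and a monomial as its finitely
  supported exponent function. Monomials are thus written additively: \<open>0\<close> is the monomial 1,
  \<open>u + v\<close> is the product, and \<^term>\<open>Poly_Mapping.single u 1\<close> is the monomial \<open>u\<close> viewed as a
  polynomial.
\<close>

type_synonym mon = "nat \<times> nat \<Rightarrow>\<^sub>0 nat"
type_synonym 'k mpoly = "mon \<Rightarrow>\<^sub>0 'k"

definition mons_in :: "(nat \<times> nat) set \<Rightarrow> mon set" where
  "mons_in V = {u. Poly_Mapping.keys u \<subseteq> V}"

definition poly_ring :: "(nat \<times> nat) set \<Rightarrow> ('k::field mpoly) ring" where
  "poly_ring V =
     \<lparr>carrier = {f. Poly_Mapping.keys f \<subseteq> mons_in V}, mult = (*), one = 1, zero = 0, add = (+)\<rparr>"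

definition R_fin :: "nat \<Rightarrow> nat \<Rightarrow> ('k::field mpoly) ring" where
  "R_fin c n = poly_ring ({1..c} \<times> {1..n})"

definition R_inf :: "nat \<Rightarrow> ('k::field mpoly) ring" where
  "R_inf c = poly_ring ({1..c} \<times> {1..})"

definition mons :: "nat \<Rightarrow> mon set" where
  "mons c = mons_in ({1..c} \<times> {1..})"

abbreviation to_poly :: "mon \<Rightarrow> 'k::field mpoly" where
  "to_poly u \<equiv> Poly_Mapping.single u 1"


section \<open>The monoids \<open>Inc\<^sup>i\<close> and invariant chains\<close>

text \<open>
  A strictly increasing map on the positive integers is represented by its extension to all natural
  numbers with value 0 at 0. The extension is again strictly increasing, and conversely every
  strictly increasing map on the natural numbers fixing 0 restricts to the positive integers. The
  requirement \<open>\<pi> 0 = 0\<close> is the instance \<open>j = 0\<close> below.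
\<close>

definition Inc :: "nat \<Rightarrow> (nat \<Rightarrow> nat) set" where
  "Inc i = {\<pi>. strict_mono \<pi> \<and> (\<forall>j\<le>i. \<pi> j = j)}"

definition Inc_seg :: "nat \<Rightarrow> nat \<Rightarrow> nat \<Rightarrow> (nat \<Rightarrow> nat) set" where
  "Inc_seg i m n = {\<pi> \<in> Inc i. \<pi> m \<le> n}"

definition act_mon :: "(nat \<Rightarrow> nat) \<Rightarrow> mon \<Rightarrow> mon" where
  "act_mon \<pi> u = (\<Sum>(k, j)\<in>Poly_Mapping.keys u. Poly_Mapping.single (k, \<pi> j) (Poly_Mapping.lookup u (k, j)))"

definition act :: "(nat \<Rightarrow> nat) \<Rightarrow> 'k::field mpoly \<Rightarrow> 'k mpoly" where
  "act \<pi> f = (\<Sum>u\<in>Poly_Mapping.keys f. Poly_Mapping.single (act_mon \<pi> u) (Poly_Mapping.lookup f u))"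

text \<open>
  A chain is a function on the natural numbers of which only the values at \<open>n \<ge> 1\<close> matter.
\<close>

definition inc_invariant_chain :: "nat \<Rightarrow> nat \<Rightarrow> (nat \<Rightarrow> 'k::field mpoly set) \<Rightarrow> bool" where
  "inc_invariant_chain c i I \<longleftrightarrow>
     (\<forall>n\<ge>1. ideal (I n) (R_fin c n)) \<and>
     (\<forall>m n. 1 \<le> m \<longrightarrow> m \<le> n \<longrightarrow> (\<forall>f\<in>I m. \<forall>\<pi>\<in>Inc_seg i m n. act \<pi> f \<in> I n))"

definition ind :: "nat \<Rightarrow> nat \<Rightarrow> (nat \<Rightarrow> 'k::field mpoly set) \<Rightarrow> nat" where
  "ind c i I = (LEAST r. 1 \<le> r \<and>
     (\<forall>n\<ge>r. I n = genideal (R_fin c n) {act \<pi> f | \<pi> f. f \<in> I r \<and> \<pi> \<in> Inc_seg i r n}))"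


section \<open>Monomial orders and initial ideals\<close>

text \<open>
  A monomial order is a multiplicative total order with least element 1. On the monomials of each
  \<open>R\<^sub>n\<close> it is a well-order by Dickson's lemma; on the monomials of \<open>R\<close>, which has infinitely many
  variables, being a well-order is not required.
\<close>

definition monomial_order :: "nat \<Rightarrow> mon rel \<Rightarrow> bool" where
  "monomial_order c ord \<longleftrightarrow>
     linear_order_on (mons c) ord \<and>
     (\<forall>u\<in>mons c. (0, u) \<in> ord) \<and>
     (\<forall>u\<in>mons c. \<forall>v\<in>mons c. \<forall>w\<in>mons c. (u, v) \<in> ord \<longrightarrow> (u + w, v + w) \<in> ord)"

definition respects_Inc :: "nat \<Rightarrow> nat \<Rightarrow> mon rel \<Rightarrow> bool" where
  "respects_Inc c i ord \<longleftrightarrow>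
     (\<forall>\<pi>\<in>Inc i. \<forall>u\<in>mons c. \<forall>v\<in>mons c.
        (u, v) \<in> ord \<longrightarrow> (act_mon \<pi> u, act_mon \<pi> v) \<in> ord)"

definition lead_mon :: "mon rel \<Rightarrow> 'k::field mpoly \<Rightarrow> mon" where
  "lead_mon ord f = (THE u. u \<in> Poly_Mapping.keys f \<and> (\<forall>v\<in>Poly_Mapping.keys f. (v, u) \<in> ord))"

definition initial_chain ::
    "nat \<Rightarrow> mon rel \<Rightarrow> (nat \<Rightarrow> 'k::field mpoly set) \<Rightarrow> nat \<Rightarrow> 'k mpoly set" where
  "initial_chain c ord I n =
     genideal (R_fin c n) {to_poly (lead_mon ord f) | f. f \<in> I n \<and> f \<noteq> 0}"


section \<open>Covers and the invariants \<open>\<gamma>\<^sub>j\<close>\<close>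

definition min_gens :: "nat \<Rightarrow> nat \<Rightarrow> 'k::field mpoly set \<Rightarrow> mon set" where
  "min_gens c n J = (THE G. G \<subseteq> mons_in ({1..c} \<times> {1..n}) \<and>
     genideal (R_fin c n) (to_poly ` G) = J \<and>
     (\<forall>G'. G' \<subset> G \<longrightarrow> genideal (R_fin c n) (to_poly ` G') \<noteq> J))"

definition min_index :: "mon \<Rightarrow> nat" where
  "min_index u = Min (snd ` Poly_Mapping.keys u)"

definition min_gens_above :: "nat \<Rightarrow> nat \<Rightarrow> nat \<Rightarrow> 'k::field mpoly set \<Rightarrow> mon set" where
  "min_gens_above c n j J = {u \<in> min_gens c n J. j < min_index u}"

definition covers :: "nat set \<Rightarrow> mon \<Rightarrow> bool" where
  "covers C u \<longleftrightarrow> (\<exists>k\<in>C. \<exists>l\<ge>1. (k, l) \<in> Poly_Mapping.keys u)"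

definition is_cover :: "nat \<Rightarrow> nat \<Rightarrow> nat \<Rightarrow> 'k::field mpoly set \<Rightarrow> nat set \<Rightarrow> bool" where
  "is_cover c n j J C \<longleftrightarrow> C \<subseteq> {1..c} \<and> (\<forall>u\<in>min_gens_above c n j J. covers C u)"

definition gamma_ideal :: "nat \<Rightarrow> nat \<Rightarrow> nat \<Rightarrow> 'k::field mpoly set \<Rightarrow> enat" where
  "gamma_ideal c n j J =
     (if J = carrier (R_fin c n) then \<infinity> else enat (Min {card C | C. is_cover c n j J C}))"

text \<open>
  For a chain of monomial ideals, \<open>\<gamma>\<^sub>j(J\<^sub>n)\<close> is constant for \<open>n \<ge> ind\<^sup>j\<close>, so the common value
  is the one at \<open>n = ind\<^sup>j\<close>.
\<close>

definition gamma_mon_chain :: "nat \<Rightarrow> nat \<Rightarrow> (nat \<Rightarrow> 'k::field mpoly set) \<Rightarrow> enat" where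
  "gamma_mon_chain c j J = gamma_ideal c (ind c j J) j (J (ind c j J))"

text \<open>
  For arbitrary ideals, the value common to the initial chains with respect to all
  monomial orders respecting \<open>Inc\<^sup>i\<close>.
\<close>

definition gamma_chain :: "nat \<Rightarrow> nat \<Rightarrow> (nat \<Rightarrow> 'k::field mpoly set) \<Rightarrow> enat" where
  "gamma_chain c i I = (THE g. \<forall>ord. monomial_order c ord \<and> respects_Inc c i ord \<longrightarrow>
     gamma_mon_chain c i (initial_chain c ord I) = g)"


section \<open>The chains \<open>J\<^sub>e\<close> and the invariant \<open>\<Gamma>\<^sub>i\<close>\<close>

text \<open>
  An exponent vector in \<open>\<int>\<^sub>\<ge>\<^sub>0\<^sup>c\<close> is a function \<open>e\<close> on the natural numbers of which
  only the values at \<open>1, \<dots>, c\<close> are used.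
\<close>

definition colon_ideal :: "('a, 'b) ring_scheme \<Rightarrow> 'a set \<Rightarrow> 'a \<Rightarrow> 'a set" where
  "colon_ideal A J x = {a \<in> carrier A. a \<otimes>\<^bsub>A\<^esub> x \<in> J}"

definition column_mon :: "nat \<Rightarrow> nat \<Rightarrow> (nat \<Rightarrow> nat) \<Rightarrow> mon" where
  "column_mon c l e = (\<Sum>k=1..c. Poly_Mapping.single (k, l) (e k))"

definition colon_step ::
    "nat \<Rightarrow> nat \<Rightarrow> (nat \<Rightarrow> nat) \<Rightarrow> ('k::field mpoly) ring \<Rightarrow> 'k mpoly set \<Rightarrow> 'k mpoly set" where
  "colon_step c j e A J = genideal A
     (colon_ideal A J (to_poly (column_mon c (Suc j) e)) \<union>
      {to_poly (Poly_Mapping.single (k, Suc j) 1) | k. k \<in> {1..c}})"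

definition colon_chain ::
    "nat \<Rightarrow> nat \<Rightarrow> (nat \<Rightarrow> 'k::field mpoly set) \<Rightarrow> (nat \<Rightarrow> nat) \<Rightarrow> nat \<Rightarrow> 'k mpoly set" where
  "colon_chain c j J e n =
     (if j < n then colon_step c j e (R_fin c n) (J n)
      else carrier (R_fin c n) \<inter> colon_step c j e (R_inf c) (genideal (R_inf c) (J n)))"

text \<open>The chain \<open>H\<^bsub>e\<^sub>1,\<dots>,e\<^sub>k\<^esub>\<close> for the list \<open>[e\<^sub>1, \<dots>, e\<^sub>k]\<close>.\<close>

fun iter_chain :: "nat \<Rightarrow> nat \<Rightarrow> (nat \<Rightarrow> 'k::field mpoly set) \<Rightarrow> (nat \<Rightarrow> nat) list
    \<Rightarrow> nat \<Rightarrow> 'k mpoly set" where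
  "iter_chain c j H [] = H"
| "iter_chain c j H (e # es) = iter_chain c (Suc j) (colon_chain c j H e) es"

text \<open>The set \<open>E(H\<^bsub>e\<^sub>1,\<dots>,e\<^sub>k\<^sub>-\<^sub>1\<^esub>)\<close> for the list \<open>es = [e\<^sub>1, \<dots>, e\<^sub>k\<^sub>-\<^sub>1]\<close>, so that
  \<open>r + k = r + Suc (length es)\<close>.\<close>

definition E_set :: "nat \<Rightarrow> nat \<Rightarrow> nat \<Rightarrow> (nat \<Rightarrow> 'k::field mpoly set) \<Rightarrow> (nat \<Rightarrow> nat) list
    \<Rightarrow> (nat \<Rightarrow> nat) set" where
  "E_set c i r H es =
     {e. iter_chain c i H (es @ [e]) (r + Suc (length es)) \<noteq>
         carrier (R_fin c (r + Suc (length es)))}"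

definition admissible :: "nat \<Rightarrow> nat \<Rightarrow> nat \<Rightarrow> (nat \<Rightarrow> 'k::field mpoly set) \<Rightarrow> (nat \<Rightarrow> nat) list
    \<Rightarrow> bool" where
  "admissible c i r H es \<longleftrightarrow> (\<forall>l<length es. es ! l \<in> E_set c i r H (take l es))"

definition gamma_max :: "nat \<Rightarrow> nat \<Rightarrow> nat \<Rightarrow> (nat \<Rightarrow> 'k::field mpoly set) \<Rightarrow> nat \<Rightarrow> enat" where
  "gamma_max c i r H k =
     Max {gamma_mon_chain c (i + k) (iter_chain c i H es) | es.
            length es = k \<and> admissible c i r H es}"

definition Gamma :: "nat \<Rightarrow> nat \<Rightarrow> nat \<Rightarrow> (nat \<Rightarrow> 'k::field mpoly set) \<Rightarrow> enat" where
  "Gamma c i r H = Max {gamma_max c i r H k | k. 1 \<le> k}"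


section \<open>Cohen-Macaulay rings\<close>

definition regular_sequence :: "('a, 'b) ring_scheme \<Rightarrow> 'a list \<Rightarrow> bool" where
  "regular_sequence A xs \<longleftrightarrow>
     set xs \<subseteq> carrier A \<and>
     (\<forall>l<length xs. \<forall>a\<in>carrier A.
        xs ! l \<otimes>\<^bsub>A\<^esub> a \<in> genideal A (set (take l xs)) \<longrightarrow> a \<in> genideal A (set (take l xs))) \<and>
     genideal A (set xs) \<noteq> carrier A"

definition depth :: "('a, 'b) ring_scheme \<Rightarrow> 'a set \<Rightarrow> enat" where
  "depth A I = Sup {enat (length xs) | xs. set xs \<subseteq> I \<and> regular_sequence A xs}"

definition codim :: "('a, 'b) ring_scheme \<Rightarrow> 'a set \<Rightarrow> enat" where
  "codim A P = Sup {enat n | n. \<exists>Q. (\<forall>l\<le>n. primeideal (Q l) A) \<and>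
     (\<forall>l<n. Q l \<subset> Q (Suc l)) \<and> Q n = P}"

text \<open>
  Eisenbud's definition (Commutative Algebra, Section 18.2). The depth of a maximal ideal \<open>M\<close> is
  that of the local ring \<open>A\<^sub>M\<close>, and its codimension is the dimension of \<open>A\<^sub>M\<close>, so this is the usual
  condition that all localizations at maximal ideals are Cohen-Macaulay local rings.
\<close>

definition cohen_macaulay :: "('a, 'b) ring_scheme \<Rightarrow> bool" where
  "cohen_macaulay A \<longleftrightarrow>
     cring A \<and> noetherian_ring A \<and> (\<forall>M. maximalideal M A \<longrightarrow> depth A M = codim A M)"

end

theory Submission
  imports Defs "HOL-Library.Ramsey" "HOL-Library.Sublist" "HOL-Library.Product_Lexorder"
begin

text \<open>
  For a chain of monomial ideals, \<open>c - \<gamma>\<^sub>j\<close> is the largest number of rows whose variables in the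
  columns after \<open>j\<close> support no monomial of the chain. A pigeonhole argument on columns shows that
  the \<open>n\<close>-th ideal has codimension \<open>\<gamma>\<^sub>j n\<close> up to a bounded error. As passing to an initial ideal
  preserves the codimension, \<open>\<gamma>\<^sub>i\<close> does not depend on the monomial order.

  The vector \<open>e = 0\<close> yields \<open>\<gamma>\<^sub>i \<le> \<Gamma>\<^sub>i\<close>. For the converse, the ideals of an iterated chain are, apart
  from variables of finitely many columns, colon ideals \<open>(H\<^sub>n : w)\<close> by a monomial, so their
  associated primes are associated primes of \<open>H\<^sub>n\<close>. If \<open>R\<^sub>n/H\<^sub>n\<close> is Cohen-Macaulay, these all have the
  codimension of \<open>H\<^sub>n\<close>, and comparing the growth in \<open>n\<close> bounds the invariant of the iterated chain by
  that of \<open>H\<close>.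
\<close>


section \<open>Well-quasi-orders\<close>

text \<open>\<open>ind\<close> and \<open>gamma_chain\<close> are defined by choice and
  \<open>Gamma\<close> by \<open>Max\<close>, so existence has to be settled before anything can be
  compared: a stable index, which comes from Higman's lemma; finite non-empty sets of values; and
  one value for all monomial orders, although the theorem fixes one. The comparison of two orders
  cannot count monomials by degree, since a monomial order need not refine the degree. A positive
  weight takes its place. It is chosen so that the leading monomial has the greatest weight in each
  of finitely many polynomials whose leading monomials generate the initial ideal; multiples of
  these polynomials reach every leading monomial without raising the weight. Cohen-Macaulayness
  enters at the maximal ideal generated by the variables. That the depth there is at most the
  dimension at an associated prime (J : w) rests on two opposite facts: an expression in a regular
  sequence with nonzero constants as coefficients does not kill w in the localization, but modulo (J
  : w) more polynomials than remaining variables satisfy a polynomial relation.\<close>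

definition wqo_on :: "('a \<Rightarrow> 'a \<Rightarrow> bool) \<Rightarrow> 'a set \<Rightarrow> bool" where
  "wqo_on P A \<longleftrightarrow> (\<forall>f::nat \<Rightarrow> 'a. (\<forall>n. f n \<in> A) \<longrightarrow> (\<exists>i j. i < j \<and> P (f i) (f j)))"

lemma wqo_onD:
  assumes "wqo_on P A" "\<And>n. f n \<in> A"
  obtains i j :: nat where "i < j" "P (f i) (f j)"
  using assms unfolding wqo_on_def by blast

lemma wqo_on_subset: "wqo_on P A \<Longrightarrow> B \<subseteq> A \<Longrightarrow> wqo_on P B"
  unfolding wqo_on_def by (meson subsetD)

text \<open>Transitivity of \<open>P\<close> is not assumed, so good pairs do not propagate by
  themselves. Ramsey's theorem yields a subsequence on which all pairs are good or all are bad, and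
  the latter contradicts the hypothesis.\<close>

lemma wqo_on_subseq:
  assumes "wqo_on P A" "\<And>n. f n \<in> A"
  obtains \<phi> :: "nat \<Rightarrow> nat" where "strict_mono \<phi>" "\<And>i j. i < j \<Longrightarrow> P (f (\<phi> i)) (f (\<phi> j))"
proof -
  define col where "col X = (if P (f (Min X)) (f (Max X)) then 0 else 1 :: nat)" for X
  have "\<forall>x\<in>UNIV. \<forall>y\<in>UNIV. x \<noteq> y \<longrightarrow> col {x, y} < 2"
    by (simp add: col_def)
  from Ramsey2[OF infinite_UNIV_nat this] obtain Y t where Y: "infinite Y"
    and t: "\<forall>x\<in>Y. \<forall>y\<in>Y. x \<noteq> y \<longrightarrow> col {x, y} = t"
    by (elim exE conjE) (rule that)
  define \<phi> where "\<phi> = enumerate Y"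
  have mono: "strict_mono \<phi>"
    unfolding \<phi>_def by (rule strict_mono_enumerate[OF Y])
  have inY: "\<phi> n \<in> Y" for n
    unfolding \<phi>_def by (rule enumerate_in_set[OF Y])
  have col: "(P (f (\<phi> i)) (f (\<phi> j))) \<longleftrightarrow> t = 0" if "i < j" for i j
  proof -
    have lt: "\<phi> i < \<phi> j" using mono that by (simp add: strict_mono_less)
    then have "col {\<phi> i, \<phi> j} = t" using t inY[of i] inY[of j] by simp
    moreover have "Min {\<phi> i, \<phi> j} = \<phi> i" "Max {\<phi> i, \<phi> j} = \<phi> j" using lt by auto
    ultimately show ?thesis by (auto simp: col_def split: if_splits)
  qed
  obtain i j where "i < j" "P (f (\<phi> i)) (f (\<phi> j))"
    using wqo_onD[OF assms(1), of "\<lambda>n. f (\<phi> n)"] assms(2) by blast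
  then have "t = 0" using col by blast
  then show thesis using that[OF mono] col by blast
qed

lemma wqo_on_product:
  assumes "wqo_on P A" "wqo_on Q B"
  shows "wqo_on (\<lambda>x y. P (fst x) (fst y) \<and> Q (snd x) (snd y)) (A \<times> B)"
  unfolding wqo_on_def
proof (intro allI impI)
  fix f :: "nat \<Rightarrow> 'a \<times> 'b" assume f: "\<forall>n. f n \<in> A \<times> B"
  obtain \<phi> :: "nat \<Rightarrow> nat" where \<phi>: "strict_mono \<phi>"
    and P: "\<And>i j. i < j \<Longrightarrow> P (fst (f (\<phi> i))) (fst (f (\<phi> j)))"
    using wqo_on_subseq[OF assms(1), of "\<lambda>n. fst (f n)"] f by (metis mem_Times_iff)
  obtain i j where "i < j" "Q (snd (f (\<phi> i))) (snd (f (\<phi> j)))"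
    using wqo_onD[OF assms(2), of "\<lambda>n. snd (f (\<phi> n))"] f by (metis mem_Times_iff)
  then show "\<exists>i j. i < j \<and> P (fst (f i)) (fst (f j)) \<and> Q (snd (f i)) (snd (f j))"
    using P \<phi> by (metis strict_mono_less)
qed

lemma wqo_on_Un:
  assumes "wqo_on P A" "wqo_on P B"
  shows "wqo_on P (A \<union> B)"
  unfolding wqo_on_def
proof (intro allI impI)
  fix f :: "nat \<Rightarrow> 'a" assume f: "\<forall>n. f n \<in> A \<union> B"
  have main: "\<exists>i j. i < j \<and> P (f i) (f j)" if C: "infinite {n. f n \<in> C}" "wqo_on P C" for C
  proof -
    let ?e = "enumerate {n. f n \<in> C}"
    have "f (?e n) \<in> C" for n using enumerate_in_set[OF C(1), of n] by simp
    then obtain i j where "i < j" "P (f (?e i)) (f (?e j))"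
      using wqo_onD[OF C(2), of "\<lambda>n. f (?e n)"] by blast
    then show ?thesis using enumerate_mono[OF _ C(1)] by blast
  qed
  have "{n. f n \<in> A} \<union> {n. f n \<in> B} = UNIV" using f by auto
  then have "infinite {n. f n \<in> A} \<or> infinite {n. f n \<in> B}"
    by (metis finite_UnI infinite_UNIV_nat)
  then show "\<exists>i j. i < j \<and> P (f i) (f j)" using main assms by blast
qed

text \<open>\<open>R y x\<close> says that y is a code of x. A relation instead of a function lets
  the code carry facts about x, which \<open>impl\<close> may then use.\<close>

lemma wqo_on_transfer:
  assumes "wqo_on Q B"
    and ex: "\<And>x::'a. x \<in> A \<Longrightarrow> \<exists>y\<in>B. R y x"
    and impl: "\<And>y y' x x'. Q y y' \<Longrightarrow> R y x \<Longrightarrow> R y' x' \<Longrightarrow> P x x'"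
  shows "wqo_on P A"
  unfolding wqo_on_def
proof (intro allI impI)
  fix f :: "nat \<Rightarrow> 'a" assume f: "\<forall>n. f n \<in> A"
  then have "\<forall>n. \<exists>y\<in>B. R y (f n)" using ex by blast
  then obtain g where g: "\<And>n. g n \<in> B" "\<And>n. R (g n) (f n)" by metis
  obtain i j where "i < j" "Q (g i) (g j)" using wqo_onD[OF assms(1), of g] g(1) by blast
  then show "\<exists>i j. i < j \<and> P (f i) (f j)" using impl g(2) by blast
qed

text \<open>Otherwise one could choose forever an element with no earlier choice below it, a
  sequence without a good pair.\<close>

lemma wqo_on_finite_basis:
  assumes "wqo_on P A"
  shows "\<exists>B. finite B \<and> B \<subseteq> A \<and> (\<forall>x\<in>A. \<exists>b\<in>B. P b x)"
proof (rule ccontr)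
  assume "\<not> ?thesis"
  then have "\<forall>B. finite B \<longrightarrow> B \<subseteq> A \<longrightarrow> (\<exists>x\<in>A. \<forall>b\<in>B. \<not> P b x)" by simp
  then have ex: "\<exists>x. x \<in> A \<and> (\<forall>b\<in>B. \<not> P b x)" if "finite B" "B \<subseteq> A" for B
    using that unfolding Bex_def by simp
  define g where "g B = (SOME x. x \<in> A \<and> (\<forall>b\<in>B. \<not> P b x))" for B
  have g: "g B \<in> A \<and> (\<forall>b\<in>B. \<not> P b (g B))" if "finite B" "B \<subseteq> A" for B
    unfolding g_def by (rule someI_ex[OF ex[OF that]])
  \<comment> \<open>\<open>F n\<close> lists the first n choices, the latest at the head.\<close>
  define F where "F = rec_nat [] (\<lambda>_ xs. g (set xs) # xs)"
  have F: "F 0 = []" "F (Suc n) = g (set (F n)) # F n" for n by (simp_all add: F_def)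
  have sub: "set (F n) \<subseteq> A" for n
    by (induction n) (use g F in auto)
  have mem: "g (set (F i)) \<in> set (F j)" if "i < j" for i j
    using that by (induction j) (auto simp: F less_Suc_eq)
  have "g (set (F n)) \<in> A" for n using g[OF finite_set sub] by blast
  from wqo_onD[OF assms, of "\<lambda>n. g (set (F n))", OF this] obtain i j
    where "i < j" "P (g (set (F i))) (g (set (F j)))" .
  then show False using g[OF finite_set sub] mem by blast
qed

lemma wqo_on_nat_le: "wqo_on (\<le>) (UNIV :: nat set)"
  unfolding wqo_on_def
proof (intro allI impI)
  fix f :: "nat \<Rightarrow> nat"
  obtain i where "\<And>j. f i \<le> f j" using ex_has_least_nat[of "\<lambda>_. True" 0 f] by blast
  then have "f i \<le> f (Suc i)" by blast
  then show "\<exists>i j. i < j \<and> f i \<le> f j" by blast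
qed

lemma wqo_on_finite:
  assumes "finite A" shows "wqo_on (=) A"
  unfolding wqo_on_def
proof (intro allI impI)
  fix f :: "nat \<Rightarrow> 'a" assume "\<forall>n. f n \<in> A"
  then have "finite (range f)" using assms by (metis finite_subset image_subsetI)
  then have "\<not> inj f" using finite_imageD infinite_UNIV_nat by blast
  then obtain i j where "i \<noteq> j" "f i = f j" unfolding inj_def by blast
  then show "\<exists>i j. i < j \<and> f i = f j" by (metis linorder_neqE_nat)
qed

section \<open>Dickson's and Higman's lemmas\<close>

lemma dickson:
  fixes X :: "'x set"
  assumes "finite X"
  shows "wqo_on (\<lambda>f g. \<forall>x\<in>X. f x \<le> g x) (UNIV :: ('x \<Rightarrow> nat) set)"
  using assms
proof (induction X)
  case empty
  show ?case by (auto simp: wqo_on_def)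
next
  case (insert x X)
  have "wqo_on (\<lambda>a b. fst a \<le> fst b \<and> (\<forall>x\<in>X. snd a x \<le> snd b x))
      (UNIV \<times> UNIV :: (nat \<times> ('x \<Rightarrow> nat)) set)"
    by (rule wqo_on_product[OF wqo_on_nat_le insert.IH])
  then show ?case
    by (rule wqo_on_transfer[where R = "\<lambda>y f. y = (f x, f)"]) auto
qed

text \<open>The elements a chosen along an infinite descent would form a sequence none of whose
  members lies above an earlier one. Induction along this relation replaces a minimal bad sequence
  in the proof of Higman's lemma.\<close>

lemma wf_residuals:
  assumes "wqo_on P A"
  shows "wf {(C, B). B \<subseteq> A \<and> (\<exists>a\<in>B. C = {b \<in> B. \<not> P a b})}"
  unfolding wf_iff_no_infinite_down_chain
proof
  assume "\<exists>F. \<forall>i. (F (Suc i), F i) \<in> {(C, B). B \<subseteq> A \<and> (\<exists>a\<in>B. C = {b \<in> B. \<not> P a b})}"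
  then obtain F where F: "\<And>i. F i \<subseteq> A \<and> (\<exists>a\<in>F i. F (Suc i) = {b \<in> F i. \<not> P a b})"
    by auto
  then have sub: "\<And>i. F i \<subseteq> A" by auto
  have "\<exists>a. \<forall>i. a i \<in> F i \<and> F (Suc i) = {b \<in> F i. \<not> P (a i) b}"
    using F by (intro choice allI) (simp add: Bex_def)
  then obtain a where a: "\<And>i::nat. a i \<in> F i" "\<And>i. F (Suc i) = {b \<in> F i. \<not> P (a i) b}"
    by auto
  have "F (Suc i) \<subseteq> F i" for i using a(2) by blast
  then have dec: "F j \<subseteq> F i" if "i \<le> j" for i j
    using lift_Suc_antimono_le[of F] that by blast
  obtain i j where "i < j" "P (a i) (a j)"
    using wqo_onD[OF assms, of a] a(1) sub by blast
  moreover have "a j \<in> F (Suc i)" using a(1)[of j] dec[of "Suc i" j] \<open>i < j\<close> by auto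
  ultimately show False using a(2) by blast
qed

text \<open>The alphabets decrease along the residuals \<open>{b. \<not> P a b}\<close>; a list avoiding \<open>a # w\<close> is either
  a list over the residual of \<open>a\<close>, or such a list followed by a letter and a list avoiding \<open>w\<close>.\<close>

theorem higman:
  assumes "wqo_on P A"
  shows "wqo_on (list_emb P) (lists A)"
proof -
  have "B \<subseteq> A \<longrightarrow> wqo_on (list_emb P) (lists B)" for B
  proof (induction B rule: wf_induct_rule[OF wf_residuals[OF assms]])
    case (1 B)
    show ?case
    proof
      assume B: "B \<subseteq> A"
      have wqoB: "wqo_on P B" using assms B by (rule wqo_on_subset)
      \<comment> \<open>In a sequence without good pairs all later words avoid the first one, so it
        is enough to treat the words that avoid a fixed \<open>w\<close>.\<close>
      have avoid: "wqo_on (list_emb P) {x \<in> lists B. \<not> list_emb P w x}" if "w \<in> lists B" for w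
        using that
      proof (induction w)
        case Nil
        then show ?case by (simp add: wqo_on_def)
      next
        case (Cons a w)
        let ?B = "{b \<in> B. \<not> P a b}"
        have aB: "a \<in> B" using Cons by simp
        have resid: "wqo_on (list_emb P) (lists ?B)"
          using 1[of ?B] aB B by blast
        have avw: "wqo_on (list_emb P) {x \<in> lists B. \<not> list_emb P w x}"
          using Cons by simp
        let ?T = "{x0 @ b # x1 | x0 b x1. x0 \<in> lists ?B \<and> b \<in> B \<and>
           x1 \<in> {x \<in> lists B. \<not> list_emb P w x}}"
        have "wqo_on (list_emb P) ?T"
        proof (rule wqo_on_transfer[OF wqo_on_product[OF resid wqo_on_product[OF wqoB avw]],
              where R = "\<lambda>y x. x = fst y @ fst (snd y) # snd (snd y)"], goal_cases)
          case (1 x)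
          then obtain x0 b x1 where "x = x0 @ b # x1" "x0 \<in> lists ?B" "b \<in> B"
            "x1 \<in> {x \<in> lists B. \<not> list_emb P w x}" by blast
          then show ?case by (intro bexI[of _ "(x0, b, x1)"]) auto
        next
          case (2 y y' x x')
          then show ?case by (simp add: list_emb_append_mono list_emb_Cons2)
        qed
        then have "wqo_on (list_emb P) (lists ?B \<union> ?T)"
          by (rule wqo_on_Un[OF resid])
        moreover have "{x \<in> lists B. \<not> list_emb P (a # w) x} \<subseteq> lists ?B \<union> ?T"
        proof
          fix x assume x: "x \<in> {x \<in> lists B. \<not> list_emb P (a # w) x}"
          show "x \<in> lists ?B \<union> ?T"
          proof (cases "\<exists>b\<in>set x. P a b")
            case False
            then show ?thesis using x by auto
          next
            case True
            then obtain x0 b x1 where s: "x = x0 @ b # x1" "P a b" "\<forall>y\<in>set x0. \<not> P a y"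
              using split_list_first_prop[of x "P a"] by blast
            have "\<not> list_emb P w x1"
            proof
              assume "list_emb P w x1"
              then have "list_emb P (a # w) x" using s by (auto intro: list_emb_append2)
              then show False using x by simp
            qed
            moreover have "x0 \<in> lists ?B" "b \<in> B" "x1 \<in> lists B" using x s by auto
            ultimately have "x \<in> ?T" using s(1) by blast
            then show ?thesis by simp
          qed
        qed
        ultimately show ?case by (rule wqo_on_subset)
      qed
      show "wqo_on (list_emb P) (lists B)"
        unfolding wqo_on_def
      proof (intro allI impI)
        fix f :: "nat \<Rightarrow> 'a list" assume f: "\<forall>n. f n \<in> lists B"
        show "\<exists>i j. i < j \<and> list_emb P (f i) (f j)"
        proof (cases "\<exists>n. list_emb P (f 0) (f (Suc n))")
          case True
          then show ?thesis by blast
        next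
          case False
          then have g: "f (Suc n) \<in> {x \<in> lists B. \<not> list_emb P (f 0) x}" for n using f by blast
          have "f 0 \<in> lists B" using f by blast
          from wqo_onD[OF avoid[OF this], of "\<lambda>n. f (Suc n)", OF g] obtain i j
            where "i < j" "list_emb P (f (Suc i)) (f (Suc j))" .
          then have "Suc i < Suc j \<and> list_emb P (f (Suc i)) (f (Suc j))" by simp
          then show ?thesis by blast
        qed
      qed
    qed
  qed
  then show ?thesis by blast
qed

text \<open>The map on positions is made total and strictly increasing because it is to be turned
  into a member of \<open>Inc\<close>.\<close>

lemma list_emb_strict_mono:
  assumes "list_emb P xs ys"
  shows "\<exists>\<pi>. strict_mono \<pi> \<and> (\<forall>l<length xs. \<pi> l < length ys \<and> P (xs ! l) (ys ! \<pi> l))"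
  using assms
proof induction
  case (list_emb_Nil ys)
  show ?case by (intro exI[of _ id]) (simp add: strict_mono_def)
next
  case (list_emb_Cons xs ys y)
  then obtain \<pi> where \<pi>: "strict_mono \<pi>" "\<forall>l<length xs. \<pi> l < length ys \<and> P (xs ! l) (ys ! \<pi> l)"
    by blast
  then show ?case by (intro exI[of _ "\<lambda>l. Suc (\<pi> l)"]) (simp add: strict_mono_def)
next
  case (list_emb_Cons2 x y xs ys)
  then obtain \<pi> where \<pi>: "strict_mono \<pi>" "\<forall>l<length xs. \<pi> l < length ys \<and> P (xs ! l) (ys ! \<pi> l)"
    by blast
  let ?\<pi> = "\<lambda>l. case l of 0 \<Rightarrow> 0 | Suc l \<Rightarrow> Suc (\<pi> l)"
  have "strict_mono ?\<pi>" using \<pi>(1) by (auto simp: strict_mono_def split: nat.split)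
  moreover have "\<forall>l<length (x # xs). ?\<pi> l < length (y # ys) \<and> P ((x # xs) ! l) ((y # ys) ! ?\<pi> l)"
    using \<pi>(2) list_emb_Cons2.hyps by (auto split: nat.split)
  ultimately show ?case by blast
qed


section \<open>Monomials and monomial ideals\<close>

abbreviation lookup where "lookup \<equiv> Poly_Mapping.lookup"
abbreviation keys where "keys \<equiv> Poly_Mapping.keys"
abbreviation single where "single \<equiv> Poly_Mapping.single"

definition mdvd :: "mon \<Rightarrow> mon \<Rightarrow> bool" where
  "mdvd u v \<longleftrightarrow> (\<forall>x. lookup u x \<le> lookup v x)"

lemma mdvd_refl [simp]: "mdvd u u"
  by (simp add: mdvd_def)

lemma mdvd_trans: "mdvd u v \<Longrightarrow> mdvd v w \<Longrightarrow> mdvd u w"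
  unfolding mdvd_def by (meson le_trans)

lemma mdvd_antisym: "mdvd u v \<Longrightarrow> mdvd v u \<Longrightarrow> u = v"
  unfolding mdvd_def by (intro poly_mapping_eqI) (meson le_antisym)

lemma mdvd_add [simp]: "mdvd u (u + w)" "mdvd u (w + u)"
  by (simp_all add: mdvd_def lookup_add)

lemma mdvd_add_mono: "mdvd u v \<Longrightarrow> mdvd u' v' \<Longrightarrow> mdvd (u + u') (v + v')"
  unfolding mdvd_def by (simp add: lookup_add add_mono)

lemma mdvd_diff: "mdvd u v \<Longrightarrow> u + (v - u) = v"
  unfolding mdvd_def by (intro poly_mapping_eqI) (simp add: lookup_add lookup_minus del: split_paired_All)

lemma mdvd_0 [simp]: "mdvd 0 u"
  by (simp add: mdvd_def)

lemma mdvd_keys: "mdvd u v \<Longrightarrow> keys u \<subseteq> keys v"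
  unfolding mdvd_def by (metis in_keys_iff le_zero_eq subsetI)

lemma keys_add_mon: "keys (u + v :: mon) = keys u \<union> keys v"
  by (auto simp: in_keys_iff lookup_add)

lemma mons_in_add [simp]: "u + v \<in> mons_in V \<longleftrightarrow> u \<in> mons_in V \<and> v \<in> mons_in V"
  by (auto simp: mons_in_def keys_add_mon)

lemma mons_in_0 [simp]: "0 \<in> mons_in V"
  by (simp add: mons_in_def)

lemma mons_in_mono: "u \<in> mons_in V \<Longrightarrow> V \<subseteq> W \<Longrightarrow> u \<in> mons_in W"
  by (auto simp: mons_in_def)

lemma mons_in_mdvd: "mdvd u v \<Longrightarrow> v \<in> mons_in V \<Longrightarrow> u \<in> mons_in V"
  using mdvd_keys unfolding mons_in_def by blast

lemma mons_in_diff: "v \<in> mons_in V \<Longrightarrow> v - u \<in> mons_in V"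
  by (rule mons_in_mdvd) (auto simp: mdvd_def lookup_minus)

lemma mons_in_singleI: "x \<in> V \<Longrightarrow> single x e \<in> mons_in V"
  by (simp add: mons_in_def)

definition mdeg :: "mon \<Rightarrow> nat" where
  "mdeg u = (\<Sum>x\<in>keys u. lookup u x)"

lemma mdeg_superset: "finite X \<Longrightarrow> keys u \<subseteq> X \<Longrightarrow> mdeg u = (\<Sum>x\<in>X. lookup u x)"
  unfolding mdeg_def by (rule sum.mono_neutral_left) (auto simp: in_keys_iff)

lemma mdeg_add: "mdeg (u + v) = mdeg u + mdeg v"
proof -
  let ?X = "keys u \<union> keys v"
  have "mdeg (u + v) = (\<Sum>x\<in>?X. lookup (u + v) x)"
    by (rule mdeg_superset) (auto simp: keys_add_mon)
  also have "\<dots> = (\<Sum>x\<in>?X. lookup u x) + (\<Sum>x\<in>?X. lookup v x)"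
    by (simp add: lookup_add sum.distrib)
  also have "\<dots> = mdeg u + mdeg v"
    by (simp add: mdeg_superset[of ?X])
  finally show ?thesis .
qed

lemma mdeg_eq_0 [simp]: "mdeg u = 0 \<longleftrightarrow> u = 0"
  by (auto simp: mdeg_def in_keys_iff poly_mapping_eq_iff fun_eq_iff)

lemma mdeg_less: "mdvd u v \<Longrightarrow> u \<noteq> v \<Longrightarrow> mdeg u < mdeg v"
  by (metis mdvd_diff mdeg_add add.right_neutral mdeg_eq_0 less_add_same_cancel1 neq0_conv)


subsection \<open>The action on monomials\<close>

lemma lookup_act_mon:
  assumes "inj \<pi>"
  shows "lookup (act_mon \<pi> u) (k, j) = (if j \<in> range \<pi> then lookup u (k, inv_into UNIV \<pi> j) else 0)"
proof -
  have "lookup (act_mon \<pi> u) (k, j)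
      = (\<Sum>x\<in>keys u. lookup (single (fst x, \<pi> (snd x)) (lookup u x)) (k, j))"
    unfolding act_mon_def by (simp add: lookup_sum case_prod_unfold)
  also have "\<dots> = (\<Sum>x\<in>keys u. if j \<in> range \<pi> \<and> x = (k, inv_into UNIV \<pi> j) then lookup u x else 0)"
    by (rule sum.cong) (use assms in \<open>auto simp: lookup_single when_def\<close>)
  also have "\<dots> = (if j \<in> range \<pi> then lookup u (k, inv_into UNIV \<pi> j) else 0)"
    by (auto simp: in_keys_iff)
  finally show ?thesis .
qed

lemma lookup_act_mon_image [simp]: "inj \<pi> \<Longrightarrow> lookup (act_mon \<pi> u) (k, \<pi> l) = lookup u (k, l)"
  by (simp add: lookup_act_mon)

lemma keys_act_mon:
  assumes "inj \<pi>" shows "keys (act_mon \<pi> u) = (\<lambda>(k, l). (k, \<pi> l)) ` keys u"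
proof -
  have "x \<in> keys (act_mon \<pi> u) \<longleftrightarrow> x \<in> (\<lambda>(k, l). (k, \<pi> l)) ` keys u" for x
  proof (cases x)
    case (Pair k j)
    then show ?thesis
      using assms by (force simp: in_keys_iff lookup_act_mon image_iff split: if_splits)
  qed
  then show ?thesis by blast
qed

lemma act_mon_eqI:
  assumes "inj \<pi>" "\<And>k l. lookup v (k, \<pi> l) = lookup u (k, l)"
    "\<And>k j. j \<notin> range \<pi> \<Longrightarrow> lookup v (k, j) = 0"
  shows "act_mon \<pi> u = v"
proof (rule poly_mapping_eqI)
  fix x show "lookup (act_mon \<pi> u) x = lookup v x"
  proof (cases x)
    case (Pair k j)
    show ?thesis using assms unfolding Pair
      by (cases "j \<in> range \<pi>") (auto simp: lookup_act_mon)
  qed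
qed

lemma act_mon_add: "inj \<pi> \<Longrightarrow> act_mon \<pi> (u + v) = act_mon \<pi> u + act_mon \<pi> v"
  by (rule act_mon_eqI) (auto simp: lookup_add lookup_act_mon)

lemma act_mon_comp:
  assumes "inj \<pi>" "inj \<sigma>" shows "act_mon \<pi> (act_mon \<sigma> u) = act_mon (\<pi> \<circ> \<sigma>) u"
proof (rule sym, rule act_mon_eqI)
  show "inj (\<pi> \<circ> \<sigma>)" using assms by (rule inj_compose)
  show "lookup (act_mon \<pi> (act_mon \<sigma> u)) (k, (\<pi> \<circ> \<sigma>) l) = lookup u (k, l)" for k l
    using assms by simp
  show "lookup (act_mon \<pi> (act_mon \<sigma> u)) (k, j) = 0" if "j \<notin> range (\<pi> \<circ> \<sigma>)" for k j
    using that assms by (auto simp: lookup_act_mon)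
qed

lemma act_mon_cong:
  assumes "inj \<pi>" "inj \<sigma>" "\<And>k l. (k, l) \<in> keys u \<Longrightarrow> \<pi> l = \<sigma> l"
  shows "act_mon \<pi> u = act_mon \<sigma> u"
  unfolding act_mon_def by (rule sum.cong) (use assms(3) in auto)

lemma act_mon_id [simp]: "act_mon (\<lambda>l. l) u = u"
  by (rule act_mon_eqI) auto

lemma mdvd_act_mon: "inj \<pi> \<Longrightarrow> mdvd u v \<Longrightarrow> mdvd (act_mon \<pi> u) (act_mon \<pi> v)"
  unfolding mdvd_def by (auto simp: lookup_act_mon)

lemma act_mon_inj: "inj \<pi> \<Longrightarrow> act_mon \<pi> u = act_mon \<pi> v \<Longrightarrow> u = v"
  by (metis lookup_act_mon_image poly_mapping_eqI surj_pair)

lemma Inc_inj: "\<pi> \<in> Inc i \<Longrightarrow> inj \<pi>"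
  by (simp add: Inc_def strict_mono_imp_inj_on)

lemma Inc_seg_Inc: "\<pi> \<in> Inc_seg i m n \<Longrightarrow> \<pi> \<in> Inc i"
  by (simp add: Inc_seg_def)

lemma Inc_less: "\<pi> \<in> Inc i \<Longrightarrow> \<pi> a < \<pi> b \<longleftrightarrow> a < b"
  by (simp add: Inc_def strict_mono_less)

lemma Inc_le: "\<pi> \<in> Inc i \<Longrightarrow> \<pi> a \<le> \<pi> b \<longleftrightarrow> a \<le> b"
  by (simp add: Inc_def strict_mono_less_eq)

lemma Inc_fix: "\<pi> \<in> Inc i \<Longrightarrow> j \<le> i \<Longrightarrow> \<pi> j = j"
  by (simp add: Inc_def)

lemma Inc_above: "\<pi> \<in> Inc i \<Longrightarrow> i < \<pi> l \<longleftrightarrow> i < l"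
  using Inc_less[of \<pi> i i l] Inc_fix[of \<pi> i i] by simp

lemma Inc_pos: "\<pi> \<in> Inc i \<Longrightarrow> 1 \<le> \<pi> l \<longleftrightarrow> 1 \<le> l"
  using Inc_less[of \<pi> i 0 l] Inc_fix[of \<pi> i 0] by (simp add: Suc_le_eq)

lemma Inc_ge: "\<pi> \<in> Inc i \<Longrightarrow> l \<le> \<pi> l"
  by (simp add: Inc_def strict_mono_imp_increasing)

lemma Inc_comp: "\<pi> \<in> Inc i \<Longrightarrow> \<sigma> \<in> Inc i \<Longrightarrow> \<pi> \<circ> \<sigma> \<in> Inc i"
  by (auto simp: Inc_def strict_mono_def)

lemma id_Inc_seg: "m \<le> n \<Longrightarrow> (\<lambda>l. l) \<in> Inc_seg i m n"
  by (simp add: Inc_seg_def Inc_def strict_mono_def)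

abbreviation vars :: "nat \<Rightarrow> nat \<Rightarrow> (nat \<times> nat) set" where
  "vars c n \<equiv> {1..c} \<times> {1..n}"

lemma act_mon_mons_in:
  assumes "\<pi> \<in> Inc_seg i m n" "u \<in> mons_in (vars c m)"
  shows "act_mon \<pi> u \<in> mons_in (vars c n)"
proof -
  have \<pi>: "\<pi> \<in> Inc i" "\<pi> m \<le> n" using assms by (auto simp: Inc_seg_def)
  have "1 \<le> \<pi> l \<and> \<pi> l \<le> n" if "1 \<le> l" "l \<le> m" for l
    using that \<pi> Inc_pos[OF \<pi>(1)] Inc_le[OF \<pi>(1), of l m] by simp
  then show ?thesis
    using assms(2) by (force simp: mons_in_def keys_act_mon[OF Inc_inj[OF \<pi>(1)]])
qed


subsection \<open>Polynomials and monomial ideals\<close>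

lemma poly_decomp: "f = (\<Sum>u\<in>keys f. single u (lookup f u))"
  by (rule poly_mapping_eqI) (auto simp: lookup_sum lookup_single when_def in_keys_iff)

lemma lookup_single_times_add:
  fixes f :: "'k::field mpoly"
  shows "lookup (single w a * f) (w + u) = a * lookup f u"
proof -
  have "single w a * f = (\<Sum>v\<in>keys f. single (w + v) (a * lookup f v))"
    by (subst poly_decomp[of f]) (simp add: sum_distrib_left mult_single)
  then have "lookup (single w a * f) (w + u) = (\<Sum>v\<in>keys f. if v = u then a * lookup f v else 0)"
    by (simp add: lookup_sum lookup_single when_def)
  also have "\<dots> = a * lookup f u" by (auto simp: in_keys_iff)
  finally show ?thesis .
qed

lemma keys_single_times:
  fixes f :: "'k::field mpoly"
  assumes "a \<noteq> 0" shows "keys (single w a * f) = (\<lambda>u. w + u) ` keys f"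
proof
  show "keys (single w a * f) \<subseteq> (\<lambda>u. w + u) ` keys f"
    using keys_mult[of "single w a" f] assms by auto
  show "(\<lambda>u. w + u) ` keys f \<subseteq> keys (single w a * f)"
    using assms by (auto simp: in_keys_iff lookup_single_times_add)
qed

lemma keys_times_single: "keys (f * to_poly w :: 'k::field mpoly) = (\<lambda>u. u + w) ` keys f"
  using keys_single_times[of 1 w f] by (simp add: mult.commute add.commute)

lemma keys_uminus [simp]: "keys (- f :: 'k::field mpoly) = keys f"
  by (auto simp: in_keys_iff)

lemma keys_sum_subset: "keys (sum f A) \<subseteq> (\<Union>a\<in>A. keys (f a))"
  by (induction A rule: infinite_finite_induct) (use keys_add in fastforce)+

lemma poly_ring_simps [simp]:
  "carrier (poly_ring V) = {f. keys f \<subseteq> mons_in V}"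
  "mult (poly_ring V) = (*)" "one (poly_ring V) = 1" "zero (poly_ring V) = 0" "add (poly_ring V) = (+)"
  by (simp_all add: poly_ring_def)

lemma poly_ring_times_closed:
  "keys f \<subseteq> mons_in V \<Longrightarrow> keys g \<subseteq> mons_in V \<Longrightarrow> keys (f * g :: 'k::field mpoly) \<subseteq> mons_in V"
  using keys_mult[of f g] by fastforce

lemma poly_ring_cring: "cring (poly_ring V :: 'k::field mpoly ring)"
proof (rule cringI)
  show "abelian_group (poly_ring V :: 'k mpoly ring)"
  proof (rule abelian_groupI)
    fix f g :: "'k mpoly"
    assume "f \<in> carrier (poly_ring V)" "g \<in> carrier (poly_ring V)"
    then show "f \<oplus>\<^bsub>poly_ring V\<^esub> g \<in> carrier (poly_ring V)"
      using keys_add[of f g] by auto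
  next
    fix f :: "'k mpoly" assume "f \<in> carrier (poly_ring V)"
    then show "\<exists>g\<in>carrier (poly_ring V). g \<oplus>\<^bsub>poly_ring V\<^esub> f = \<zero>\<^bsub>poly_ring V\<^esub>"
      by (intro bexI[of _ "- f"]) auto
  qed (auto simp: add_ac)
  show "comm_monoid (poly_ring V :: 'k mpoly ring)"
    by (rule comm_monoidI) (auto simp: mult_ac poly_ring_times_closed[THEN subsetD])
qed (auto simp: algebra_simps)

text \<open>A monomial ideal is encoded by the set of its monomials, with the empty set for the zero
  ideal. Chains and colons are computed on these sets; \<open>polys\<close> translates back.\<close>

definition upset :: "(nat \<times> nat) set \<Rightarrow> mon set \<Rightarrow> bool" where
  "upset V L \<longleftrightarrow> L \<subseteq> mons_in V \<and> (\<forall>u\<in>L. \<forall>v\<in>mons_in V. mdvd u v \<longrightarrow> v \<in> L)"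

definition up :: "(nat \<times> nat) set \<Rightarrow> mon set \<Rightarrow> mon set" where
  "up V S = {v \<in> mons_in V. \<exists>u\<in>S. mdvd u v}"

definition polys :: "mon set \<Rightarrow> 'k::field mpoly set" where
  "polys L = {f. keys f \<subseteq> L}"

lemma upset_up [simp]: "upset V (up V S)"
  unfolding upset_def up_def using mdvd_trans by blast

lemma upsetD: "upset V L \<Longrightarrow> u \<in> L \<Longrightarrow> v \<in> mons_in V \<Longrightarrow> mdvd u v \<Longrightarrow> v \<in> L"
  by (auto simp: upset_def)

lemma upset_mons: "upset V L \<Longrightarrow> u \<in> L \<Longrightarrow> u \<in> mons_in V"
  by (auto simp: upset_def)

lemma to_poly_polys [simp]: "to_poly u \<in> polys L \<longleftrightarrow> u \<in> L"
  by (simp add: polys_def)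

lemma polys_eq_iff [simp]: "(polys L :: 'k::field mpoly set) = polys L' \<longleftrightarrow> L = L'"
proof
  assume *: "(polys L :: 'k mpoly set) = polys L'"
  have "u \<in> L \<longleftrightarrow> u \<in> L'" for u
    using * by (metis to_poly_polys)
  then show "L = L'" by blast
qed simp

lemma carrier_polys: "carrier (poly_ring V) = polys (mons_in V)"
  by (simp add: polys_def)

lemma polys_carrier_iff:
  assumes "upset V L"
  shows "(polys L :: 'k::field mpoly set) = carrier (poly_ring V) \<longleftrightarrow> 0 \<in> L"
proof -
  have "L = mons_in V \<longleftrightarrow> 0 \<in> L"
    using assms by (auto simp: upset_def)
  then show ?thesis by (simp only: carrier_polys polys_eq_iff)
qed

lemma polys_ideal:
  assumes "upset V L" shows "ideal (polys L :: 'k::field mpoly set) (poly_ring V)"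
proof -
  interpret cring "poly_ring V :: 'k mpoly ring" by (rule poly_ring_cring)
  have sub: "L \<subseteq> mons_in V" using assms by (simp add: upset_def)
  have mult: "g * f \<in> polys L" if "f \<in> polys L" "g \<in> carrier (poly_ring V)" for f g :: "'k mpoly"
  proof -
    have "u + v \<in> L" if "u \<in> keys g" "v \<in> keys f" for u v
    proof (rule upsetD[OF assms])
      show "v \<in> L" using that \<open>f \<in> polys L\<close> by (auto simp: polys_def)
      then show "u + v \<in> mons_in V" using sub that \<open>g \<in> carrier (poly_ring V)\<close> by auto
    qed simp
    then show ?thesis using keys_mult[of g f] by (fastforce simp: polys_def)
  qed
  show ?thesis
  proof (rule idealI)
    show "ring (poly_ring V :: 'k mpoly ring)" by (rule ring_axioms)
    show "subgroup (polys L :: 'k mpoly set) (add_monoid (poly_ring V))"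
    proof (rule add.subgroupI)
      show "(polys L :: 'k mpoly set) \<subseteq> carrier (poly_ring V)" using sub by (auto simp: polys_def)
      have "(0 :: 'k mpoly) \<in> polys L" by (simp add: polys_def)
      then show "(polys L :: 'k mpoly set) \<noteq> {}" by blast
    next
      fix f :: "'k mpoly" assume f: "f \<in> polys L"
      have "f \<oplus>\<^bsub>poly_ring V\<^esub> (- f) = \<zero>\<^bsub>poly_ring V\<^esub>" by simp
      moreover have "f \<in> carrier (poly_ring V)" "- f \<in> carrier (poly_ring V)"
        using f sub by (auto simp: polys_def)
      ultimately have "\<ominus>\<^bsub>poly_ring V\<^esub> f = - f" by (metis minus_equality a_comm)
      then show "\<ominus>\<^bsub>poly_ring V\<^esub> f \<in> polys L" using f by (simp add: polys_def)
    next
      fix f g :: "'k mpoly" assume "f \<in> polys L" "g \<in> polys L"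
      then show "f \<oplus>\<^bsub>poly_ring V\<^esub> g \<in> polys L"
        using keys_add[of f g] by (auto simp: polys_def)
    qed
  qed (use mult in \<open>simp_all add: mult.commute\<close>)
qed

lemma ideal_plus: "ideal J (poly_ring V) \<Longrightarrow> f \<in> J \<Longrightarrow> g \<in> J \<Longrightarrow> f + g \<in> J"
  using additive_subgroup.a_closed[OF ideal.axioms(1)] by fastforce

lemma ideal_0: "ideal J (poly_ring V) \<Longrightarrow> 0 \<in> J"
  using additive_subgroup.zero_closed[OF ideal.axioms(1)] by fastforce

lemma ideal_times: "ideal J (poly_ring V) \<Longrightarrow> f \<in> J \<Longrightarrow> keys g \<subseteq> mons_in V \<Longrightarrow> g * f \<in> J"
  using ideal.I_l_closed[of J "poly_ring V" f g] by simp

lemma ideal_carrier: "ideal J (poly_ring V) \<Longrightarrow> f \<in> J \<Longrightarrow> keys f \<subseteq> mons_in V"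
  using additive_subgroup.a_subset[OF ideal.axioms(1)] by fastforce

lemma ideal_sum:
  assumes "ideal J (poly_ring V)" "\<And>a. a \<in> A \<Longrightarrow> f a \<in> J"
  shows "sum f A \<in> J"
  using assms(2)
  by (induction A rule: infinite_finite_induct) (auto intro: ideal_0[OF assms(1)] ideal_plus[OF assms(1)])

text \<open>\<open>F\<close> may contain polynomials besides the monomials in \<open>S\<close>. This
  is the form needed for the images \<open>act \<pi> f\<close> of whole ideals and for the
  generators in \<open>colon_step\<close>.\<close>

lemma genideal_polys:
  fixes F :: "'k::field mpoly set"
  assumes sub: "\<And>f. f \<in> F \<Longrightarrow> f \<in> polys (up V S)"
    and S: "S \<subseteq> mons_in V" "\<And>u. u \<in> S \<Longrightarrow> to_poly u \<in> F"
  shows "genideal (poly_ring V) F = polys (up V S)"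
proof -
  interpret cring "poly_ring V :: 'k mpoly ring" by (rule poly_ring_cring)
  have Fc: "F \<subseteq> carrier (poly_ring V)" using sub by (fastforce simp: polys_def up_def)
  show ?thesis
  proof
    show "genideal (poly_ring V) F \<subseteq> polys (up V S)"
      by (rule genideal_minimal[OF polys_ideal]) (use sub in auto)
    have id: "ideal (genideal (poly_ring V) F) (poly_ring V)" by (rule genideal_ideal[OF Fc])
    show "polys (up V S) \<subseteq> genideal (poly_ring V) F"
    proof
      fix f :: "'k mpoly" assume f: "f \<in> polys (up V S)"
      have "single v (lookup f v) \<in> genideal (poly_ring V) F" if "v \<in> keys f" for v
      proof -
        have "v \<in> up V S" using that f by (auto simp: polys_def)
        then obtain u where u: "u \<in> S" "mdvd u v" "v \<in> mons_in V" by (auto simp: up_def)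
        have "to_poly u \<in> genideal (poly_ring V) F"
          using genideal_self[OF Fc] S(2) u(1) by blast
        then have "single (v - u) (lookup f v) * to_poly u \<in> genideal (poly_ring V) F"
          by (rule ideal_times[OF id]) (use u mons_in_diff in auto)
        then show ?thesis using mdvd_diff[OF u(2)] by (simp add: mult_single add.commute)
      qed
      then show "f \<in> genideal (poly_ring V) F"
        using ideal_sum[OF id, of "keys f" "\<lambda>v. single v (lookup f v)"] poly_decomp[of f] by simp
    qed
  qed
qed

lemma genideal_to_poly:
  "S \<subseteq> mons_in V \<Longrightarrow> genideal (poly_ring V) (to_poly ` S :: 'k::field mpoly set) = polys (up V S)"
  by (rule genideal_polys) (use mdvd_refl in \<open>force simp: up_def\<close>)+

lemma colon_ideal_polys:
  assumes "w \<in> mons_in V"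
  shows "colon_ideal (poly_ring V) (polys L) (to_poly w :: 'k::field mpoly)
    = polys {u \<in> mons_in V. u + w \<in> L}"
  using assms by (auto simp: colon_ideal_def polys_def keys_times_single)


section \<open>Chains of monomial ideals\<close>

definition mchain :: "nat \<Rightarrow> nat \<Rightarrow> (nat \<Rightarrow> mon set) \<Rightarrow> bool" where
  "mchain c j L \<longleftrightarrow> (\<forall>n\<ge>1. upset (vars c n) (L n)) \<and>
     (\<forall>m n. 1 \<le> m \<longrightarrow> m \<le> n \<longrightarrow> (\<forall>u\<in>L m. \<forall>\<pi>\<in>Inc_seg j m n. act_mon \<pi> u \<in> L n))"

text \<open>The condition minimized by \<open>ind\<close>, in terms of monomials;
  \<open>stable_iff\<close> relates the two.\<close>

definition stable :: "nat \<Rightarrow> nat \<Rightarrow> (nat \<Rightarrow> mon set) \<Rightarrow> nat \<Rightarrow> bool" where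
  "stable c j L r \<longleftrightarrow> 1 \<le> r \<and>
     (\<forall>n\<ge>r. \<forall>v\<in>L n. \<exists>u\<in>L r. \<exists>\<pi>\<in>Inc_seg j r n. mdvd (act_mon \<pi> u) v)"

lemma mchain_upset: "mchain c j L \<Longrightarrow> 1 \<le> n \<Longrightarrow> upset (vars c n) (L n)"
  by (simp add: mchain_def)

lemma mchain_act:
  assumes "mchain c j L" "1 \<le> m" "\<pi> \<in> Inc_seg j m n" "u \<in> L m"
  shows "act_mon \<pi> u \<in> L n"
proof -
  have "m \<le> n" using assms(3) Inc_ge[of \<pi> j m] by (simp add: Inc_seg_def)
  then show ?thesis using assms unfolding mchain_def by blast
qed

lemma mchain_mono: "mchain c j L \<Longrightarrow> 1 \<le> m \<Longrightarrow> m \<le> n \<Longrightarrow> L m \<subseteq> L n"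
  using mchain_act[OF _ _ id_Inc_seg, of c j L m n] by auto

lemma act_to_poly: "act \<pi> (to_poly u :: 'k::field mpoly) = to_poly (act_mon \<pi> u)"
  by (simp add: act_def)

lemma keys_act: "keys (act \<pi> (f :: 'k::field mpoly)) \<subseteq> act_mon \<pi> ` keys f"
  unfolding act_def
  by (rule order_trans[OF keys_sum_subset]) auto

lemma R_fin_poly_ring: "R_fin c n = poly_ring (vars c n)"
  by (simp add: R_fin_def)

lemma genideal_act_polys:
  assumes "mchain c j L" "1 \<le> r" "r \<le> n"
  shows "genideal (R_fin c n) {act \<pi> f | \<pi> f. f \<in> polys (L r) \<and> \<pi> \<in> Inc_seg j r n}
    = (polys (up (vars c n) {act_mon \<pi> u | \<pi> u. u \<in> L r \<and> \<pi> \<in> Inc_seg j r n}) :: 'k::field mpoly set)"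
  unfolding R_fin_poly_ring
proof (rule genideal_polys)
  fix g :: "'k mpoly" assume "g \<in> {act \<pi> f | \<pi> f. f \<in> polys (L r) \<and> \<pi> \<in> Inc_seg j r n}"
  then obtain \<pi> and f :: "'k mpoly" where f: "g = act \<pi> f" "keys f \<subseteq> L r" "\<pi> \<in> Inc_seg j r n"
    by (auto simp: polys_def)
  have "v \<in> up (vars c n) {act_mon \<pi> u | \<pi> u. u \<in> L r \<and> \<pi> \<in> Inc_seg j r n}" if "v \<in> keys g" for v
  proof -
    have "v \<in> act_mon \<pi> ` keys f" using subsetD[OF keys_act] that f(1) by simp
    then obtain u where "u \<in> L r" "v = act_mon \<pi> u" using f(2) by blast
    moreover from this have "v \<in> mons_in (vars c n)"
      using act_mon_mons_in[OF f(3)] mchain_upset[OF assms(1,2)] upset_mons by blast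
    ultimately show ?thesis using f(3) mdvd_refl unfolding up_def by blast
  qed
  then show "g \<in> polys (up (vars c n) {act_mon \<pi> u | \<pi> u. u \<in> L r \<and> \<pi> \<in> Inc_seg j r n})"
    by (auto simp: polys_def)
next
  show "{act_mon \<pi> u | \<pi> u. u \<in> L r \<and> \<pi> \<in> Inc_seg j r n} \<subseteq> mons_in (vars c n)"
    using act_mon_mons_in mchain_upset[OF assms(1,2)] upset_mons by blast
next
  fix v assume "v \<in> {act_mon \<pi> u | \<pi> u. u \<in> L r \<and> \<pi> \<in> Inc_seg j r n}"
  then obtain \<pi> u where "v = act_mon \<pi> u" "u \<in> L r" "\<pi> \<in> Inc_seg j r n" by blast
  then have "(to_poly v :: 'k mpoly) = act \<pi> (to_poly u) \<and> to_poly u \<in> (polys (L r) :: 'k mpoly set)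
      \<and> \<pi> \<in> Inc_seg j r n"
    by (simp add: act_to_poly)
  then show "(to_poly v :: 'k mpoly) \<in> {act \<pi> f | \<pi> f. f \<in> polys (L r) \<and> \<pi> \<in> Inc_seg j r n}"
    by blast
qed

lemma stable_iff:
  assumes "mchain c j L" "\<And>n. 1 \<le> n \<Longrightarrow> J n = (polys (L n) :: 'k::field mpoly set)"
  shows "stable c j L r \<longleftrightarrow> 1 \<le> r \<and>
    (\<forall>n\<ge>r. J n = genideal (R_fin c n) {act \<pi> f | \<pi> f. f \<in> J r \<and> \<pi> \<in> Inc_seg j r n})"
proof (cases "1 \<le> r")
  case True
  have "J n = genideal (R_fin c n) {act \<pi> f | \<pi> f. f \<in> J r \<and> \<pi> \<in> Inc_seg j r n} \<longleftrightarrow>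
      (\<forall>v\<in>L n. \<exists>u\<in>L r. \<exists>\<pi>\<in>Inc_seg j r n. mdvd (act_mon \<pi> u) v)" if "r \<le> n" for n
  proof -
    have J: "J r = polys (L r)" "J n = polys (L n)" using assms(2) True that by auto
    have "L n = up (vars c n) {act_mon \<pi> u | \<pi> u. u \<in> L r \<and> \<pi> \<in> Inc_seg j r n} \<longleftrightarrow>
      (\<forall>v\<in>L n. \<exists>u\<in>L r. \<exists>\<pi>\<in>Inc_seg j r n. mdvd (act_mon \<pi> u) v)" (is "_ = ?U \<longleftrightarrow> ?R")
    proof
      assume eq: "L n = ?U"
      show ?R
      proof
        fix v assume "v \<in> L n"
        then have "v \<in> ?U" using eq by simp
        then show "\<exists>u\<in>L r. \<exists>\<pi>\<in>Inc_seg j r n. mdvd (act_mon \<pi> u) v" by (auto simp: up_def)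
      qed
    next
      have up: "upset (vars c n) (L n)" using mchain_upset[OF assms(1)] True that by simp
      assume ?R
      then have "L n \<subseteq> ?U" using upset_mons[OF up] unfolding up_def by blast
      moreover have "?U \<subseteq> L n"
      proof
        fix v assume "v \<in> ?U"
        then obtain \<pi> u where "u \<in> L r" "\<pi> \<in> Inc_seg j r n" "mdvd (act_mon \<pi> u) v"
          "v \<in> mons_in (vars c n)" by (auto simp: up_def)
        then show "v \<in> L n"
          using upsetD[OF up] mchain_act[OF assms(1) True] by blast
      qed
      ultimately show "L n = ?U" by blast
    qed
    then show ?thesis
      unfolding J genideal_act_polys[OF assms(1) True that] polys_eq_iff .
  qed
  then show ?thesis using True by (simp add: stable_def)
qed (simp add: stable_def)

lemma ind_eq_Least:
  assumes "mchain c j L" "\<And>n. 1 \<le> n \<Longrightarrow> J n = (polys (L n) :: 'k::field mpoly set)"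
  shows "ind c j J = (LEAST r. stable c j L r)"
  unfolding ind_def using stable_iff[OF assms] by simp


subsection \<open>Noetherianity up to symmetry\<close>

text \<open>Higman's lemma for words of columns. The letter for column l holds its exponents and the
  tag \<open>min l (i + 1)\<close>; equal tags force an embedding of words to keep the first i
  columns in place, so that it extends to a member of \<open>Inc i\<close>. Keeping m beside u fixes
  the length of the word, which gives the bound on \<open>\<pi> m\<close>.\<close>

lemma wqo_on_columns:
  "wqo_on (\<lambda>x y. \<exists>\<pi>\<in>Inc_seg i (fst x) (fst y). mdvd (act_mon \<pi> (snd x)) (snd y))
     {(m, u). 1 \<le> m \<and> u \<in> mons_in (vars c m)}"
proof -
  let ?P = "\<lambda>a b :: nat \<times> (nat \<Rightarrow> nat). fst a = fst b \<and> (\<forall>k\<in>{1..c}. snd a k \<le> snd b k)"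
  define wd where "wd m u = map (\<lambda>l. (min (Suc l) (Suc i), \<lambda>k. lookup u (k, Suc l))) [0..<m]"
    for m and u :: mon
  have wd_nth: "wd m u ! l = (min (Suc l) (Suc i), \<lambda>k. lookup u (k, Suc l))" if "l < m" for m u l
    using that by (simp add: wd_def)
  have "wqo_on ?P ({..Suc i} \<times> UNIV)"
    by (rule wqo_on_product[OF wqo_on_finite dickson]) auto
  then have "wqo_on (list_emb ?P) (lists ({..Suc i} \<times> UNIV))" by (rule higman)
  then show ?thesis
  proof (rule wqo_on_transfer[where R = "\<lambda>y x. y = wd (fst x) (snd x) \<and> 1 \<le> fst x \<and>
        snd x \<in> mons_in (vars c (fst x))"], goal_cases)
    case (1 x)
    then show ?case by (intro bexI[of _ "wd (fst x) (snd x)"]) (auto simp: wd_def)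
  next
    case (2 y y' x x')
    obtain m u n v where x: "x = (m, u)" "x' = (n, v)" by (metis surj_pair)
    have u: "u \<in> mons_in (vars c m)" and v: "v \<in> mons_in (vars c n)" and m: "1 \<le> m"
      using 2 x by auto
    have "list_emb ?P (wd m u) (wd n v)" using 2 x by simp
    from list_emb_strict_mono[OF this] obtain p where p: "strict_mono p"
      "\<And>l. l < m \<Longrightarrow> p l < n \<and> ?P (wd m u ! l) (wd n v ! p l)" by (auto simp: wd_def)
    have tag: "min (Suc l) (Suc i) = min (Suc (p l)) (Suc i)" if "l < m" for l
      using p(2)[OF that] that by (simp add: wd_nth)
    have le: "lookup u (k, Suc l) \<le> lookup v (k, Suc (p l))" if "l < m" "k \<in> {1..c}" for k l
      using p(2)[OF that(1)] that wd_nth[of "p l" n v] wd_nth[of l m u] by auto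
    \<comment> \<open>If m < i, the tags control \<open>p\<close> only below m, where it is the
      identity, while the columns up to i have to be fixed as well; hence the separate case.\<close>
    define \<pi> where "\<pi> l = (if m < i then l else case l of 0 \<Rightarrow> 0 | Suc l \<Rightarrow> Suc (p l))" for l
    have \<pi>_p: "\<pi> (Suc l) = Suc (p l)" if "l < m" for l
      using tag[OF that] that by (auto simp: \<pi>_def min_def split: if_splits)
    have mono: "strict_mono \<pi>"
      using p(1) by (auto simp: \<pi>_def strict_mono_def split: nat.split)
    have "\<pi> j = j" if ji: "j \<le> i" for j
    proof (cases "m < i \<or> j = 0")
      case True
      then show ?thesis by (auto simp: \<pi>_def)
    next
      case False
      then obtain l where "j = Suc l" "l < m" using ji by (cases j) auto
      then show ?thesis using tag[of l] \<pi>_p[of l] ji by (simp add: min_def split: if_splits)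
    qed
    then have \<pi>: "\<pi> \<in> Inc i" using mono by (simp add: Inc_def)
    have "\<pi> m \<le> n" using \<pi>_p[of "m - 1"] p(2)[of "m - 1"] m by simp
    then have seg: "\<pi> \<in> Inc_seg i m n" using \<pi> by (simp add: Inc_seg_def)
    have "lookup (act_mon \<pi> u) (k, j) \<le> lookup v (k, j)" for k j
    proof (cases "lookup (act_mon \<pi> u) (k, j) = 0")
      case False
      then have "(k, j) \<in> keys (act_mon \<pi> u)" by (simp add: in_keys_iff)
      then obtain l where l: "(k, l) \<in> keys u" "j = \<pi> l"
        by (auto simp: keys_act_mon[OF Inc_inj[OF \<pi>]])
      then have "k \<in> {1..c}" "1 \<le> l" "l \<le> m" using u by (auto simp: mons_in_def)
      then obtain l' where "l = Suc l'" "l' < m" by (cases l) auto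
      then show ?thesis
        using le[of l' k] \<open>k \<in> {1..c}\<close> l \<pi>_p[of l'] Inc_inj[OF \<pi>]
        by (metis lookup_act_mon_image)
    qed simp
    then have "mdvd (act_mon \<pi> u) v" by (auto simp: mdvd_def)
    then show ?case using seg x by auto
  qed
qed

text \<open>An increasing map from \<open>{1..m}\<close> to \<open>{1..n + 1}\<close> with \<open>m \<le> n\<close> misses some \<open>p\<close>, hence factors
  through \<open>{1..n}\<close> via the increasing map that skips \<open>p\<close>.\<close>

lemma act_mon_factor:
  assumes \<pi>: "\<pi> \<in> Inc_seg i m (Suc n)" and mn: "1 \<le> m" "m \<le> n" and u: "u \<in> mons_in (vars c m)"
  shows "\<exists>\<pi>1\<in>Inc_seg i m n. \<exists>\<pi>2\<in>Inc_seg i n (Suc n). act_mon \<pi> u = act_mon \<pi>2 (act_mon \<pi>1 u)"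
proof (cases "m < i")
  case True
  have "act_mon \<pi> u = act_mon (\<lambda>l. l) u"
  proof (rule act_mon_cong)
    show "inj \<pi>" by (rule Inc_inj[OF Inc_seg_Inc[OF \<pi>]])
    show "\<pi> l = l" if "(k, l) \<in> keys u" for k l
    proof -
      have "l \<le> i" using that u True by (auto simp: mons_in_def)
      then show ?thesis using \<pi> by (simp add: Inc_seg_def Inc_def)
    qed
  qed simp
  then show ?thesis using mn by (intro bexI[OF _ id_Inc_seg]) simp_all
next
  case False
  have inc: "\<pi> \<in> Inc i" and le: "\<pi> m \<le> Suc n" using \<pi> by (auto simp: Inc_seg_def)
  have "card (\<pi> ` {1..m}) \<le> m" using card_image_le[of "{1..m}" \<pi>] by simp
  then have "\<not> {1..Suc n} \<subseteq> \<pi> ` {1..m}"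
    using mn card_mono[of "\<pi> ` {1..m}" "{1..Suc n}"] by auto
  then obtain p where p: "1 \<le> p" "p \<le> Suc n" "p \<notin> \<pi> ` {1..m}"
    by (metis atLeastAtMost_iff subsetI)
  have "i < p"
  proof (rule ccontr)
    assume "\<not> i < p"
    then have "p = \<pi> p" using Inc_fix[OF inc, of p] by simp
    then show False using p \<open>\<not> i < p\<close> False by auto
  qed
  \<comment> \<open>Beyond column m, which is all that u sees, \<open>\<pi>\<close> might still take
    the value p. There \<open>\<sigma>\<close> takes values above n + 1 instead, so it misses p
    everywhere.\<close>
  define \<sigma> where "\<sigma> l = (if l \<le> m then \<pi> l else Suc n + (l - m))" for l
  define \<pi>2 where "\<pi>2 l = (if l < p then l else Suc l)" for l
  define \<pi>1 where "\<pi>1 l = (if \<sigma> l < p then \<sigma> l else \<sigma> l - 1)" for l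
  have \<sigma>: "\<sigma> a < \<sigma> b" if "a < b" for a b
  proof (cases "b \<le> m")
    case True
    then show ?thesis using that Inc_less[OF inc] by (simp add: \<sigma>_def)
  next
    case b: False
    show ?thesis
    proof (cases "a \<le> m")
      case True
      then have "\<pi> a \<le> \<pi> m" using Inc_le[OF inc] by simp
      then show ?thesis using True b le by (simp add: \<sigma>_def)
    qed (use that b in \<open>simp add: \<sigma>_def\<close>)
  qed
  have \<pi>0: "\<pi> 0 = 0" using Inc_fix[OF inc, of 0] by simp
  have ne: "\<sigma> l \<noteq> p" for l
  proof (cases "l = 0")
    case True
    then show ?thesis using p \<pi>0 by (simp add: \<sigma>_def)
  next
    case False
    then show ?thesis using p by (auto simp: \<sigma>_def)
  qed
  have mono1: "strict_mono \<pi>1"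
  proof (rule strict_monoI)
    fix a b :: nat assume "a < b"
    then show "\<pi>1 a < \<pi>1 b" using \<sigma>[of a b] ne[of a] ne[of b] by (auto simp: \<pi>1_def)
  qed
  have fix1: "\<pi>1 l = l" if "l \<le> i" for l
    using that False Inc_fix[OF inc that] \<open>i < p\<close> by (simp add: \<pi>1_def \<sigma>_def)
  have "\<pi>1 m \<le> n"
    using le p(2) ne[of m] by (auto simp: \<pi>1_def \<sigma>_def)
  then have 1: "\<pi>1 \<in> Inc_seg i m n" using mono1 fix1 by (simp add: Inc_seg_def Inc_def)
  have 2: "\<pi>2 \<in> Inc_seg i n (Suc n)"
    using \<open>i < p\<close> by (auto simp: Inc_seg_def Inc_def \<pi>2_def strict_mono_def)
  have comp: "\<pi>2 (\<pi>1 l) = \<sigma> l" for l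
    using ne[of l] by (auto simp: \<pi>2_def \<pi>1_def)
  have "act_mon \<pi> u = act_mon (\<pi>2 \<circ> \<pi>1) u"
  proof (rule act_mon_cong)
    show "inj \<pi>" using inc by (rule Inc_inj)
    show "inj (\<pi>2 \<circ> \<pi>1)" using 1 2 by (meson Inc_inj Inc_comp Inc_seg_Inc)
    show "\<pi> l = (\<pi>2 \<circ> \<pi>1) l" if "(k, l) \<in> keys u" for k l
      using that u by (auto simp: comp \<sigma>_def mons_in_def)
  qed
  then show ?thesis
    using 1 2 act_mon_comp[OF Inc_inj[OF Inc_seg_Inc[OF 2]] Inc_inj[OF Inc_seg_Inc[OF 1]], of u]
    by metis
qed

text \<open>A finite basis of all pairs (n, u) with u in \<open>L n\<close> exists by
  \<open>wqo_on_columns\<close>, and r is chosen above its levels. An image of a basis element has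
  to be recognized as an image of a member of \<open>L r\<close>; this is done by pulling it down
  one level at a time with \<open>act_mon_factor\<close>.\<close>

theorem stable_exists:
  assumes L: "mchain c i L"
  shows "\<exists>r. stable c i L r"
proof -
  let ?A = "{(m, u). 1 \<le> m \<and> u \<in> L m}"
  have "?A \<subseteq> {(m, u). 1 \<le> m \<and> u \<in> mons_in (vars c m)}"
    using mchain_upset[OF L] upset_mons by blast
  from wqo_on_finite_basis[OF wqo_on_subset[OF wqo_on_columns[of i c] this]]
  obtain B where B: "finite B" "B \<subseteq> ?A"
    and ex: "\<forall>x\<in>?A. \<exists>b\<in>B. \<exists>\<pi>\<in>Inc_seg i (fst b) (fst x). mdvd (act_mon \<pi> (snd b)) (snd x)"
    by (elim exE conjE) (rule that)
  have basis: "\<exists>b\<in>B. \<exists>\<pi>\<in>Inc_seg i (fst b) n. mdvd (act_mon \<pi> (snd b)) v"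
    if "1 \<le> n" "v \<in> L n" for n v
    using bspec[OF ex, of "(n, v)"] that by simp
  \<comment> \<open>The inserted 1 keeps r positive when all \<open>L n\<close> are empty.\<close>
  define r where "r = Max (insert 1 (fst ` B))"
  have r: "1 \<le> r" "\<And>b. b \<in> B \<Longrightarrow> fst b \<le> r"
    using B(1) by (auto simp: r_def)
  have "\<exists>u\<in>L r. \<exists>\<pi>\<in>Inc_seg i r n. mdvd (act_mon \<pi> u) v" if "r \<le> n" "v \<in> L n" for n v
    using that
  proof (induction n arbitrary: v rule: dec_induct)
    case base
    then show ?case by (intro bexI[of _ v] bexI[OF _ id_Inc_seg]) auto
  next
    case (step n)
    obtain m u \<pi> where b: "(m, u) \<in> B" "\<pi> \<in> Inc_seg i m (Suc n)" "mdvd (act_mon \<pi> u) v"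
      using basis[of "Suc n" v] step.prems by auto
    have m: "1 \<le> m" "u \<in> L m" "m \<le> n" using b(1) B(2) r(2) step.hyps by force+
    have u: "u \<in> mons_in (vars c m)" using mchain_upset[OF L m(1)] m(2) upset_mons by blast
    obtain \<pi>1 \<pi>2 where f: "\<pi>1 \<in> Inc_seg i m n" "\<pi>2 \<in> Inc_seg i n (Suc n)"
      "act_mon \<pi> u = act_mon \<pi>2 (act_mon \<pi>1 u)"
      using act_mon_factor[OF b(2) m(1,3) u] by blast
    have "act_mon \<pi>1 u \<in> L n" by (rule mchain_act[OF L m(1) f(1) m(2)])
    from step.IH[OF this] obtain u' \<pi>' where u': "u' \<in> L r" "\<pi>' \<in> Inc_seg i r n"
      "mdvd (act_mon \<pi>' u') (act_mon \<pi>1 u)" by blast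
    have inj: "inj \<pi>2" "inj \<pi>'" using f(2) u'(2) by (auto intro: Inc_inj Inc_seg_Inc)
    have "mdvd (act_mon \<pi>2 (act_mon \<pi>' u')) (act_mon \<pi> u)"
      unfolding f(3) by (rule mdvd_act_mon[OF inj(1) u'(3)])
    then have "mdvd (act_mon (\<pi>2 \<circ> \<pi>') u') v"
      using b(3) mdvd_trans by (metis act_mon_comp[OF inj])
    moreover have "\<pi>2 \<circ> \<pi>' \<in> Inc_seg i r (Suc n)"
    proof -
      have "\<pi>2 (\<pi>' r) \<le> \<pi>2 n"
        using u'(2) Inc_le[OF Inc_seg_Inc[OF f(2)]] by (simp add: Inc_seg_def)
      then show ?thesis using f(2) u'(2) Inc_comp unfolding Inc_seg_def by fastforce
    qed
    ultimately show ?case using u'(1) by blast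
  qed
  then show ?thesis using r(1) by (auto simp: stable_def)
qed


section \<open>Covers\<close>

lemma ex_minimal_divisor:
  assumes "u \<in> L"
  shows "\<exists>v\<in>L. mdvd v u \<and> (\<forall>w\<in>L. mdvd w v \<longrightarrow> w = v)"
proof -
  obtain v where v: "v \<in> L \<and> mdvd v u" and least: "\<And>w. w \<in> L \<and> mdvd w u \<Longrightarrow> mdeg v \<le> mdeg w"
    using ex_has_least_nat[of "\<lambda>v. v \<in> L \<and> mdvd v u" u mdeg] assms by auto
  have "w = v" if "w \<in> L" "mdvd w v" for w
    using least[of w] mdeg_less[of w v] mdvd_trans[of w v u] that v by fastforce
  then show ?thesis using v by blast
qed

lemma up_minimal:
  assumes L: "upset V L"
  shows "up V {u \<in> L. \<forall>v\<in>L. mdvd v u \<longrightarrow> v = u} = L"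
proof
  show "up V {u \<in> L. \<forall>v\<in>L. mdvd v u \<longrightarrow> v = u} \<subseteq> L"
    using upsetD[OF L] by (auto simp: up_def)
  show "L \<subseteq> up V {u \<in> L. \<forall>v\<in>L. mdvd v u \<longrightarrow> v = u}"
  proof
    fix u assume "u \<in> L"
    then show "u \<in> up V {u \<in> L. \<forall>v\<in>L. mdvd v u \<longrightarrow> v = u}"
      using ex_minimal_divisor[of u L] upset_mons[OF L, of u] unfolding up_def by auto
  qed
qed

text \<open>Every generating set of monomials contains the monomials minimal under divisibility, and
  these already generate; so the \<open>THE\<close> is well defined.\<close>

lemma min_gens_polys:
  assumes L: "upset (vars c n) L"
  shows "min_gens c n (polys L :: 'k::field mpoly set) = {u \<in> L. \<forall>v\<in>L. mdvd v u \<longrightarrow> v = u}"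
    (is "_ = ?G")
proof -
  have gen: "genideal (poly_ring (vars c n)) (to_poly ` G :: 'k mpoly set) = polys L
      \<longleftrightarrow> up (vars c n) G = L" if "G \<subseteq> mons_in (vars c n)" for G
    unfolding genideal_to_poly[OF that] polys_eq_iff ..
  have sub: "?G \<subseteq> mons_in (vars c n)" using L upset_mons by blast
  have up: "up (vars c n) ?G = L"
    by (rule up_minimal[OF L])
  show ?thesis
    unfolding min_gens_def R_fin_poly_ring
  proof (rule the_equality)
    show "?G \<subseteq> mons_in (vars c n) \<and>
      genideal (poly_ring (vars c n)) (to_poly ` ?G :: 'k mpoly set) = polys L \<and>
      (\<forall>G'. G' \<subset> ?G \<longrightarrow> genideal (poly_ring (vars c n)) (to_poly ` G' :: 'k mpoly set) \<noteq> polys L)"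
    proof (intro conjI allI impI)
      fix G' assume G': "G' \<subset> ?G"
      then obtain u where u: "u \<in> ?G" "u \<notin> G'" by blast
      have "u \<notin> up (vars c n) G'" using u G' by (auto simp: up_def)
      then have "up (vars c n) G' \<noteq> L" using u(1) by blast
      moreover have "G' \<subseteq> mons_in (vars c n)" using G' sub by blast
      ultimately show "genideal (poly_ring (vars c n)) (to_poly ` G' :: 'k mpoly set) \<noteq> polys L"
        using gen by blast
    qed (use sub up gen[OF sub] in auto)
  next
    fix G assume G: "G \<subseteq> mons_in (vars c n) \<and>
      genideal (poly_ring (vars c n)) (to_poly ` G :: 'k mpoly set) = polys L \<and>
      (\<forall>G'. G' \<subset> G \<longrightarrow> genideal (poly_ring (vars c n)) (to_poly ` G' :: 'k mpoly set) \<noteq> polys L)"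
    then have upG: "up (vars c n) G = L" using gen by blast
    have "?G \<subseteq> G"
    proof
      fix u assume u: "u \<in> ?G"
      then have "u \<in> up (vars c n) G" using upG by simp
      then obtain v where v: "v \<in> G" "mdvd v u" by (auto simp: up_def)
      then have "v \<in> up (vars c n) G" using G mdvd_refl unfolding up_def by blast
      then show "u \<in> G" using u v upG by auto
    qed
    then show "G = ?G" using G gen[OF sub] up by blast
  qed
qed

text \<open>A minimal divisor has smaller support, so an uncovered monomial of the ideal yields an
  uncovered generator. The monomial 1 is excluded because its \<open>min_index\<close> is a
  \<open>Min\<close> over the empty set.\<close>

lemma is_cover_iff:
  assumes L: "upset (vars c n) L" and "0 \<notin> L"
  shows "is_cover c n j (polys L :: 'k::field mpoly set) C \<longleftrightarrow>
    C \<subseteq> {1..c} \<and> (\<forall>u\<in>L. \<not> keys u \<subseteq> ({1..c} - C) \<times> {j<..})"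
proof -
  have "(\<forall>u\<in>min_gens_above c n j (polys L :: 'k mpoly set). covers C u)
      \<longleftrightarrow> (\<forall>u\<in>L. \<not> keys u \<subseteq> ({1..c} - C) \<times> {j<..})"
  proof
    assume *: "\<forall>u\<in>min_gens_above c n j (polys L :: 'k mpoly set). covers C u"
    show "\<forall>u\<in>L. \<not> keys u \<subseteq> ({1..c} - C) \<times> {j<..}"
    proof (intro ballI notI)
      fix u assume u: "u \<in> L" "keys u \<subseteq> ({1..c} - C) \<times> {j<..}"
      obtain v where v: "v \<in> L" "mdvd v u" "\<forall>w\<in>L. mdvd w v \<longrightarrow> w = v"
        using ex_minimal_divisor[OF u(1)] by blast
      have kv: "keys v \<subseteq> ({1..c} - C) \<times> {j<..}" using mdvd_keys[OF v(2)] u(2) by blast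
      have "v \<noteq> 0" using v(1) assms(2) by blast
      then have "keys v \<noteq> {}" by simp
      then have "j < min_index v" unfolding min_index_def using kv by (subst Min_gr_iff) auto
      then have "v \<in> min_gens_above c n j (polys L :: 'k mpoly set)"
        using v by (simp add: min_gens_above_def min_gens_polys[OF L])
      then have "covers C v" using * by blast
      then show False using kv by (auto simp: covers_def)
    qed
  next
    assume *: "\<forall>u\<in>L. \<not> keys u \<subseteq> ({1..c} - C) \<times> {j<..}"
    show "\<forall>u\<in>min_gens_above c n j (polys L :: 'k mpoly set). covers C u"
    proof
      fix u assume "u \<in> min_gens_above c n j (polys L :: 'k mpoly set)"
      then have u: "u \<in> L" "j < min_index u" by (auto simp: min_gens_above_def min_gens_polys[OF L])
      have ku: "keys u \<subseteq> vars c n" using upset_mons[OF L u(1)] by (simp add: mons_in_def)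
      have lj: "j < l" if "(k, l) \<in> keys u" for k l
      proof -
        have "min_index u \<le> l" unfolding min_index_def using that by (intro Min_le) force+
        then show ?thesis using u(2) by simp
      qed
      obtain x where x: "x \<in> keys u" "x \<notin> ({1..c} - C) \<times> {j<..}" using * u(1) by blast
      obtain k l where kl: "x = (k, l)" by fastforce
      have "k \<in> C" "1 \<le> l" using x kl lj[of k l] ku by auto
      then show "covers C u" using x kl by (auto simp: covers_def)
    qed
  qed
  then show ?thesis by (simp add: is_cover_def)
qed

text \<open>For a proper chain, the complements in the rows of such \<open>D\<close> are the
  \<open>j\<close>-covers, here for all levels at once.\<close>

definition free :: "nat \<Rightarrow> (nat \<Rightarrow> mon set) \<Rightarrow> nat set \<Rightarrow> bool" where
  "free j L D \<longleftrightarrow> (\<forall>n\<ge>1. \<forall>u\<in>L n. \<not> keys u \<subseteq> D \<times> {j<..})"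

definition proper :: "(nat \<Rightarrow> mon set) \<Rightarrow> bool" where
  "proper L \<longleftrightarrow> (\<forall>n\<ge>1. 0 \<notin> L n)"

text \<open>Members of \<open>Inc j\<close> preserve the row of a variable and whether its column
  lies after j, so a monomial and its image avoid the same rows. Levels below r are reached by
  passing to \<open>max n r\<close>.\<close>

lemma stable_free_iff:
  assumes L: "mchain c j L" and r: "stable c j L r"
  shows "free j L D \<longleftrightarrow> (\<forall>u\<in>L r. \<not> keys u \<subseteq> D \<times> {j<..})"
proof
  assume "free j L D"
  then show "\<forall>u\<in>L r. \<not> keys u \<subseteq> D \<times> {j<..}" using r by (auto simp: free_def stable_def)
next
  assume *: "\<forall>u\<in>L r. \<not> keys u \<subseteq> D \<times> {j<..}"
  show "free j L D"
    unfolding free_def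
  proof (intro allI impI ballI notI)
    fix n u assume n: "1 \<le> n" and u: "u \<in> L n" "keys u \<subseteq> D \<times> {j<..}"
    have "u \<in> L (max n r)" using mchain_mono[OF L n, of "max n r"] u(1) by auto
    then obtain v \<pi> where v: "v \<in> L r" "\<pi> \<in> Inc_seg j r (max n r)" "mdvd (act_mon \<pi> v) u"
      using r unfolding stable_def by (meson max.cobounded2)
    have \<pi>: "\<pi> \<in> Inc j" using v(2) by (rule Inc_seg_Inc)
    have "keys (act_mon \<pi> v) \<subseteq> D \<times> {j<..}" using mdvd_keys[OF v(3)] u(2) by blast
    then have "keys v \<subseteq> D \<times> {j<..}"
      by (auto simp: keys_act_mon[OF Inc_inj[OF \<pi>]] Inc_above[OF \<pi>])
    then show False using * v(1) by blast
  qed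
qed

section \<open>Minimal covers and the size of independent sets of variables\<close>

definition min_cover :: "nat \<Rightarrow> nat \<Rightarrow> (nat \<Rightarrow> mon set) \<Rightarrow> nat set \<Rightarrow> bool" where
  "min_cover c j L C \<longleftrightarrow> C \<subseteq> {1..c} \<and> free j L ({1..c} - C) \<and>
     (\<forall>C'\<subseteq>{1..c}. free j L ({1..c} - C') \<longrightarrow> card C \<le> card C')"

lemma gamma_mon_chain_eq:
  assumes L: "mchain c j L" and pr: "proper L"
    and J: "\<And>n. 1 \<le> n \<Longrightarrow> J n = (polys (L n) :: 'k::field mpoly set)"
  shows "\<exists>C. min_cover c j L C \<and> gamma_mon_chain c j J = enat (card C)"
proof -
  let ?r = "ind c j J"
  have r: "stable c j L ?r"
    using LeastI_ex[OF stable_exists[OF L]] ind_eq_Least[OF L J] by simp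
  then have r1: "1 \<le> ?r" by (simp add: stable_def)
  have up: "upset (vars c ?r) (L ?r)" by (rule mchain_upset[OF L r1])
  have no0: "0 \<notin> L ?r" using pr r1 by (simp add: proper_def)
  have cov: "is_cover c ?r j (J ?r) C \<longleftrightarrow> C \<subseteq> {1..c} \<and> free j L ({1..c} - C)" for C
    unfolding J[OF r1] is_cover_iff[OF up no0] stable_free_iff[OF L r] ..
  have "J ?r \<noteq> carrier (R_fin c ?r)"
    unfolding J[OF r1] R_fin_poly_ring using polys_carrier_iff[OF up] no0 by blast
  then have g: "gamma_mon_chain c j J = enat (Min {card C | C. is_cover c ?r j (J ?r) C})"
    by (simp add: gamma_mon_chain_def gamma_ideal_def)
  let ?S = "{card C | C. is_cover c ?r j (J ?r) C}"
  have "?S \<subseteq> card ` Pow {1..c}" using cov by auto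
  then have fin: "finite ?S" by (rule finite_subset) simp
  have "free j L ({1..c} - {1..c})"
    using pr by (auto simp: free_def proper_def)
  then have "is_cover c ?r j (J ?r) {1..c}" by (simp add: cov)
  then have "?S \<noteq> {}" by blast
  then have "Min ?S \<in> ?S" using fin by (rule Min_in[rotated])
  then obtain C where C: "Min ?S = card C" "is_cover c ?r j (J ?r) C" by blast
  have "card C \<le> card C'" if "C' \<subseteq> {1..c}" "free j L ({1..c} - C')" for C'
  proof -
    have "is_cover c ?r j (J ?r) C'" using that by (simp add: cov)
    then have "card C' \<in> ?S" by blast
    then show ?thesis using Min_le[OF fin, of "card C'"] C(1) by simp
  qed
  then have "min_cover c j L C" using C(2) cov by (simp add: min_cover_def)
  then show ?thesis using g C(1) by auto
qed

text \<open>The columns j + 1, ..., N can be moved increasingly into any N columns after j. Hence a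
  set of variables that contains no support of a monomial cannot repeat a non-free row pattern
  \<open>D\<close> in too many columns.\<close>

lemma columns_embed:
  assumes L: "mchain c j L" and N: "1 \<le> N" "u \<in> L N" "keys u \<subseteq> D \<times> {j<..}"
    and T: "T \<subseteq> {j<..n}" "N \<le> card T"
  shows "\<exists>v\<in>L n. keys v \<subseteq> D \<times> T"
proof -
  have fin: "finite T" using T(1) finite_subset by blast
  obtain h where h: "bij_betw h {..<card T} T" "strict_mono_on {..<card T} h"
    using ex_bij_betw_strict_mono_card[OF fin] by blast
  have hT: "h l \<in> T" if "l < card T" for l using h(1) that by (auto simp: bij_betw_def)
  have hn: "j < h l \<and> h l \<le> n" if "l < card T" for l using hT[OF that] T(1) by auto
  \<comment> \<open>Column j + 1 goes to the least element of \<open>T\<close>, and so on; the value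
    \<open>n + l\<close> beyond the last column served only continues the map increasingly.\<close>
  define \<pi> where "\<pi> l = (if l \<le> j then l else if l \<le> j + card T then h (l - Suc j) else n + l)" for l
  have "strict_mono \<pi>"
  proof (rule strict_monoI)
    fix a b :: nat assume ab: "a < b"
    have mono: "h (a - Suc j) < h (b - Suc j)" if "j < a" "b \<le> j + card T"
      using strict_mono_onD[OF h(2)] that ab by (simp add: diff_less_mono)
    have bnd: "j < h (l - Suc j) \<and> h (l - Suc j) \<le> n" if "\<not> l \<le> j" "l \<le> j + card T" for l
      using hn[of "l - Suc j"] that by auto
    show "\<pi> a < \<pi> b"
    proof (cases "a \<le> j")
      case True
      then show ?thesis using ab bnd[of b] by (auto simp: \<pi>_def simp del: diff_is_0_eq')
    next
      case False
      then show ?thesis using ab mono bnd[of a] by (auto simp: \<pi>_def)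
    qed
  qed
  then have inc: "\<pi> \<in> Inc j" by (simp add: Inc_def \<pi>_def)
  have "card T \<le> card {j<..n}" by (rule card_mono[OF _ T(1)]) simp
  then have "N \<le> n" using T(2) by simp
  then have "\<pi> N \<le> n" using T(2) hn[of "N - Suc j"] by (auto simp: \<pi>_def)
  then have seg: "\<pi> \<in> Inc_seg j N n" using inc by (simp add: Inc_seg_def)
  have "keys (act_mon \<pi> u) \<subseteq> D \<times> T"
  proof -
    have "k \<in> D \<and> \<pi> l \<in> T" if "(k, l) \<in> keys u" for k l
    proof -
      have "k \<in> D" "j < l" using that N(3) by auto
      moreover have "l \<le> N"
        using that upset_mons[OF mchain_upset[OF L N(1)] N(2)] by (auto simp: mons_in_def)
      ultimately show ?thesis using T(2) hT[of "l - Suc j"] by (auto simp: \<pi>_def)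
    qed
    then show ?thesis by (auto simp: keys_act_mon[OF Inc_inj[OF inc]])
  qed
  then show ?thesis using mchain_act[OF L N(1) seg N(2)] by blast
qed

text \<open>By the pigeonhole principle, all but boundedly many columns of a variable set avoiding the
  chain contain at most \<open>c - card C\<close> variables.\<close>

lemma card_independent_le:
  assumes L: "mchain c j L" and C: "min_cover c j L C"
  shows "\<exists>B. \<forall>n\<ge>1. \<forall>U\<subseteq>vars c n. (\<forall>u\<in>L n. \<not> keys u \<subseteq> U) \<longrightarrow>
    card U + card C * n \<le> c * n + B"
proof -
  let ?g = "card C"
  have gc: "?g \<le> c" using C card_mono[of "{1..c}" C] by (simp add: min_cover_def)
  have "\<exists>N. 1 \<le> N \<and> (\<exists>u\<in>L N. keys u \<subseteq> D \<times> {j<..})" if D: "D \<subseteq> {1..c}" "c - ?g < card D" for D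
  proof -
    have "card D \<le> c" using D(1) card_mono[of "{1..c}" D] by simp
    moreover have "card ({1..c} - D) = c - card D" using D(1) by (simp add: card_Diff_subset finite_subset)
    ultimately have "card ({1..c} - D) < ?g" using D(2) gc by linarith
    moreover have "{1..c} - ({1..c} - D) = D" using D(1) by blast
    ultimately have "\<not> free j L D"
      using C unfolding min_cover_def by (metis Diff_subset not_less)
    then show ?thesis by (auto simp: free_def)
  qed
  then obtain N where N: "\<And>D. D \<subseteq> {1..c} \<Longrightarrow> c - ?g < card D \<Longrightarrow>
      1 \<le> N D \<and> (\<exists>u\<in>L (N D). keys u \<subseteq> D \<times> {j<..})"
    by metis
  \<comment> \<open>Bounds the number of columns with more than \<open>c - ?g\<close> variables: the
    first j, and for each row set \<open>D\<close> at most \<open>N D\<close> columns equal to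
    \<open>D\<close>, since more would put a monomial of \<open>L n\<close> inside
    \<open>U\<close>.\<close>
  define K where "K = j + (\<Sum>D\<in>Pow {1..c}. N D)"
  have "card U + ?g * n \<le> c * n + ?g * K"
    if n: "1 \<le> n" and U: "U \<subseteq> vars c n" "\<forall>u\<in>L n. \<not> keys u \<subseteq> U" for n U
  proof -
    define col where "col l = {k. (k, l) \<in> U}" for l
    have col: "col l \<subseteq> {1..c}" for l using U(1) by (auto simp: col_def)
    define T where "T = {l \<in> {1..n}. c - ?g < card (col l)}"
    let ?T = "\<lambda>D. {l \<in> {j<..n}. col l = D}"
    let ?P = "{D \<in> Pow {1..c}. c - ?g < card D}"
    have cardT: "card (?T D) \<le> N D" if "D \<in> ?P" for D
    proof (rule ccontr)
      assume "\<not> card (?T D) \<le> N D"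
      then have le: "N D \<le> card (?T D)" by simp
      obtain u where u: "u \<in> L (N D)" "keys u \<subseteq> D \<times> {j<..}" "1 \<le> N D"
        using N[of D] \<open>D \<in> ?P\<close> by blast
      obtain v where v: "v \<in> L n" "keys v \<subseteq> D \<times> ?T D"
        using columns_embed[OF L u(3,1,2) _ le] by blast
      have "D \<times> ?T D \<subseteq> U" by (auto simp: col_def)
      then show False using v U(2) by blast
    qed
    have finP: "finite ?P" by simp
    have "T \<subseteq> {1..j} \<union> (\<Union>D\<in>?P. ?T D)"
      using col by (auto simp: T_def)
    then have "card T \<le> card ({1..j} \<union> (\<Union>D\<in>?P. ?T D))"
      by (rule card_mono[rotated]) simp
    also have "\<dots> \<le> j + card (\<Union>D\<in>?P. ?T D)"
      using card_Un_le[of "{1..j}"] by simp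
    also have "card (\<Union>D\<in>?P. ?T D) \<le> (\<Sum>D\<in>?P. card (?T D))"
      by (rule card_UN_le[OF finP])
    also have "(\<Sum>D\<in>?P. card (?T D)) \<le> (\<Sum>D\<in>?P. N D)"
      by (rule sum_mono[OF cardT])
    also have "\<dots> \<le> (\<Sum>D\<in>Pow {1..c}. N D)"
      by (rule sum_mono2) auto
    finally have "card T \<le> K" by (simp add: K_def)
    have "U = (\<lambda>(l, k). (k, l)) ` (SIGMA l:{1..n}. col l)"
      using U(1) by (force simp: col_def)
    then have "card U = card (SIGMA l:{1..n}. col l)"
      by (simp add: card_image inj_on_def)
    also have "\<dots> = (\<Sum>l=1..n. card (col l))"
      by (rule card_SigmaI) (simp_all add: finite_subset[OF col])
    also have "\<dots> \<le> (\<Sum>l=1..n. (c - ?g) + (if l \<in> T then ?g else 0))"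
    proof (rule sum_mono)
      fix l assume l: "l \<in> {1..n}"
      have "card (col l) \<le> c" using card_mono[OF _ col, of l] by simp
      then show "card (col l) \<le> (c - ?g) + (if l \<in> T then ?g else 0)"
        using l gc by (auto simp: T_def)
    qed
    also have "\<dots> = (c - ?g) * n + ?g * card T"
    proof -
      have "{1..n} \<inter> T = T" by (auto simp: T_def)
      then show ?thesis by (simp add: sum.distrib sum.If_cases)
    qed
    also have "\<dots> \<le> (c - ?g) * n + ?g * K" using \<open>card T \<le> K\<close> by simp
    finally have "card U \<le> (c - ?g) * n + ?g * K" .
    moreover have "(c - ?g) * n + ?g * n = c * n" using gc by (metis add_mult_distrib le_add_diff_inverse2)
    ultimately show ?thesis by linarith
  qed
  then show ?thesis by blast
qed


section \<open>Initial ideals\<close>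

lemma mons_in_vars_mons: "u \<in> mons_in (vars c n) \<Longrightarrow> u \<in> mons c"
  unfolding mons_def by (rule mons_in_mono) auto

lemma ord_max:
  assumes "monomial_order c ord" "finite S" "S \<noteq> {}" "S \<subseteq> mons c"
  shows "\<exists>u\<in>S. \<forall>v\<in>S. (v, u) \<in> ord"
proof -
  have lin: "refl_on (mons c) ord" "trans ord" "total_on (mons c) ord"
    using assms(1)
    by (auto simp: monomial_order_def linear_order_on_def partial_order_on_def preorder_on_def)
  show ?thesis
    using assms(2-4)
  proof (induction S rule: finite_ne_induct)
    case (singleton x)
    then show ?case using lin(1) by (auto simp: refl_on_def)
  next
    case (insert x S)
    then obtain u where u: "u \<in> S" "\<forall>v\<in>S. (v, u) \<in> ord" by auto
    have xu: "x \<in> mons c" "u \<in> mons c" using insert.prems u(1) by auto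
    have refl: "(x, x) \<in> ord" using lin(1) xu by (auto simp: refl_on_def)
    show ?case
    proof (cases "(x, u) \<in> ord")
      case True
      then show ?thesis using u by auto
    next
      case False
      then have "(u, x) \<in> ord" using lin(3) xu refl by (auto simp: total_on_def)
      then have "\<forall>v\<in>insert x S. (v, x) \<in> ord" using u(2) refl lin(2) by (auto dest: transD)
      then show ?thesis by blast
    qed
  qed
qed

lemma ord_antisym: "monomial_order c ord \<Longrightarrow> (u, v) \<in> ord \<Longrightarrow> (v, u) \<in> ord \<Longrightarrow> u = v"
  by (auto simp: monomial_order_def linear_order_on_def partial_order_on_def dest: antisymD)

lemma lead_mon_eqI:
  assumes "monomial_order c ord" "u \<in> keys f" "\<And>v. v \<in> keys f \<Longrightarrow> (v, u) \<in> ord"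
  shows "lead_mon ord f = u"
  unfolding lead_mon_def
  by (rule the_equality) (use assms ord_antisym[OF assms(1)] in blast)+

lemma lead_mon:
  assumes "monomial_order c ord" "keys f \<subseteq> mons c" "f \<noteq> 0"
  shows "lead_mon ord f \<in> keys f" "v \<in> keys f \<Longrightarrow> (v, lead_mon ord f) \<in> ord"
proof -
  obtain u where u: "u \<in> keys f" "\<forall>v\<in>keys f. (v, u) \<in> ord"
    using ord_max[OF assms(1) finite_keys _ assms(2)] assms(3) by auto
  then have "lead_mon ord f = u" using lead_mon_eqI[OF assms(1)] by blast
  then show "lead_mon ord f \<in> keys f" "v \<in> keys f \<Longrightarrow> (v, lead_mon ord f) \<in> ord" using u by auto
qed

lemma lead_mon_eq_0:
  assumes ord: "monomial_order c ord" and f: "keys f \<subseteq> mons c" "f \<noteq> 0" and "lead_mon ord f = 0"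
  shows "keys f \<subseteq> {0}"
proof
  fix v assume v: "v \<in> keys f"
  have "v = 0"
  proof (rule ord_antisym[OF ord])
    show "(v, 0) \<in> ord" using lead_mon(2)[OF ord f v] assms(4) by simp
    show "(0, v) \<in> ord" using ord v f(1) unfolding monomial_order_def by blast
  qed
  then show "v \<in> {0}" by simp
qed

lemma lead_mon_single_times:
  fixes f :: "'k::field mpoly"
  assumes ord: "monomial_order c ord" and f: "keys f \<subseteq> mons c" "f \<noteq> 0" and w: "w \<in> mons c"
  shows "lead_mon ord (to_poly w * f) = w + lead_mon ord f"
proof (rule lead_mon_eqI[OF ord])
  show "w + lead_mon ord f \<in> keys (to_poly w * f)"
    using lead_mon(1)[OF ord f] by (simp add: keys_single_times)
  fix v assume "v \<in> keys (to_poly w * f)"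
  then obtain u where u: "v = w + u" "u \<in> keys f" by (auto simp: keys_single_times)
  then have "(u, lead_mon ord f) \<in> ord" using lead_mon(2)[OF ord f] by blast
  moreover have "u \<in> mons c" "lead_mon ord f \<in> mons c" using u(2) lead_mon(1)[OF ord f] f(1) by auto
  ultimately have "(u + w, lead_mon ord f + w) \<in> ord"
    using ord w unfolding monomial_order_def by blast
  then show "(v, w + lead_mon ord f) \<in> ord" using u(1) by (simp add: add.commute)
qed

definition leads :: "mon rel \<Rightarrow> 'k::field mpoly set \<Rightarrow> mon set" where
  "leads ord J = {lead_mon ord f | f. f \<in> J \<and> f \<noteq> 0}"

lemma upset_leads:
  fixes J :: "'k::field mpoly set"
  assumes ord: "monomial_order c ord" and J: "ideal J (poly_ring (vars c n))"
  shows "upset (vars c n) (leads ord J)"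
proof -
  have mem: "lead_mon ord f \<in> mons_in (vars c n)" "keys f \<subseteq> mons c"
    if "f \<in> J" "f \<noteq> 0" for f
  proof -
    have *: "keys f \<subseteq> mons_in (vars c n)" by (rule ideal_carrier[OF J that(1)])
    then show "keys f \<subseteq> mons c" using mons_in_vars_mons by blast
    then show "lead_mon ord f \<in> mons_in (vars c n)" using lead_mon(1)[OF ord _ that(2)] * by blast
  qed
  have "v \<in> leads ord J" if u: "u \<in> leads ord J" and v: "v \<in> mons_in (vars c n)" "mdvd u v" for u v
  proof -
    obtain f where f: "u = lead_mon ord f" "f \<in> J" "f \<noteq> 0" using u by (auto simp: leads_def)
    let ?w = "v - u"
    have w: "?w \<in> mons_in (vars c n)" by (rule mons_in_diff[OF v(1)])
    have "lead_mon ord (to_poly ?w * f) = ?w + u"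
      unfolding f(1) by (rule lead_mon_single_times[OF ord mem(2)[OF f(2,3)] f(3)])
        (use w f(1) mons_in_vars_mons in auto)
    then have "lead_mon ord (to_poly ?w * f) = v" using mdvd_diff[OF v(2)] by (simp add: add.commute)
    moreover have "to_poly ?w * f \<in> J" by (rule ideal_times[OF J f(2)]) (use w in auto)
    moreover have "to_poly ?w * f \<noteq> 0"
      using f(3) keys_single_times[of 1 ?w f] by (metis image_is_empty keys_eq_empty one_neq_zero)
    ultimately show ?thesis unfolding leads_def by force
  qed
  then show ?thesis using mem(1) by (auto simp: upset_def leads_def)
qed

lemma initial_chain_eq:
  assumes ord: "monomial_order c ord" and J: "ideal (I n) (poly_ring (vars c n))"
  shows "initial_chain c ord I n = (polys (leads ord (I n)) :: 'k::field mpoly set)"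
proof -
  have up: "upset (vars c n) (leads ord (I n))" by (rule upset_leads[OF ord J])
  have "{to_poly (lead_mon ord f) | f. f \<in> I n \<and> f \<noteq> 0} = (to_poly ` leads ord (I n) :: 'k mpoly set)"
    by (auto simp: leads_def)
  then have "initial_chain c ord I n = genideal (poly_ring (vars c n)) (to_poly ` leads ord (I n))"
    unfolding initial_chain_def R_fin_poly_ring by simp
  also have "\<dots> = polys (up (vars c n) (leads ord (I n)))"
    using up by (intro genideal_to_poly) (auto simp: upset_def)
  also have "up (vars c n) (leads ord (I n)) = leads ord (I n)"
    using up mdvd_refl unfolding up_def upset_def by blast
  finally show ?thesis .
qed

lemma lookup_act:
  assumes "inj \<pi>" shows "lookup (act \<pi> (f :: 'k::field mpoly)) (act_mon \<pi> u) = lookup f u"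
proof -
  have "lookup (act \<pi> f) (act_mon \<pi> u) = (\<Sum>v\<in>keys f. if v = u then lookup f v else 0)"
    unfolding act_def lookup_sum
    by (rule sum.cong) (auto simp: lookup_single when_def dest: act_mon_inj[OF assms])
  also have "\<dots> = lookup f u" by (auto simp: in_keys_iff)
  finally show ?thesis .
qed

lemma lead_mon_act:
  fixes f :: "'k::field mpoly"
  assumes ord: "monomial_order c ord" "respects_Inc c i ord" and \<pi>: "\<pi> \<in> Inc i"
    and f: "keys f \<subseteq> mons c" "f \<noteq> 0"
  shows "lead_mon ord (act \<pi> f) = act_mon \<pi> (lead_mon ord f)" "act \<pi> f \<noteq> 0"
proof -
  have inj: "inj \<pi>" using \<pi> by (rule Inc_inj)
  have l: "act_mon \<pi> (lead_mon ord f) \<in> keys (act \<pi> f)"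
    using lead_mon(1)[OF ord(1) f] by (simp add: in_keys_iff lookup_act[OF inj])
  then show "act \<pi> f \<noteq> 0" by auto
  show "lead_mon ord (act \<pi> f) = act_mon \<pi> (lead_mon ord f)"
  proof (rule lead_mon_eqI[OF ord(1) l])
    fix v assume "v \<in> keys (act \<pi> f)"
    then obtain u where u: "v = act_mon \<pi> u" "u \<in> keys f" using keys_act[of \<pi> f] by blast
    moreover have "lead_mon ord f \<in> mons c" "u \<in> mons c"
      using lead_mon(1)[OF ord(1) f] u(2) f(1) by auto
    ultimately show "(v, act_mon \<pi> (lead_mon ord f)) \<in> ord"
      using lead_mon(2)[OF ord(1) f u(2)] ord(2) \<pi> unfolding respects_Inc_def by blast
  qed
qed

lemma mchain_leads:
  fixes I :: "nat \<Rightarrow> 'k::field mpoly set"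
  assumes ord: "monomial_order c ord" "respects_Inc c i ord" and I: "inc_invariant_chain c i I"
  shows "mchain c i (\<lambda>n. leads ord (I n))"
  unfolding mchain_def
proof (intro conjI allI impI ballI)
  have id: "ideal (I n) (poly_ring (vars c n))" if "1 \<le> n" for n
    using I that by (simp add: inc_invariant_chain_def R_fin_poly_ring)
  show "upset (vars c n) (leads ord (I n))" if "1 \<le> n" for n
    by (rule upset_leads[OF ord(1) id[OF that]])
  fix m n u \<pi> assume mn: "1 \<le> m" "m \<le> n" and u: "u \<in> leads ord (I m)" and \<pi>: "\<pi> \<in> Inc_seg i m n"
  obtain f where f: "u = lead_mon ord f" "f \<in> I m" "f \<noteq> 0" using u by (auto simp: leads_def)
  have "keys f \<subseteq> mons c" using ideal_carrier[OF id[OF mn(1)] f(2)] mons_in_vars_mons by blast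
  note l = lead_mon_act[OF ord Inc_seg_Inc[OF \<pi>] this f(3)]
  have "act \<pi> f \<in> I n" using I mn f(2) \<pi> unfolding inc_invariant_chain_def by blast
  then show "act_mon \<pi> u \<in> leads ord (I n)" using l f(1) by (auto simp: leads_def intro!: exI[of _ "act \<pi> f"])
qed

text \<open>As 1 is the least monomial, a polynomial with leading monomial 1 is a nonzero constant,
  which lies in no proper ideal.\<close>

lemma proper_leads:
  fixes I :: "nat \<Rightarrow> 'k::field mpoly set"
  assumes ord: "monomial_order c ord" and I: "inc_invariant_chain c i I"
    and pr: "\<forall>n\<ge>1. I n \<noteq> carrier (R_fin c n)"
  shows "proper (\<lambda>n. leads ord (I n))"
  unfolding proper_def
proof (intro allI impI notI)
  fix n :: nat assume n: "1 \<le> n" and "0 \<in> leads ord (I n)"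
  then obtain f where f: "lead_mon ord f = 0" "f \<in> I n" "f \<noteq> 0" by (auto simp: leads_def)
  have id: "ideal (I n) (poly_ring (vars c n))"
    using I n by (simp add: inc_invariant_chain_def R_fin_poly_ring)
  have "keys f \<subseteq> mons c" using ideal_carrier[OF id f(2)] mons_in_vars_mons by blast
  from lead_mon_eq_0[OF ord this f(3,1)]
  have "keys f \<subseteq> {0}" .
  then have fs: "f = single 0 (lookup f 0)"
    by (intro poly_mapping_eqI) (auto simp: lookup_single when_def in_keys_iff)
  then have ne: "lookup f 0 \<noteq> 0" using f(3) by (metis single_zero)
  have "single 0 (inverse (lookup f 0)) * f \<in> I n"
    by (rule ideal_times[OF id f(2)]) (use ne in auto)
  moreover have "single 0 (inverse (lookup f 0)) * f = 1"
    by (subst fs) (use ne in \<open>simp add: mult_single flip: single_one\<close>)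
  ultimately have "1 \<in> I n" by simp
  have "g \<in> I n" if "keys g \<subseteq> mons_in (vars c n)" for g
    using ideal_times[OF id \<open>1 \<in> I n\<close> that] by simp
  then have "I n = carrier (R_fin c n)"
    using ideal_carrier[OF id] by (auto simp: R_fin_poly_ring)
  then show False using pr n by blast
qed


section \<open>Iterated colon ideals\<close>

text \<open>Divisibility by a member of \<open>L n\<close> stands in for membership, because for n
  \<le> j the product with the column monomial leaves \<open>R_fin c n\<close>. In this form one
  formula serves both cases of \<open>colon_chain\<close>.\<close>

definition colon_mons :: "nat \<Rightarrow> nat \<Rightarrow> (nat \<Rightarrow> nat) \<Rightarrow> (nat \<Rightarrow> mon set) \<Rightarrow> nat \<Rightarrow> mon set" where
  "colon_mons c j e L n = {u \<in> mons_in (vars c n).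
     (\<exists>v\<in>L n. mdvd v (u + column_mon c (Suc j) e)) \<or> (\<exists>k\<in>{1..c}. (k, Suc j) \<in> keys u)}"

lemma lookup_column_mon:
  "lookup (column_mon c l e) (k, l') = (if k \<in> {1..c} \<and> l' = l then e k else 0)"
proof -
  have "lookup (column_mon c l e) (k, l') = (\<Sum>k'=1..c. if k' = k \<and> l' = l then e k' else 0)"
    unfolding column_mon_def by (auto simp: lookup_sum lookup_single when_def intro!: sum.cong)
  also have "\<dots> = (if k \<in> {1..c} \<and> l' = l then e k else 0)"
    by (cases "l' = l") auto
  finally show ?thesis .
qed

lemma keys_column_mon: "keys (column_mon c l e) \<subseteq> {1..c} \<times> {l}"
  by (auto simp: in_keys_iff lookup_column_mon split: if_splits)

lemma colon_step_polys:
  assumes L: "upset V L" and V: "{1..c} \<times> {Suc j} \<subseteq> V"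
  shows "colon_step c j e (poly_ring V) (polys L :: 'k::field mpoly set)
    = polys {u \<in> mons_in V. u + column_mon c (Suc j) e \<in> L \<or> (\<exists>k\<in>{1..c}. (k, Suc j) \<in> keys u)}"
proof -
  let ?w = "column_mon c (Suc j) e"
  have w: "?w \<in> mons_in V" using keys_column_mon[of c "Suc j" e] V by (auto simp: mons_in_def)
  let ?S = "{u \<in> mons_in V. u + ?w \<in> L} \<union> {single (k, Suc j) 1 | k. k \<in> {1..c}}"
  have "(k, Suc j) \<in> V" if "k \<in> {1..c}" for k using V that by blast
  then have S: "?S \<subseteq> mons_in V" by (auto intro: mons_in_singleI)
  have "up V ?S = {u \<in> mons_in V. u + ?w \<in> L \<or> (\<exists>k\<in>{1..c}. (k, Suc j) \<in> keys u)}"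
  proof (intro Set.set_eqI iffI)
    fix v assume "v \<in> up V ?S"
    then obtain u where u: "u \<in> ?S" "mdvd u v" "v \<in> mons_in V" by (auto simp: up_def)
    show "v \<in> {u \<in> mons_in V. u + ?w \<in> L \<or> (\<exists>k\<in>{1..c}. (k, Suc j) \<in> keys u)}"
    proof (cases "u + ?w \<in> L")
      case True
      then have "v + ?w \<in> L"
        by (rule upsetD[OF L]) (use u w in \<open>auto intro: mdvd_add_mono\<close>)
      then show ?thesis using u by simp
    next
      case False
      then obtain k where "k \<in> {1..c}" "u = single (k, Suc j) 1" using u(1) by auto
      then show ?thesis using mdvd_keys[OF u(2)] u(3) by auto
    qed
  next
    fix v assume v: "v \<in> {u \<in> mons_in V. u + ?w \<in> L \<or> (\<exists>k\<in>{1..c}. (k, Suc j) \<in> keys u)}"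
    show "v \<in> up V ?S"
    proof (cases "v + ?w \<in> L")
      case True
      then show ?thesis using v mdvd_refl unfolding up_def by blast
    next
      case False
      then obtain k where k: "k \<in> {1..c}" "(k, Suc j) \<in> keys v" using v by blast
      then have "mdvd (single (k, Suc j) 1) v"
        by (auto simp: mdvd_def lookup_single when_def in_keys_iff)
      then show ?thesis using k(1) v unfolding up_def by blast
    qed
  qed
  moreover have "colon_step c j e (poly_ring V) (polys L :: 'k mpoly set) = polys (up V ?S)"
    unfolding colon_step_def colon_ideal_polys[OF w]
  proof (rule genideal_polys[OF _ S])
    fix f :: "'k mpoly"
    assume f: "f \<in> polys {u \<in> mons_in V. u + ?w \<in> L} \<union> {to_poly (single (k, Suc j) 1) | k. k \<in> {1..c}}"
    then have "keys f \<subseteq> ?S" by (auto simp: polys_def)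
    moreover have "?S \<subseteq> up V ?S" using S mdvd_refl unfolding up_def by blast
    ultimately show "f \<in> polys (up V ?S)" by (auto simp: polys_def)
  next
    fix u assume "u \<in> ?S"
    then show "(to_poly u :: 'k mpoly) \<in> polys {u \<in> mons_in V. u + ?w \<in> L} \<union>
        {to_poly (single (k, Suc j) 1) | k. k \<in> {1..c}}"
      by (auto simp: polys_def)
  qed
  ultimately show ?thesis by simp
qed

lemma colon_chain_polys:
  assumes L: "upset (vars c n) (L n)" and n: "1 \<le> n" and J: "J n = (polys (L n) :: 'k::field mpoly set)"
  shows "colon_chain c j J e n = polys (colon_mons c j e L n)"
proof (cases "j < n")
  case True
  let ?w = "column_mon c (Suc j) e"
  have "{1..c} \<times> {Suc j} \<subseteq> vars c n" using True by auto
  note step = colon_step_polys[OF L this, of e, where 'k='k]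
  have w: "?w \<in> mons_in (vars c n)" using keys_column_mon[of c "Suc j" e] True by (auto simp: mons_in_def)
  have "u + ?w \<in> L n \<longleftrightarrow> (\<exists>v\<in>L n. mdvd v (u + ?w))" if "u \<in> mons_in (vars c n)" for u
    using upsetD[OF L, of _ "u + ?w"] that w by (auto intro: mdvd_refl)
  then have "{u \<in> mons_in (vars c n). u + ?w \<in> L n \<or> (\<exists>k\<in>{1..c}. (k, Suc j) \<in> keys u)}
      = colon_mons c j e L n"
    unfolding colon_mons_def by blast
  then show ?thesis using True step J by (simp add: colon_chain_def R_fin_poly_ring)
next
  case False
  let ?w = "column_mon c (Suc j) e"
  let ?V = "{1..c} \<times> {1..} :: (nat \<times> nat) set"
  have LV: "L n \<subseteq> mons_in ?V" using upset_mons[OF L] by (force simp: mons_in_def)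
  have "genideal (poly_ring ?V) (polys (L n) :: 'k mpoly set) = polys (up ?V (L n))"
  proof (rule genideal_polys[OF _ LV])
    fix f :: "'k mpoly" assume "f \<in> polys (L n)"
    moreover have "L n \<subseteq> up ?V (L n)" using LV mdvd_refl unfolding up_def by blast
    ultimately show "f \<in> polys (up ?V (L n))" by (auto simp: polys_def)
  qed simp
  then have gen: "genideal (R_inf c) (J n) = polys (up ?V (L n))"
    unfolding R_inf_def J .
  have "{1..c} \<times> {Suc j} \<subseteq> ?V" by auto
  from colon_step_polys[OF upset_up this, of e "L n", where 'k = 'k]
  have "colon_step c j e (R_inf c) (genideal (R_inf c) (J n)) = (polys {u \<in> mons_in ?V.
      u + ?w \<in> up ?V (L n) \<or> (\<exists>k\<in>{1..c}. (k, Suc j) \<in> keys u)} :: 'k mpoly set)"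
    unfolding gen by (simp only: R_inf_def)
  then have "colon_chain c j J e n = (polys (mons_in (vars c n)) :: 'k mpoly set) \<inter> polys {u \<in> mons_in ?V.
      u + ?w \<in> up ?V (L n) \<or> (\<exists>k\<in>{1..c}. (k, Suc j) \<in> keys u)}"
    using False by (simp add: colon_chain_def R_fin_poly_ring polys_def)
  also have "\<dots> = polys (mons_in (vars c n) \<inter> {u \<in> mons_in ?V.
      u + ?w \<in> up ?V (L n) \<or> (\<exists>k\<in>{1..c}. (k, Suc j) \<in> keys u)})"
    by (auto simp: polys_def)
  also have "mons_in (vars c n) \<inter> {u \<in> mons_in ?V.
      u + ?w \<in> up ?V (L n) \<or> (\<exists>k\<in>{1..c}. (k, Suc j) \<in> keys u)} = colon_mons c j e L n"
  proof -
    have "mons_in (vars c n) \<subseteq> mons_in ?V" by (force simp: mons_in_def)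
    moreover have "?w \<in> mons_in ?V" using keys_column_mon[of c "Suc j" e] by (auto simp: mons_in_def)
    ultimately show ?thesis unfolding colon_mons_def up_def by auto
  qed
  finally show ?thesis .
qed

lemma act_mon_column:
  assumes "\<pi> \<in> Inc j" "l \<le> j" shows "act_mon \<pi> (column_mon c l e) = column_mon c l e"
proof (rule act_mon_eqI[OF Inc_inj[OF assms(1)]])
  show "lookup (column_mon c l e) (k, \<pi> l') = lookup (column_mon c l e) (k, l')" for k l'
    using Inc_fix[OF assms] Inc_inj[OF assms(1)] by (metis injD lookup_column_mon)
  show "lookup (column_mon c l e) (k, l') = 0" if "l' \<notin> range \<pi>" for k l'
    using that Inc_fix[OF assms] by (metis lookup_column_mon rangeI)
qed

text \<open>Members of \<open>Inc (Suc j)\<close> fix column j + 1, hence commute with the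
  multiplication by its monomial and permute none of its variables.\<close>

lemma mchain_colon_mons:
  assumes L: "mchain c j L"
  shows "mchain c (Suc j) (colon_mons c j e L)"
  unfolding mchain_def
proof (intro conjI allI impI ballI)
  let ?w = "column_mon c (Suc j) e"
  show "upset (vars c n) (colon_mons c j e L n)" for n
    unfolding upset_def
  proof (intro conjI ballI impI)
    show "colon_mons c j e L n \<subseteq> mons_in (vars c n)" by (auto simp: colon_mons_def)
    fix u v assume u: "u \<in> colon_mons c j e L n" and v: "v \<in> mons_in (vars c n)" "mdvd u v"
    have dv: "mdvd (u + ?w) (v + ?w)" using v(2) by (rule mdvd_add_mono) simp
    have "\<exists>x\<in>L n. mdvd x (v + ?w)" if "\<exists>x\<in>L n. mdvd x (u + ?w)"
      using that mdvd_trans[OF _ dv] by auto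
    moreover have "\<exists>k\<in>{1..c}. (k, Suc j) \<in> keys v" if "\<exists>k\<in>{1..c}. (k, Suc j) \<in> keys u"
      using that mdvd_keys[OF v(2)] by auto
    ultimately show "v \<in> colon_mons c j e L n"
      using u v(1) unfolding colon_mons_def by (auto simp del: split_paired_Ex)
  qed
  fix m n u \<pi> assume mn: "1 \<le> m" "m \<le> n" and u: "u \<in> colon_mons c j e L m"
    and \<pi>: "\<pi> \<in> Inc_seg (Suc j) m n"
  have inc: "\<pi> \<in> Inc (Suc j)" using \<pi> by (rule Inc_seg_Inc)
  have inj: "inj \<pi>" using inc by (rule Inc_inj)
  have segj: "\<pi> \<in> Inc_seg j m n" using \<pi> by (auto simp: Inc_seg_def Inc_def)
  have um: "u \<in> mons_in (vars c m)" using u by (simp add: colon_mons_def)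
  have "act_mon \<pi> u \<in> mons_in (vars c n)" by (rule act_mon_mons_in[OF \<pi> um])
  moreover have "(\<exists>v\<in>L n. mdvd v (act_mon \<pi> u + ?w)) \<or> (\<exists>k\<in>{1..c}. (k, Suc j) \<in> keys (act_mon \<pi> u))"
  proof (cases "\<exists>k\<in>{1..c}. (k, Suc j) \<in> keys u")
    case True
    then obtain k where "k \<in> {1..c}" "(k, Suc j) \<in> keys u" by blast
    then have "(k, \<pi> (Suc j)) \<in> keys (act_mon \<pi> u)" by (force simp: keys_act_mon[OF inj])
    then show ?thesis using \<open>k \<in> {1..c}\<close> Inc_fix[OF inc, of "Suc j"] by auto
  next
    case False
    then obtain v where v: "v \<in> L m" "mdvd v (u + ?w)" using u by (auto simp: colon_mons_def)
    have "mdvd (act_mon \<pi> v) (act_mon \<pi> u + ?w)"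
      using mdvd_act_mon[OF inj v(2)] act_mon_column[OF inc, of "Suc j"] by (simp add: act_mon_add[OF inj])
    then show ?thesis using mchain_act[OF L mn(1) segj v(1)] by blast
  qed
  ultimately show "act_mon \<pi> u \<in> colon_mons c j e L n" by (simp add: colon_mons_def)
qed

section \<open>Several colon steps as a single colon\<close>

fun iter_mons :: "nat \<Rightarrow> nat \<Rightarrow> (nat \<Rightarrow> mon set) \<Rightarrow> (nat \<Rightarrow> nat) list \<Rightarrow> nat \<Rightarrow> mon set" where
  "iter_mons c j L [] = L"
| "iter_mons c j L (e # es) = iter_mons c (Suc j) (colon_mons c j e L) es"

fun iter_mon :: "nat \<Rightarrow> nat \<Rightarrow> (nat \<Rightarrow> nat) list \<Rightarrow> mon" where
  "iter_mon c j [] = 0"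
| "iter_mon c j (e # es) = column_mon c (Suc j) e + iter_mon c (Suc j) es"

lemma mchain_iter_mons: "mchain c j L \<Longrightarrow> mchain c (j + length es) (iter_mons c j L es)"
proof (induction es arbitrary: j L)
  case (Cons e es)
  show ?case using Cons.IH[OF mchain_colon_mons[OF Cons.prems]] by simp
qed simp

lemma iter_chain_polys:
  assumes "mchain c j L" "\<And>n. 1 \<le> n \<Longrightarrow> J n = (polys (L n) :: 'k::field mpoly set)" "1 \<le> n"
  shows "iter_chain c j J es n = polys (iter_mons c j L es n)"
  using assms(1,2)
proof (induction es arbitrary: j L J)
  case Nil
  then show ?case using assms(3) by simp
next
  case (Cons e es)
  show ?case unfolding iter_chain.simps iter_mons.simps
    by (rule Cons.IH[OF mchain_colon_mons[OF Cons.prems(1)]])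
      (rule colon_chain_polys[OF mchain_upset[OF Cons.prems(1)] _ Cons.prems(2)])
qed

lemma keys_iter_mon: "keys (iter_mon c j es) \<subseteq> {1..c} \<times> {j<..j + length es}"
proof (induction es arbitrary: j)
  case (Cons e es)
  show ?case using Cons[of "Suc j"] keys_column_mon[of c "Suc j" e] by (auto simp: keys_add_mon)
qed simp

text \<open>Successive colons amount to one colon by the product of the column monomials. The
  variables adjoined at one step do not disturb the later steps, because those take colons by
  monomials in other columns.\<close>

lemma iter_mons_iff:
  assumes "mchain c j L" "1 \<le> n" "u \<in> mons_in (vars c n)"
  shows "u \<in> iter_mons c j L es n \<longleftrightarrow> (\<exists>v\<in>L n. mdvd v (u + iter_mon c j es)) \<or>
    (\<exists>k\<in>{1..c}. \<exists>l\<in>{j<..j + length es}. (k, l) \<in> keys u)"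
  using assms(1)
proof (induction es arbitrary: j L)
  case Nil
  show ?case using upsetD[OF mchain_upset[OF Nil assms(2)] _ assms(3)] by (auto intro: mdvd_refl)
next
  case (Cons e es)
  let ?w = "column_mon c (Suc j) e" and ?W = "iter_mon c (Suc j) es"
  have "(\<exists>v\<in>colon_mons c j e L n. mdvd v (u + ?W)) \<longleftrightarrow>
    (\<exists>v\<in>L n. mdvd v (u + (?w + ?W))) \<or> (\<exists>k\<in>{1..c}. (k, Suc j) \<in> keys u)" (is "?A \<longleftrightarrow> ?B")
  proof
    assume ?A
    then obtain v where v: "v \<in> colon_mons c j e L n" "mdvd v (u + ?W)" by blast
    show ?B
    proof (cases "\<exists>k\<in>{1..c}. (k, Suc j) \<in> keys v")
      case True
      then obtain k where k: "k \<in> {1..c}" "(k, Suc j) \<in> keys v" by blast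
      then have "(k, Suc j) \<in> keys u"
        using mdvd_keys[OF v(2)] keys_iter_mon[of c "Suc j" es] by (auto simp: keys_add_mon)
      then show ?thesis using k by blast
    next
      case False
      then obtain v' where v': "v' \<in> L n" "mdvd v' (v + ?w)" using v(1) by (auto simp: colon_mons_def)
      have "mdvd (v + ?w) (u + ?W + ?w)" using v(2) by (rule mdvd_add_mono) simp
      then show ?thesis using v' mdvd_trans[OF v'(2)] by (auto simp: add_ac)
    qed
  next
    assume ?B
    then show ?A
    proof
      assume "\<exists>v\<in>L n. mdvd v (u + (?w + ?W))"
      then obtain v where v: "v \<in> L n" "mdvd v (u + (?w + ?W))" by blast
      \<comment> \<open>With truncated subtraction, \<open>v - ?w\<close> is the least monomial
        whose product with \<open>?w\<close> is divisible by v.\<close>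
      have "v - ?w \<in> mons_in (vars c n)"
        by (rule mons_in_diff[OF upset_mons[OF mchain_upset[OF Cons.prems assms(2)] v(1)]])
      moreover have "mdvd v (v - ?w + ?w)"
        unfolding mdvd_def lookup_add lookup_minus by (intro allI) arith
      moreover have "mdvd (v - ?w) (u + ?W)"
        unfolding mdvd_def
      proof
        fix x show "lookup (v - ?w) x \<le> lookup (u + ?W) x"
          using v(2)[unfolded mdvd_def, rule_format, of x] by (simp add: lookup_add lookup_minus)
      qed
      ultimately show ?A using v(1) unfolding colon_mons_def by blast
    next
      assume "\<exists>k\<in>{1..c}. (k, Suc j) \<in> keys u"
      then obtain k where k: "k \<in> {1..c}" "(k, Suc j) \<in> keys u" by blast
      have "(k, Suc j) \<in> vars c n" using k assms(3) by (auto simp: mons_in_def)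
      then have "single (k, Suc j) 1 \<in> colon_mons c j e L n"
        using k(1) by (auto simp: colon_mons_def mons_in_def)
      moreover have "mdvd (single (k, Suc j) 1) (u + ?W)"
        using k(2) by (auto simp: mdvd_def lookup_single lookup_add when_def in_keys_iff)
      ultimately show ?A by blast
    qed
  qed
  moreover have "{j<..j + length (e # es)} = insert (Suc j) {Suc j<..Suc j + length es}" by auto
  ultimately show ?case using Cons.IH[OF mchain_colon_mons[OF Cons.prems]] by auto
qed

text \<open>If \<open>\<pi> v\<close> lives in the columns up to \<open>i + k\<close>, then \<open>\<pi>\<close> may be replaced by a map that
  agrees with it there and shifts by \<open>k\<close> afterwards.\<close>

lemma divisor_in_early_member:
  assumes L: "mchain c i L" and R: "stable c i L R" and W: "keys W \<subseteq> {1..c} \<times> {..i + k}"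
    and n: "1 \<le> n" and v: "v \<in> L n" "mdvd v W"
  shows "\<exists>u\<in>L (R + k). mdvd u W"
proof -
  have R1: "1 \<le> R" using R by (simp add: stable_def)
  have "v \<in> L (max n R)" using mchain_mono[OF L n, of "max n R"] v(1) by auto
  then obtain u \<pi> where u: "u \<in> L R" "\<pi> \<in> Inc_seg i R (max n R)" "mdvd (act_mon \<pi> u) v"
    using R unfolding stable_def by (meson max.cobounded2)
  have \<pi>: "\<pi> \<in> Inc i" using u(2) by (rule Inc_seg_Inc)
  \<comment> \<open>For l \<le> i the map fixes l, and for l > i already \<open>l + k\<close>
    exceeds \<open>i + k\<close>. This makes \<open>\<sigma>\<close> increasing where its two rules
    meet.\<close>
  have le: "\<pi> l \<le> l + k" if "\<pi> l \<le> i + k" for l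
    using that Inc_fix[OF \<pi>, of l] by (cases "l \<le> i") auto
  define \<sigma> where "\<sigma> l = (if \<pi> l \<le> i + k then \<pi> l else l + k)" for l
  have "strict_mono \<sigma>"
  proof (rule strict_monoI)
    fix a b :: nat assume "a < b"
    then show "\<sigma> a < \<sigma> b" using Inc_less[OF \<pi>, of a b] le[of a] by (auto simp: \<sigma>_def)
  qed
  moreover have "\<sigma> l = l" if "l \<le> i" for l using Inc_fix[OF \<pi> that] that by (simp add: \<sigma>_def)
  ultimately have \<sigma>: "\<sigma> \<in> Inc i" by (simp add: Inc_def)
  have "\<sigma> R \<le> R + k" using le[of R] by (simp add: \<sigma>_def)
  then have seg: "\<sigma> \<in> Inc_seg i R (R + k)" using \<sigma> by (simp add: Inc_seg_def)
  have dvd: "mdvd (act_mon \<pi> u) W" using mdvd_trans[OF u(3) v(2)] .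
  have "act_mon \<sigma> u = act_mon \<pi> u"
  proof (rule act_mon_cong[OF Inc_inj[OF \<sigma>] Inc_inj[OF \<pi>]])
    fix k' l assume "(k', l) \<in> keys u"
    then have "(k', \<pi> l) \<in> keys (act_mon \<pi> u)" by (force simp: keys_act_mon[OF Inc_inj[OF \<pi>]])
    then have "\<pi> l \<le> i + k" using mdvd_keys[OF dvd] W by auto
    then show "\<sigma> l = \<pi> l" by (simp add: \<sigma>_def)
  qed
  then show ?thesis using mchain_act[OF L R1 seg u(1)] dvd by auto
qed


section \<open>Linear and algebraic dependence by counting\<close>

text \<open>Gaussian elimination: one equation is solved for an unknown z with nonzero coefficient,
  and the result is substituted into the others.\<close>

lemma underdetermined_system:
  fixes a :: "'b \<Rightarrow> 'y \<Rightarrow> 'k::field"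
  assumes "finite B" "finite Y" "card B < card Y"
  shows "\<exists>x. (\<exists>y\<in>Y. x y \<noteq> 0) \<and> (\<forall>b\<in>B. (\<Sum>y\<in>Y. a b y * x y) = 0)"
  using assms
proof (induction B arbitrary: Y a)
  case empty
  then obtain y where "y \<in> Y" by fastforce
  then show ?case by (intro exI[of _ "\<lambda>_. 1"]) auto
next
  case (insert b B)
  show ?case
  proof (cases "\<forall>y\<in>Y. a b y = 0")
    case True
    obtain x where "\<exists>y\<in>Y. x y \<noteq> 0" "\<forall>b\<in>B. (\<Sum>y\<in>Y. a b y * x y) = 0"
      using insert.IH[of Y a] insert.prems insert.hyps by auto
    then show ?thesis using True by (intro exI[of _ x]) auto
  next
    case False
    then obtain z where z: "z \<in> Y" "a b z \<noteq> 0" by blast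
    let ?Y = "Y - {z}"
    define a' where "a' b' y = a b' y - a b' z * a b y / a b z" for b' y
    have "card B < card ?Y" using insert.prems insert.hyps z(1) by simp
    then obtain x where x: "\<exists>y\<in>?Y. x y \<noteq> 0" "\<forall>b\<in>B. (\<Sum>y\<in>?Y. a' b y * x y) = 0"
      using insert.IH[of ?Y a'] insert.prems by auto
    define s where "s = - (\<Sum>y\<in>?Y. a b y * x y) / a b z"
    define x' where "x' = x(z := s)"
    have split: "(\<Sum>y\<in>Y. a b' y * x' y) = a b' z * s + (\<Sum>y\<in>?Y. a b' y * x y)" for b'
    proof -
      have "(\<Sum>y\<in>Y. a b' y * x' y) = a b' z * x' z + (\<Sum>y\<in>?Y. a b' y * x' y)"
        using insert.prems z(1) by (simp add: sum.remove)
      also have "(\<Sum>y\<in>?Y. a b' y * x' y) = (\<Sum>y\<in>?Y. a b' y * x y)"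
        by (rule sum.cong) (auto simp: x'_def)
      finally show ?thesis by (simp add: x'_def)
    qed
    have "(\<Sum>y\<in>Y. a b' y * x' y) = 0" if "b' \<in> insert b B" for b'
    proof (cases "b' = b")
      case True
      then show ?thesis using z(2) split[of b] by (simp add: s_def)
    next
      case False
      then have "0 = (\<Sum>y\<in>?Y. a' b' y * x y)" using x(2) that by auto
      also have "\<dots> = (\<Sum>y\<in>?Y. a b' y * x y) - (\<Sum>y\<in>?Y. a b' z / a b z * (a b y * x y))"
        by (simp add: a'_def left_diff_distrib sum_subtractf mult.assoc)
      also have "(\<Sum>y\<in>?Y. a b' z / a b z * (a b y * x y)) = - a b' z * s"
        by (simp add: s_def sum_distrib_left sum_divide_distrib sum_negf)
      finally show ?thesis using split[of b'] by (simp add: add.commute)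
    qed
    moreover have "\<exists>y\<in>Y. x' y \<noteq> 0" using x(1) by (auto simp: x'_def)
    ultimately show ?thesis by blast
  qed
qed

section \<open>Power products and algebraic dependence\<close>

lemma card_mons_box:
  assumes "finite U"
  shows "finite {u \<in> mons_in U. \<forall>x\<in>U. lookup u x \<le> b x}" (is "finite ?B")
    and "card {u \<in> mons_in U. \<forall>x\<in>U. lookup u x \<le> b x} = (\<Prod>x\<in>U. Suc (b x))"
proof -
  let ?P = "PiE U (\<lambda>x. {..b x})"
  have "bij_betw (\<lambda>u. restrict (lookup u) U) ?B ?P"
  proof (rule bij_betwI')
    fix u v assume "u \<in> ?B" "v \<in> ?B"
    show "restrict (lookup u) U = restrict (lookup v) U \<longleftrightarrow> u = v"
    proof
      assume eq: "restrict (lookup u) U = restrict (lookup v) U"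
      show "u = v"
      proof (rule poly_mapping_eqI)
        fix x show "lookup u x = lookup v x"
        proof (cases "x \<in> U")
          case True
          then show ?thesis using fun_cong[OF eq, of x] by simp
        next
          case False
          then have "x \<notin> keys u" "x \<notin> keys v"
            using \<open>u \<in> ?B\<close> \<open>v \<in> ?B\<close> by (auto simp: mons_in_def)
          then show ?thesis by (simp add: in_keys_iff)
        qed
      qed
    qed simp
  next
    fix u assume "u \<in> ?B" then show "restrict (lookup u) U \<in> ?P" by auto
  next
    fix f assume f: "f \<in> ?P"
    define u where "u = (\<Sum>x\<in>U. single x (f x))"
    have lu: "lookup u x = (if x \<in> U then f x else 0)" for x
      using assms by (simp add: u_def lookup_sum lookup_single when_def)
    have "f = restrict (lookup u) U" using f by (auto simp: lu PiE_def extensional_def)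
    moreover have "u \<in> ?B"
      using f by (auto simp: lu mons_in_def in_keys_iff PiE_iff split: if_splits)
    ultimately show "\<exists>u\<in>?B. f = restrict (lookup u) U" by blast
  qed
  moreover have "finite ?P" by (rule finite_PiE) (use assms in auto)
  moreover have "card ?P = (\<Prod>x\<in>U. Suc (b x))" by (simp add: card_PiE assms)
  ultimately show "finite ?B" "card ?B = (\<Prod>x\<in>U. Suc (b x))"
    by (auto simp: bij_betw_finite bij_betw_same_card)
qed

fun power_prod :: "'a::comm_monoid_mult list \<Rightarrow> nat list \<Rightarrow> 'a" where
  "power_prod [] \<alpha> = 1"
| "power_prod (g # gs) \<alpha> = g ^ hd \<alpha> * power_prod gs (tl \<alpha>)"

lemma lookup_keys_times_le:
  fixes f g :: "'k::field mpoly"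
  assumes "\<And>u. u \<in> keys f \<Longrightarrow> lookup u x \<le> a" "\<And>u. u \<in> keys g \<Longrightarrow> lookup u x \<le> b" "u \<in> keys (f * g)"
  shows "lookup u x \<le> a + b"
proof -
  obtain v w where "u = v + w" "v \<in> keys f" "w \<in> keys g" using keys_mult[of f g] assms(3) by blast
  then show ?thesis using assms(1)[of v] assms(2)[of w] by (simp add: lookup_add add_mono)
qed

lemma lookup_keys_power_le:
  fixes f :: "'k::field mpoly"
  assumes "\<And>u. u \<in> keys f \<Longrightarrow> lookup u x \<le> a" "u \<in> keys (f ^ n)"
  shows "lookup u x \<le> n * a"
  using assms(2)
proof (induction n arbitrary: u)
  case (Suc n)
  have "u \<in> keys (f * f ^ n)" using Suc.prems by simp
  from lookup_keys_times_le[OF assms(1) Suc.IH this] show ?case by simp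
qed simp

lemma power_prod_bound:
  fixes fs :: "'k::field mpoly list"
  assumes "\<And>f u. f \<in> set fs \<Longrightarrow> u \<in> keys f \<Longrightarrow> lookup u x \<le> a"
    "length \<alpha> = length fs" "set \<alpha> \<subseteq> {..<m}" "u \<in> keys (power_prod fs \<alpha>)"
  shows "lookup u x \<le> length fs * (m * a)"
  using assms
proof (induction fs arbitrary: \<alpha> u)
  case (Cons f fs)
  obtain b \<beta> where \<alpha>: "\<alpha> = b # \<beta>" using Cons.prems(2) by (cases \<alpha>) auto
  have IH: "lookup u x \<le> length fs * (m * a)" if "u \<in> keys (power_prod fs \<beta>)" for u
    by (rule Cons.IH[of \<beta>]) (use Cons.prems \<alpha> that in auto)
  have pow: "lookup u x \<le> m * a" if "u \<in> keys (f ^ b)" for u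
  proof -
    have "lookup u x \<le> b * a"
      by (rule lookup_keys_power_le[OF _ that]) (use Cons.prems(1) in auto)
    also have "\<dots> \<le> m * a" using Cons.prems(3) \<alpha> by simp
    finally show ?thesis .
  qed
  have "u \<in> keys (f ^ b * power_prod fs \<beta>)" using Cons.prems(4) \<alpha> by simp
  from lookup_keys_times_le[OF pow IH this] show ?case by simp
qed simp

lemma keys_power_prod:
  fixes fs :: "'k::field mpoly list"
  assumes "\<And>f. f \<in> set fs \<Longrightarrow> keys f \<subseteq> mons_in U"
  shows "keys (power_prod fs \<alpha>) \<subseteq> mons_in U"
  using assms
proof (induction fs arbitrary: \<alpha>)
  case (Cons f fs)
  have "keys (f ^ n) \<subseteq> mons_in U" for n
  proof (induction n)
    case (Suc n)
    then show ?case using poly_ring_times_closed[of f U "f ^ n"] Cons.prems by simp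
  qed simp
  then show ?case using Cons by (simp add: poly_ring_times_closed)
qed simp

text \<open>The power products with exponents below m number \<open>m ^ length fs\<close>, while all
  their monomials lie in a box whose size grows only like \<open>m ^ card U\<close>. For large m
  there is a linear relation, and the terms with coefficient 0 are dropped from it.\<close>

lemma algebraic_dependence:
  fixes fs :: "'k::field mpoly list"
  assumes U: "finite U" "card U < length fs" and fs: "\<And>f. f \<in> set fs \<Longrightarrow> keys f \<subseteq> mons_in U"
  shows "\<exists>X a. finite X \<and> X \<noteq> {} \<and> (\<forall>\<alpha>\<in>X. length \<alpha> = length fs \<and> a \<alpha> \<noteq> 0) \<and>
    (\<Sum>\<alpha>\<in>X. single 0 (a \<alpha>) * power_prod fs \<alpha>) = 0"
proof -
  let ?s = "length fs" and ?d = "card U"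
  obtain D where D: "\<And>f u x. f \<in> set fs \<Longrightarrow> u \<in> keys f \<Longrightarrow> lookup u x \<le> D"
  proof -
    let ?S = "\<Union>f\<in>set fs. \<Union>u\<in>keys f. lookup u ` U"
    have fin: "finite ?S" using U(1) by simp
    have "lookup u x \<le> Max (insert 0 ?S)" if "f \<in> set fs" "u \<in> keys f" for f u x
    proof (cases "x \<in> U")
      case True
      then have "lookup u x \<in> insert 0 ?S" using that by blast
      then show ?thesis using fin by (intro Max_ge) simp_all
    next
      case False
      then have "x \<notin> keys u" using fs that by (auto simp: mons_in_def)
      then show ?thesis by (simp add: in_keys_iff)
    qed
    then show thesis using that by blast
  qed
  \<comment> \<open>All exponents are at most \<open>E = s m D\<close>, and
    \<open>(E + 1) ^ d\<close> is at most \<open>m ^ d * (s D + 1) ^ d\<close>; as m exceeds the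
    second factor, this is below \<open>m ^ (d + 1)\<close>, hence below
    \<open>m ^ s\<close>.\<close>
  define m where "m = Suc ((?s * D + 1) ^ ?d)"
  define E where "E = ?s * (m * D)"
  let ?B = "{u \<in> mons_in U. \<forall>x\<in>U. lookup u x \<le> E}"
  let ?Y = "{\<alpha>. set \<alpha> \<subseteq> {..<m} \<and> length \<alpha> = ?s}"
  have finB: "finite ?B" by (rule card_mons_box(1)[OF U(1)])
  have cardY: "card ?Y = m ^ ?s" by (simp add: card_lists_length_eq)
  have "card ?B = (E + 1) ^ ?d" using card_mons_box(2)[OF U(1), of "\<lambda>_. E"] by simp
  also have "\<dots> \<le> (m * (?s * D + 1)) ^ ?d"
    by (rule power_mono) (simp_all add: E_def m_def algebra_simps)
  also have "\<dots> = m ^ ?d * (?s * D + 1) ^ ?d" by (rule power_mult_distrib)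
  also have "\<dots> < m ^ ?d * m" by (rule mult_strict_left_mono) (simp_all add: m_def)
  also have "\<dots> = m ^ Suc ?d" by simp
  also have "\<dots> \<le> m ^ ?s" using U(2) by (intro power_increasing) (simp_all add: m_def)
  finally have lt: "card ?B < card ?Y" by (simp add: cardY)
  have finY: "finite ?Y" using finite_lists_length_eq[of "{..<m}" ?s] by simp
  obtain a where a: "\<exists>\<alpha>\<in>?Y. a \<alpha> \<noteq> 0"
    "\<forall>u\<in>?B. (\<Sum>\<alpha>\<in>?Y. lookup (power_prod fs \<alpha>) u * a \<alpha>) = 0"
    using underdetermined_system[OF finB finY lt, of "\<lambda>u \<alpha>. lookup (power_prod fs \<alpha>) u"] by blast
  let ?X = "{\<alpha> \<in> ?Y. a \<alpha> \<noteq> 0}"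
  have "(\<Sum>\<alpha>\<in>?X. single 0 (a \<alpha>) * power_prod fs \<alpha>) = (\<Sum>\<alpha>\<in>?Y. single 0 (a \<alpha>) * power_prod fs \<alpha>)"
    by (rule sum.mono_neutral_left[OF finY]) auto
  also have "\<dots> = 0"
  proof (rule poly_mapping_eqI)
    fix u
    have "lookup (\<Sum>\<alpha>\<in>?Y. single 0 (a \<alpha>) * power_prod fs \<alpha>) u
        = (\<Sum>\<alpha>\<in>?Y. lookup (power_prod fs \<alpha>) u * a \<alpha>)"
      unfolding lookup_sum using lookup_single_times_add[of 0 _ _ u]
      by (intro sum.cong) (simp_all add: mult.commute)
    also have "\<dots> = 0"
    proof (cases "u \<in> ?B")
      case True
      then show ?thesis using a(2) by blast
    next
      case False
      have "lookup (power_prod fs \<alpha>) u = 0" if "\<alpha> \<in> ?Y" for \<alpha>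
      proof (rule ccontr)
        assume "lookup (power_prod fs \<alpha>) u \<noteq> 0"
        then have k: "u \<in> keys (power_prod fs \<alpha>)" by (simp add: in_keys_iff)
        have "lookup u x \<le> E" for x
          unfolding E_def by (rule power_prod_bound[OF D _ _ k]) (use that in auto)
        moreover have "u \<in> mons_in U" using keys_power_prod[OF fs] k by blast
        ultimately show False using False by blast
      qed
      then show ?thesis by simp
    qed
    finally show "lookup (\<Sum>\<alpha>\<in>?Y. single 0 (a \<alpha>) * power_prod fs \<alpha>) u = lookup 0 u" by simp
  qed
  finally have "(\<Sum>\<alpha>\<in>?X. single 0 (a \<alpha>) * power_prod fs \<alpha>) = 0" .
  moreover have "finite ?X" by (rule finite_subset[OF _ finY]) auto
  moreover have "?X \<noteq> {}" using a(1) by auto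
  ultimately show ?thesis by (intro exI[of _ ?X] exI[of _ a]) auto
qed


section \<open>Regular sequences\<close>

text \<open>Ideals of a type-class ring. Regular sequences are treated in the full type of
  polynomials, and the results are carried to the quotient ring along the surjection of
  \<open>ring_quotient\<close>.\<close>

definition idl :: "'a::comm_ring_1 set \<Rightarrow> bool" where
  "idl J \<longleftrightarrow> 0 \<in> J \<and> (\<forall>x\<in>J. \<forall>y\<in>J. x + y \<in> J) \<and> (\<forall>x\<in>J. \<forall>r. r * x \<in> J)"

lemma idl_0: "idl J \<Longrightarrow> 0 \<in> J"
  and idl_add: "idl J \<Longrightarrow> x \<in> J \<Longrightarrow> y \<in> J \<Longrightarrow> x + y \<in> J"
  and idl_mult: "idl J \<Longrightarrow> x \<in> J \<Longrightarrow> r * x \<in> J"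
  by (auto simp: idl_def)

lemma idl_uminus: "idl J \<Longrightarrow> x \<in> J \<Longrightarrow> - x \<in> J"
  using idl_mult[of J x "- 1"] by simp

lemma idl_diff: "idl J \<Longrightarrow> x \<in> J \<Longrightarrow> y \<in> J \<Longrightarrow> x - y \<in> J"
  using idl_add[of J x "- y"] idl_uminus[of J y] by simp

definition adj :: "'a::comm_ring_1 set \<Rightarrow> 'a \<Rightarrow> 'a set" where
  "adj Q g = {q + g * b | q b. q \<in> Q}"

lemma idl_adj: assumes "idl Q" shows "idl (adj Q g)"
  unfolding idl_def
proof (intro conjI ballI allI)
  show "0 \<in> adj Q g" unfolding adj_def using idl_0[OF assms] by (auto intro!: exI[of _ 0])
  fix x y r assume "x \<in> adj Q g"
  then obtain q b where x: "x = q + g * b" "q \<in> Q" by (auto simp: adj_def)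
  have "r * x = r * q + g * (r * b)" using x by (simp add: algebra_simps)
  then show "r * x \<in> adj Q g" unfolding adj_def using idl_mult[OF assms x(2)] by blast
  assume "y \<in> adj Q g"
  then obtain q' b' where y: "y = q' + g * b'" "q' \<in> Q" by (auto simp: adj_def)
  have "x + y = (q + q') + g * (b + b')" using x y by (simp add: algebra_simps)
  then show "x + y \<in> adj Q g" unfolding adj_def using idl_add[OF assms x(2) y(2)] by blast
qed

lemma adj_superset: "Q \<subseteq> adj Q g"
proof
  fix x assume "x \<in> Q"
  moreover have "x = x + g * 0" by simp
  ultimately show "x \<in> adj Q g" unfolding adj_def by blast
qed

lemma adj_self: assumes "idl Q" shows "g * b \<in> adj Q g"
proof -
  have "g * b = 0 + g * b" by simp
  then show ?thesis unfolding adj_def using idl_0[OF assms] by blast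
qed

fun regular :: "'a::comm_ring_1 set \<Rightarrow> 'a list \<Rightarrow> bool" where
  "regular Q [] \<longleftrightarrow> True"
| "regular Q (g # gs) \<longleftrightarrow> (\<forall>a. g * a \<in> Q \<longrightarrow> a \<in> Q) \<and> regular (adj Q g) gs"

text \<open>The type of polynomials has infinitely many variables and is not Noetherian. The maximal
  condition is therefore demanded of the ideals containing \<open>J0\<close>, which will be the
  kernel of the map onto the Noetherian quotient.\<close>

locale noetherian_at_prime =
  fixes M J0 :: "'a::comm_ring_1 set"
  assumes M: "idl M" and one: "1 \<notin> M" and prime: "\<And>x y. x * y \<in> M \<Longrightarrow> x \<in> M \<or> y \<in> M"
    and maximal: "\<And>F. F \<noteq> {} \<Longrightarrow> (\<And>I. I \<in> F \<Longrightarrow> idl I \<and> J0 \<subseteq> I) \<Longrightarrow>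
      \<exists>I\<in>F. \<forall>I'\<in>F. I \<subseteq> I' \<longrightarrow> I' = I"
begin

text \<open>The contraction of the localization of \<open>Q\<close> at \<open>M\<close>.\<close>

definition sat :: "'a set \<Rightarrow> 'a set" where
  "sat Q = {a. \<exists>u. u \<notin> M \<and> u * a \<in> Q}"

lemma satI: "u \<notin> M \<Longrightarrow> u * a \<in> Q \<Longrightarrow> a \<in> sat Q"
  by (auto simp: sat_def)

lemma sat_superset: "Q \<subseteq> sat Q"
  using satI[of 1] one by auto

lemma not_M_mult: "u \<notin> M \<Longrightarrow> v \<notin> M \<Longrightarrow> u * v \<notin> M"
  using prime by blast

lemma idl_sat: assumes "idl Q" shows "idl (sat Q)"
  unfolding idl_def
proof (intro conjI ballI allI)
  show "0 \<in> sat Q" using sat_superset idl_0[OF assms] by blast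
  fix x y r assume "x \<in> sat Q"
  then obtain u where u: "u \<notin> M" "u * x \<in> Q" by (auto simp: sat_def)
  have "u * (r * x) = r * (u * x)" by (simp add: algebra_simps)
  then show "r * x \<in> sat Q" using satI[OF u(1)] idl_mult[OF assms u(2)] by metis
  assume "y \<in> sat Q"
  then obtain v where v: "v \<notin> M" "v * y \<in> Q" by (auto simp: sat_def)
  have "u * v * (x + y) = v * (u * x) + u * (v * y)" by (simp add: algebra_simps)
  also have "\<dots> \<in> Q"
    by (rule idl_add[OF assms idl_mult[OF assms u(2)] idl_mult[OF assms v(2)]])
  finally show "x + y \<in> sat Q" by (rule satI[OF not_M_mult[OF u(1) v(1)]])
qed

text \<open>Krull's intersection theorem for the powers of \<open>g\<close>: if \<open>w = g w\<^sub>1 = g\<^sup>2 w\<^sub>2 = \<dots>\<close>, then the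
  ideals generated by the \<open>w\<^sub>t\<close> become stationary in the localization, where \<open>1 - g b\<close> is a unit.\<close>

lemma krull_intersection:
  assumes Q: "idl Q" "J0 \<subseteq> Q" and g: "g \<in> M" and w: "w \<notin> sat Q"
  shows "\<exists>u t w'. u \<notin> M \<and> u * w - g ^ t * w' \<in> Q \<and> w' \<notin> sat (adj Q g)"
proof (rule ccontr)
  assume "\<not> ?thesis"
  then have neg: "w' \<in> sat (adj Q g)" if "u \<notin> M" "u * w - g ^ t * w' \<in> Q" for u t w'
    using that by blast
  \<comment> \<open>The w' are the quotients of w by powers of g, up to factors outside
    \<open>M\<close>. By the assumption to be refuted each of them is again divisible by g.\<close>
  define F where "F = {sat (adj Q w') | w'. \<exists>u t. u \<notin> M \<and> u * w - g ^ t * w' \<in> Q}"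
  have "1 * w - g ^ 0 * w \<in> Q" using idl_0[OF Q(1)] by simp
  then have "sat (adj Q w) \<in> F" unfolding F_def using one by blast
  then have "F \<noteq> {}" by blast
  moreover have "idl I \<and> J0 \<subseteq> I" if "I \<in> F" for I
  proof -
    obtain w' where "I = sat (adj Q w')" using \<open>I \<in> F\<close> by (auto simp: F_def)
    then show ?thesis
      using idl_sat[OF idl_adj[OF Q(1)]] Q(2) adj_superset[of Q w'] sat_superset[of "adj Q w'"] by auto
  qed
  ultimately obtain I where I: "I \<in> F" "\<And>I'. I' \<in> F \<Longrightarrow> I \<subseteq> I' \<Longrightarrow> I' = I"
    using maximal[of F] by blast
  then obtain w' u t where w': "I = sat (adj Q w')" "u \<notin> M" "u * w - g ^ t * w' \<in> Q"
    by (auto simp: F_def)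
  obtain v q b where v: "v \<notin> M" "v * w' = q + g * b" "q \<in> Q"
    using neg[OF w'(2,3)] by (auto simp: sat_def adj_def)
  have vu: "v * u \<notin> M" using v(1) w'(2) by (rule not_M_mult)
  have "v * u * w - g ^ Suc t * b = v * (u * w - g ^ t * w') + g ^ t * (v * w' - g * b)"
    by (simp add: algebra_simps)
  also have "\<dots> = v * (u * w - g ^ t * w') + g ^ t * q" using v(2) by simp
  also have "\<dots> \<in> Q"
    by (rule idl_add[OF Q(1) idl_mult[OF Q(1) w'(3)] idl_mult[OF Q(1) v(3)]])
  finally have b: "v * u * w - g ^ Suc t * b \<in> Q" .
  then have "sat (adj Q b) \<in> F" using vu unfolding F_def by blast
  moreover have "I \<subseteq> sat (adj Q b)"
  proof
    fix a assume "a \<in> I"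
    then obtain x q' y where x: "x \<notin> M" "x * a = q' + w' * y" "q' \<in> Q"
      by (auto simp: w'(1) sat_def adj_def)
    have "v * x * a = v * (q' + w' * y)" using x(2) by (simp add: mult.assoc)
    also have "\<dots> = v * q' + (v * w') * y" by (simp add: algebra_simps)
    also have "\<dots> = (v * q' + y * q) + b * (g * y)" unfolding v(2) by (simp add: algebra_simps)
    also have "\<dots> \<in> adj Q b"
      unfolding adj_def using idl_add[OF Q(1) idl_mult[OF Q(1) x(3)] idl_mult[OF Q(1) v(3)]] by blast
    finally show "a \<in> sat (adj Q b)" by (rule satI[OF not_M_mult[OF v(1) x(1)]])
  qed
  \<comment> \<open>By maximality b is, up to factors outside \<open>M\<close>, a multiple of w',
    which is itself g times b. So \<open>v * z - g * y\<close> kills b modulo \<open>Q\<close>, and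
    this factor lies outside \<open>M\<close> because g is in \<open>M\<close>.\<close>
  ultimately have "sat (adj Q b) = I" using I(2) by blast
  moreover have "b \<in> sat (adj Q b)" using sat_superset adj_self[OF Q(1), of b 1] by auto
  ultimately obtain z q' y where z: "z \<notin> M" "z * b = q' + w' * y" "q' \<in> Q"
    by (auto simp: w'(1) sat_def adj_def)
  have "(v * z - g * y) * b = v * (z * b) - g * y * b" by (simp add: algebra_simps)
  also have "\<dots> = v * q' + (v * w') * y - g * y * b" unfolding z(2) by (simp add: algebra_simps)
  also have "\<dots> = v * q' + y * q" unfolding v(2) by (simp add: algebra_simps)
  also have "\<dots> \<in> Q"
    by (rule idl_add[OF Q(1) idl_mult[OF Q(1) z(3)] idl_mult[OF Q(1) v(3)]])
  finally have bQ: "(v * z - g * y) * b \<in> Q" .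
  have nM: "v * z - g * y \<notin> M"
  proof
    assume "v * z - g * y \<in> M"
    moreover have "g * y \<in> M" using idl_mult[OF M g, of y] by (simp add: mult.commute)
    ultimately have "v * z - g * y + g * y \<in> M" by (rule idl_add[OF M])
    then show False using not_M_mult[OF v(1) z(1)] by simp
  qed
  let ?z = "v * z - g * y"
  have "?z * (v * u) * w = ?z * (v * u * w - g ^ Suc t * b) + g ^ Suc t * (?z * b)"
    by (simp add: algebra_simps)
  also have "\<dots> \<in> Q"
    by (rule idl_add[OF Q(1) idl_mult[OF Q(1) b] idl_mult[OF Q(1) bQ]])
  finally have "w \<in> sat Q" by (rule satI[OF not_M_mult[OF nM vu]])
  then show False using w by blast
qed

text \<open>The lowest power of the first element and the corresponding coefficient of \<open>w\<close> are split off;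
  the remaining factor is not divisible by the first element, so one may pass to the quotient.\<close>

lemma regular_independent:
  assumes "idl Q" "J0 \<subseteq> Q" "regular Q gs" "set gs \<subseteq> M" "w \<notin> sat Q"
    "finite X" "X \<noteq> {}" "\<And>\<alpha>. \<alpha> \<in> X \<Longrightarrow> length \<alpha> = length gs \<and> a \<alpha> \<notin> M"
  shows "(\<Sum>\<alpha>\<in>X. a \<alpha> * power_prod gs \<alpha>) * w \<notin> sat Q"
  using assms
proof (induction gs arbitrary: Q w X a)
  case Nil
  then have X: "X = {[]}" by auto
  show ?case
  proof
    assume "(\<Sum>\<alpha>\<in>X. a \<alpha> * power_prod [] \<alpha>) * w \<in> sat Q"
    then obtain u where "u \<notin> M" "u * (a [] * w) \<in> Q" by (auto simp: X sat_def)
    then have "w \<in> sat Q" using satI[OF not_M_mult, of u "a []" w Q] Nil.prems(8) X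
      by (simp add: mult.assoc)
    then show False using Nil.prems by blast
  qed
next
  case (Cons g gs)
  note Q = Cons.prems(1,2) and finX = Cons.prems(6)
  have g: "g \<in> M" and reg: "\<And>a. g * a \<in> Q \<Longrightarrow> a \<in> Q" "regular (adj Q g) gs"
    using Cons.prems by auto
  have regpow: "a \<in> Q" if "g ^ n * a \<in> Q" for n a
    using that by (induction n) (auto simp: mult.assoc intro: reg(1))
  obtain u t w' where u: "u \<notin> M" "u * w - g ^ t * w' \<in> Q" "w' \<notin> sat (adj Q g)"
    using krull_intersection[OF Q g Cons.prems(5)] by blast
  \<comment> \<open>The lowest exponent of g in the sum, which becomes \<open>g ^ t0 * S\<close>
    with \<open>S = S0 + g * S1\<close>; the terms whose exponent is exactly t0 make up
    \<open>S0\<close>.\<close>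
  define t0 where "t0 = Min (hd ` X)"
  have le: "t0 \<le> hd \<alpha>" if "\<alpha> \<in> X" for \<alpha>
    unfolding t0_def using that finX by simp
  define X0 where "X0 = {\<alpha> \<in> X. hd \<alpha> = t0}"
  have "t0 \<in> hd ` X" unfolding t0_def using finX Cons.prems(7) by (intro Min_in) auto
  then have X0: "X0 \<noteq> {}" "finite X0" "X0 \<subseteq> X" using finX by (auto simp: X0_def)
  have consX0: "\<alpha> = t0 # tl \<alpha>" if "\<alpha> \<in> X0" for \<alpha>
    using that Cons.prems(8)[of \<alpha>] by (cases \<alpha>) (auto simp: X0_def)
  define S where "S = (\<Sum>\<alpha>\<in>X. a \<alpha> * (g ^ (hd \<alpha> - t0) * power_prod gs (tl \<alpha>)))"
  define S1 where "S1 = (\<Sum>\<alpha>\<in>X - X0. a \<alpha> * (g ^ (hd \<alpha> - t0 - 1) * power_prod gs (tl \<alpha>)))"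
  let ?a = "\<lambda>\<beta>. a (t0 # \<beta>)"
  define S0 where "S0 = (\<Sum>\<beta>\<in>tl ` X0. ?a \<beta> * power_prod gs \<beta>)"
  have "inj_on tl X0" using consX0 by (metis inj_onI)
  then have S0: "S0 = (\<Sum>\<alpha>\<in>X0. a \<alpha> * power_prod gs (tl \<alpha>))"
    unfolding S0_def by (subst sum.reindex) (use consX0 in \<open>auto intro!: sum.cong\<close>)
  have s: "(\<Sum>\<alpha>\<in>X. a \<alpha> * power_prod (g # gs) \<alpha>) = g ^ t0 * S"
    unfolding S_def sum_distrib_left
  proof (rule sum.cong)
    fix \<alpha> assume "\<alpha> \<in> X"
    then have "g ^ hd \<alpha> = g ^ t0 * g ^ (hd \<alpha> - t0)" using le by (simp flip: power_add)
    then show "a \<alpha> * power_prod (g # gs) \<alpha> = g ^ t0 * (a \<alpha> * (g ^ (hd \<alpha> - t0) * power_prod gs (tl \<alpha>)))"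
      by (simp add: mult_ac)
  qed simp
  have "S = (\<Sum>\<alpha>\<in>X0. a \<alpha> * (g ^ (hd \<alpha> - t0) * power_prod gs (tl \<alpha>)))
      + (\<Sum>\<alpha>\<in>X - X0. a \<alpha> * (g ^ (hd \<alpha> - t0) * power_prod gs (tl \<alpha>)))"
    unfolding S_def by (simp add: sum.subset_diff[OF X0(3) finX] add.commute)
  also have "(\<Sum>\<alpha>\<in>X0. a \<alpha> * (g ^ (hd \<alpha> - t0) * power_prod gs (tl \<alpha>))) = S0"
    unfolding S0 by (rule sum.cong) (auto simp: X0_def)
  also have "(\<Sum>\<alpha>\<in>X - X0. a \<alpha> * (g ^ (hd \<alpha> - t0) * power_prod gs (tl \<alpha>))) = g * S1"
    unfolding S1_def sum_distrib_left
  proof (rule sum.cong)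
    fix \<alpha> assume "\<alpha> \<in> X - X0"
    then have "hd \<alpha> - t0 = Suc (hd \<alpha> - t0 - 1)" using le[of \<alpha>] by (auto simp: X0_def)
    then have "g ^ (hd \<alpha> - t0) = g * g ^ (hd \<alpha> - t0 - 1)" by (metis power_Suc)
    then show "a \<alpha> * (g ^ (hd \<alpha> - t0) * power_prod gs (tl \<alpha>))
        = g * (a \<alpha> * (g ^ (hd \<alpha> - t0 - 1) * power_prod gs (tl \<alpha>)))"
      by (simp add: mult_ac)
  qed simp
  finally have S: "S = S0 + g * S1" .
  have "S0 * w' \<notin> sat (adj Q g)"
    unfolding S0_def
  proof (rule Cons.IH[OF idl_adj[OF Q(1)] _ reg(2) _ u(3)])
    show "J0 \<subseteq> adj Q g" using Q(2) adj_superset by blast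
    show "set gs \<subseteq> M" using Cons.prems(4) by simp
    show "finite (tl ` X0)" "tl ` X0 \<noteq> {}" using X0 by auto
    fix \<beta> assume "\<beta> \<in> tl ` X0"
    then have "t0 # \<beta> \<in> X" using consX0 X0(3) by force
    from Cons.prems(8)[OF this] show "length \<beta> = length gs \<and> a (t0 # \<beta>) \<notin> M" by simp
  qed
  moreover have "S0 * w' \<in> sat (adj Q g)" if mem: "(\<Sum>\<alpha>\<in>X. a \<alpha> * power_prod (g # gs) \<alpha>) * w \<in> sat Q"
  proof -
    obtain v where v: "v \<notin> M" "v * (g ^ t0 * S * w) \<in> Q" using mem unfolding s sat_def by blast
    \<comment> \<open>Modulo \<open>Q\<close>, \<open>u * w\<close> is replaced by
      \<open>g ^ t * w'\<close>; all powers of g can then be cancelled by regularity.\<close>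
    have "g ^ (t + t0) * (v * S * w') = u * (v * (g ^ t0 * S * w)) - v * g ^ t0 * S * (u * w - g ^ t * w')"
      by (simp add: algebra_simps power_add)
    also have "\<dots> \<in> Q"
      by (rule idl_diff[OF Q(1) idl_mult[OF Q(1) v(2)] idl_mult[OF Q(1) u(2)]])
    finally have "v * S * w' \<in> Q" by (rule regpow)
    moreover have "v * (S0 * w') = v * S * w' + g * (- v * S1 * w')"
      unfolding S by (simp add: algebra_simps)
    ultimately have "v * (S0 * w') \<in> adj Q g" unfolding adj_def by blast
    then show ?thesis by (rule satI[OF v(1)])
  qed
  ultimately show ?case by blast
qed

end


section \<open>Depth and codimension at the irrelevant ideal\<close>

locale ring_quotient = cring A for A :: "('b, 'm) ring_scheme" (structure) +
  fixes \<phi> :: "'a::comm_ring_1 \<Rightarrow> 'b"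
  assumes hom_add: "\<phi> (x + y) = \<phi> x \<oplus> \<phi> y"
    and hom_mult: "\<phi> (x * y) = \<phi> x \<otimes> \<phi> y"
    and hom_one: "\<phi> 1 = \<one>"
    and surj: "\<phi> ` UNIV = carrier A"
begin

lemma hom_closed [simp]: "\<phi> x \<in> carrier A"
  using surj by blast

lemma hom_zero: "\<phi> 0 = \<zero>"
  using hom_add[of 0 0] hom_closed[of 0] by (metis add.l_cancel_one add_0)

lemma hom_uminus: "\<phi> (- x) = \<ominus> \<phi> x"
  by (rule minus_equality[symmetric]) (use hom_add[of "- x" x] hom_zero in simp_all)

lemma idl_vimage:
  assumes "ideal K A" shows "idl (\<phi> -` K)"
  unfolding idl_def vimage_def mem_Collect_eq
  using additive_subgroup.zero_closed[OF ideal.axioms(1)[OF assms]]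
    additive_subgroup.a_closed[OF ideal.axioms(1)[OF assms]] ideal.I_l_closed[OF assms]
  by (simp add: hom_zero hom_add hom_mult)

lemma vimage_image:
  assumes "idl P" "\<phi> -` {\<zero>} \<subseteq> P"
  shows "\<phi> -` (\<phi> ` P) = P"
proof
  show "\<phi> -` (\<phi> ` P) \<subseteq> P"
  proof
    fix x assume "x \<in> \<phi> -` (\<phi> ` P)"
    then obtain y where y: "y \<in> P" "\<phi> x = \<phi> y" by auto
    have "\<phi> (x - y) = \<zero>"
      using hom_add[of x "- y"] hom_uminus[of y] y(2) by (simp add: r_neg)
    then have "x - y \<in> P" using assms(2) by blast
    then have "x - y + y \<in> P" using idl_add[OF assms(1)] y(1) by blast
    then show "x \<in> P" by simp
  qed
qed auto

lemma ideal_image: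
  assumes "idl P" shows "ideal (\<phi> ` P) A"
proof (rule idealI)
  show "ring A" by (rule ring_axioms)
  show "subgroup (\<phi> ` P) (add_monoid A)"
  proof (rule add.subgroupI)
    show "\<phi> ` P \<subseteq> carrier A" by auto
    show "\<phi> ` P \<noteq> {}" using idl_0[OF assms] by blast
    fix a assume "a \<in> \<phi> ` P"
    then obtain x where x: "x \<in> P" "a = \<phi> x" by blast
    then show "\<ominus> a \<in> \<phi> ` P" using idl_uminus[OF assms x(1)] hom_uminus[of x] by (metis imageI)
    fix b assume "b \<in> \<phi> ` P"
    then obtain y where y: "y \<in> P" "b = \<phi> y" by blast
    then show "a \<oplus> b \<in> \<phi> ` P" using idl_add[OF assms x(1) y(1)] hom_add[of x y] x(2) by (metis imageI)
  qed
  fix a b assume "a \<in> \<phi> ` P" "b \<in> carrier A"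
  then obtain x y where x: "x \<in> P" "a = \<phi> x" "b = \<phi> y" using surj by blast
  then show "b \<otimes> a \<in> \<phi> ` P" using idl_mult[OF assms x(1), of y] hom_mult[of y x] by (metis imageI)
  then show "a \<otimes> b \<in> \<phi> ` P" using x m_comm[of a b] by simp
qed

lemma vimage_insert:
  assumes "T \<subseteq> carrier A"
  shows "\<phi> -` genideal A (insert (\<phi> g) T) = adj (\<phi> -` genideal A T) g"
proof -
  let ?Q = "\<phi> -` genideal A T"
  have idT: "ideal (genideal A T) A" by (rule genideal_ideal[OF assms])
  have idQ: "idl ?Q" by (rule idl_vimage[OF idT])
  have ins: "insert (\<phi> g) T \<subseteq> carrier A" using assms by simp
  have idI: "ideal (genideal A (insert (\<phi> g) T)) A" by (rule genideal_ideal[OF ins])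
  have ker: "\<phi> -` {\<zero>} \<subseteq> adj ?Q g"
    using adj_superset[of ?Q g] additive_subgroup.zero_closed[OF ideal.axioms(1)[OF idT]] by auto
  show ?thesis
  proof
    have "T \<subseteq> \<phi> ` adj ?Q g"
    proof
      fix t assume "t \<in> T"
      then have "t \<in> genideal A T" using genideal_self[OF assms] by blast
      moreover obtain x where "t = \<phi> x" using \<open>t \<in> T\<close> assms surj by blast
      ultimately have "x \<in> adj ?Q g" using adj_superset[of ?Q g] by auto
      then show "t \<in> \<phi> ` adj ?Q g" using \<open>t = \<phi> x\<close> by blast
    qed
    moreover have "\<phi> g \<in> \<phi> ` adj ?Q g" using adj_self[OF idQ, of g 1] by simp
    ultimately have "genideal A (insert (\<phi> g) T) \<subseteq> \<phi> ` adj ?Q g"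
      by (intro genideal_minimal ideal_image idl_adj idQ) simp
    then have "\<phi> -` genideal A (insert (\<phi> g) T) \<subseteq> \<phi> -` (\<phi> ` adj ?Q g)" by blast
    then show "\<phi> -` genideal A (insert (\<phi> g) T) \<subseteq> adj ?Q g"
      unfolding vimage_image[OF idl_adj[OF idQ] ker] .
  next
    have self: "\<phi> g \<in> genideal A (insert (\<phi> g) T)" "T \<subseteq> genideal A (insert (\<phi> g) T)"
      using genideal_self[OF ins] by auto
    have sub: "genideal A T \<subseteq> genideal A (insert (\<phi> g) T)"
      by (rule genideal_minimal[OF idI self(2)])
    show "adj ?Q g \<subseteq> \<phi> -` genideal A (insert (\<phi> g) T)"
    proof
      fix x assume "x \<in> adj ?Q g"
      then obtain q b where x: "x = q + g * b" "\<phi> q \<in> genideal A T" by (auto simp: adj_def)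
      have "\<phi> g \<otimes> \<phi> b \<in> genideal A (insert (\<phi> g) T)"
        by (rule ideal.I_r_closed[OF idI self(1)]) simp
      moreover have "\<phi> q \<in> genideal A (insert (\<phi> g) T)" using x(2) sub by blast
      ultimately show "x \<in> \<phi> -` genideal A (insert (\<phi> g) T)"
        using additive_subgroup.a_closed[OF ideal.axioms(1)[OF idI]] x(1)
        by (simp add: hom_add hom_mult)
    qed
  qed
qed

text \<open>\<open>T\<close> collects the elements already divided out, so that the induction moves
  the head of the list into \<open>T\<close>.\<close>

lemma regular_lift:
  assumes "T \<subseteq> carrier A"
    and "\<And>l a. l < length fs \<Longrightarrow> a \<in> carrier A \<Longrightarrow>
      \<phi> (fs ! l) \<otimes> a \<in> genideal A (T \<union> set (take l (map \<phi> fs))) \<Longrightarrow>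
      a \<in> genideal A (T \<union> set (take l (map \<phi> fs)))"
  shows "regular (\<phi> -` genideal A T) fs"
  using assms
proof (induction fs arbitrary: T)
  case (Cons g gs)
  have "regular (\<phi> -` genideal A (insert (\<phi> g) T)) gs"
  proof (rule Cons.IH)
    show "insert (\<phi> g) T \<subseteq> carrier A" using Cons.prems(1) by simp
    show "a \<in> genideal A (insert (\<phi> g) T \<union> set (take l (map \<phi> gs)))"
      if "l < length gs" "a \<in> carrier A"
        "\<phi> (gs ! l) \<otimes> a \<in> genideal A (insert (\<phi> g) T \<union> set (take l (map \<phi> gs)))" for l a
      using Cons.prems(2)[of "Suc l" a] that by simp
  qed
  moreover have "a \<in> \<phi> -` genideal A T" if "g * a \<in> \<phi> -` genideal A T" for a
    using Cons.prems(2)[of 0 "\<phi> a"] that by (simp add: hom_mult)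
  ultimately show ?case unfolding vimage_insert[OF Cons.prems(1)] by simp
qed simp

lemma vimage_genideal_empty: "\<phi> -` genideal A {} = \<phi> -` {\<zero>}"
proof -
  have "genideal A {} = {\<zero>}"
    using genideal_minimal[OF zeroideal, of "{}"]
      additive_subgroup.zero_closed[OF ideal.axioms(1)[OF genideal_ideal[of "{}"]]] by auto
  then show ?thesis by simp
qed

lemma noetherian_maximal:
  assumes "noetherian_ring A" "F \<noteq> {}" "\<And>I. I \<in> F \<Longrightarrow> idl I \<and> \<phi> -` {\<zero>} \<subseteq> I"
  shows "\<exists>I\<in>F. \<forall>I'\<in>F. I \<subseteq> I' \<longrightarrow> I' = I"
proof -
  let ?S = "(`) \<phi> ` F"
  have S: "?S \<subseteq> {I. ideal I A}" using assms(3) ideal_image by blast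
  have "\<exists>K\<in>?S. \<forall>X\<in>?S. K \<subseteq> X \<longrightarrow> X = K"
  proof (rule subset_Zorn)
    fix C assume C: "subset.chain ?S C"
    show "\<exists>U\<in>?S. \<forall>X\<in>C. X \<subseteq> U"
    proof (cases "C = {}")
      case True
      then show ?thesis using assms(2) by blast
    next
      case False
      have sub: "C \<subseteq> ?S" and tot: "\<forall>X\<in>C. \<forall>Y\<in>C. X \<subseteq> Y \<or> Y \<subseteq> X"
        using C unfolding subset_chain_def by (rule conjunct1, rule conjunct2)
      have "subset.chain {I. ideal I A} C"
        unfolding subset_chain_def using order_trans[OF sub S] tot by (rule conjI)
      then have "\<Union>C \<in> C" by (rule noetherian_ring.ideal_chain_is_trivial[OF assms(1) False])
      then have "\<Union>C \<in> ?S" using sub by (rule rev_subsetD)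
      then show ?thesis by (rule bexI[rotated]) (simp add: Union_upper)
    qed
  qed
  then have "\<exists>I\<in>F. \<forall>I'\<in>F. \<phi> ` I \<subseteq> \<phi> ` I' \<longrightarrow> \<phi> ` I' = \<phi> ` I"
    by (simp only: bex_simps ball_simps)
  then obtain I where I: "I \<in> F" "\<forall>I'\<in>F. \<phi> ` I \<subseteq> \<phi> ` I' \<longrightarrow> \<phi> ` I' = \<phi> ` I"
    by (rule bexE)
  have "I' = I" if I': "I' \<in> F" "I \<subseteq> I'" for I'
  proof -
    have "\<phi> ` I' = \<phi> ` I" by (rule I(2)[rule_format, OF I'(1) image_mono[OF I'(2)]])
    then show ?thesis
      using vimage_image[of I] vimage_image[of I'] assms(3)[OF I(1)] assms(3)[OF I'(1)] by simp
  qed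
  then show ?thesis using I(1) by blast
qed

lemma primeideal_image:
  assumes P: "idl P" "\<phi> -` {\<zero>} \<subseteq> P" and one: "1 \<notin> P"
    and prime: "\<And>x y. x * y \<in> P \<Longrightarrow> x \<in> P \<or> y \<in> P"
  shows "primeideal (\<phi> ` P) A"
proof (rule primeidealI)
  have mem: "\<phi> x \<in> \<phi> ` P \<longleftrightarrow> x \<in> P" for x
    using vimage_image[OF P] by blast
  show "ideal (\<phi> ` P) A" by (rule ideal_image[OF P(1)])
  show "cring A" by (rule is_cring)
  show "carrier A \<noteq> \<phi> ` P" using mem[of 1] one hom_closed[of 1] by blast
  fix a b assume ab: "a \<in> carrier A" "b \<in> carrier A" "a \<otimes> b \<in> \<phi> ` P"
  then obtain x y where "a = \<phi> x" "b = \<phi> y" using surj by blast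
  then show "a \<in> \<phi> ` P \<or> b \<in> \<phi> ` P" using ab(3) prime[of x y] mem by (simp flip: hom_mult)
qed

end


subsection \<open>Monomial primes\<close>

text \<open>Substitution of 0 for the variables outside \<open>S\<close>. As a homomorphism of the
  whole polynomial type it gives both the projection onto \<open>poly_ring S\<close> and, in
  \<open>var_prime\<close>, the primes generated by variables.\<close>

definition restr :: "(nat \<times> nat) set \<Rightarrow> 'k::field mpoly \<Rightarrow> 'k mpoly" where
  "restr S f = (\<Sum>u\<in>keys f \<inter> mons_in S. single u (lookup f u))"

lemma lookup_restr: "lookup (restr S f) u = (if u \<in> mons_in S then lookup f u else 0)"
  unfolding restr_def by (auto simp: lookup_sum lookup_single when_def in_keys_iff)

lemma keys_restr: "keys (restr S f) = keys f \<inter> mons_in S"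
  by (auto simp: in_keys_iff lookup_restr split: if_splits)

lemma restr_add: "restr S (f + g) = restr S f + restr S g"
  by (rule poly_mapping_eqI) (simp add: lookup_restr lookup_add)

lemma restr_self: "keys f \<subseteq> mons_in S \<Longrightarrow> restr S f = f"
  by (rule poly_mapping_eqI) (auto simp: lookup_restr in_keys_iff)

lemma restr_sum: "restr S (sum f X) = (\<Sum>x\<in>X. restr S (f x))"
  by (rule poly_mapping_eqI) (simp add: lookup_restr lookup_sum)

text \<open>The polynomials each of whose monomials involves a variable outside \<open>S\<close>
  form an ideal, and \<open>restr S\<close> is the projection along it.\<close>

lemma restr_mult: "restr S (f * g :: 'k::field mpoly) = restr S f * restr S g"
proof -
  let ?N = "{f :: 'k mpoly. keys f \<inter> mons_in S = {}}"
  have mult: "h * f \<in> ?N" if "f \<in> ?N" for f h :: "'k mpoly"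
    using that keys_mult[of h f] by fastforce
  have diff: "f - restr S f \<in> ?N" for f :: "'k mpoly"
    by (auto simp: in_keys_iff lookup_minus lookup_restr)
  have "f * g - restr S f * restr S g = g * (f - restr S f) + restr S f * (g - restr S g)"
    by (simp add: algebra_simps)
  then have *: "f * g - restr S f * restr S g \<in> ?N"
    using keys_add[of "g * (f - restr S f)" "restr S f * (g - restr S g)"]
      mult[OF diff[of f], of g] mult[OF diff[of g], of "restr S f"] by auto
  have k: "keys (restr S f * restr S g) \<subseteq> mons_in S"
    by (rule poly_ring_times_closed) (auto simp: keys_restr)
  show ?thesis
  proof (rule poly_mapping_eqI)
    fix u
    show "lookup (restr S (f * g)) u = lookup (restr S f * restr S g) u"
    proof (cases "u \<in> mons_in S")
      case True
      then have "u \<notin> keys (f * g - restr S f * restr S g)" using * by blast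
      then show ?thesis using True by (simp add: lookup_restr in_keys_iff lookup_minus)
    next
      case False
      then have "u \<notin> keys (restr S f * restr S g)" using k by blast
      then show ?thesis using False by (simp add: lookup_restr in_keys_iff)
    qed
  qed
qed

lemma restr_one: "restr S 1 = 1"
  by (rule restr_self) simp

lemma restr_0: "restr S 0 = 0"
  by (simp add: restr_def)

text \<open>The ideal generated by the variables in \<open>W\<close>, presented as a kernel; for
  \<open>W = UNIV\<close> the polynomials without constant term.\<close>

definition var_prime :: "(nat \<times> nat) set \<Rightarrow> 'k::field mpoly set" where
  "var_prime W = {f. restr (- W) f = 0}"

lemma var_prime_iff: "f \<in> var_prime W \<longleftrightarrow> (\<forall>u\<in>keys f. keys u \<inter> W \<noteq> {})"
proof -
  have "f \<in> var_prime W \<longleftrightarrow> keys (restr (- W) f) = {}" by (simp add: var_prime_def)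
  then show ?thesis by (auto simp: keys_restr mons_in_def)
qed

lemma idl_var_prime: "idl (var_prime W)"
  by (auto simp: idl_def var_prime_def restr_add restr_mult restr_0)

lemma one_var_prime: "1 \<notin> var_prime W"
  by (simp add: var_prime_def restr_one)

text \<open>Kernel of a homomorphism into a domain. The lexicographic order on pairs makes the
  monomials linearly ordered, and through this the polynomial type has no zero divisors.\<close>

lemma prime_var_prime: "x * y \<in> var_prime W \<Longrightarrow> x \<in> var_prime W \<or> y \<in> var_prime W"
  by (simp add: var_prime_def restr_mult)

lemma var_prime_UNIV: "f \<in> var_prime UNIV \<longleftrightarrow> lookup f 0 = 0"
proof
  assume "f \<in> var_prime UNIV"
  then show "lookup f 0 = 0" unfolding var_prime_iff by (metis in_keys_iff inf_bot_left keys_zero)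
qed (auto simp: var_prime_iff in_keys_iff)


subsection \<open>Unmixedness\<close>

lemma quotient_map:
  fixes L :: "mon set" and S :: "(nat \<times> nat) set"
  defines "A \<equiv> poly_ring S Quot (polys L :: 'k::field mpoly set)"
    and "\<phi> \<equiv> \<lambda>f. a_r_coset (poly_ring S) (polys L) (restr S f :: 'k mpoly)"
  assumes L: "upset S L" and A: "cring A"
  shows "ring_quotient A \<phi>" "\<phi> -` {\<zero>\<^bsub>A\<^esub>} = {f. restr S f \<in> polys L}"
proof -
  have J: "ideal (polys L :: 'k mpoly set) (poly_ring S)" by (rule polys_ideal[OF L])
  have r: "restr S f \<in> carrier (poly_ring S)" for f :: "'k mpoly" by (simp add: keys_restr)
  note hom = ideal.rcos_ring_hom[OF J]
  show "ring_quotient A \<phi>"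
  proof (intro ring_quotient.intro ring_quotient_axioms.intro A)
    fix f g :: "'k mpoly"
    show "\<phi> (f + g) = \<phi> f \<oplus>\<^bsub>A\<^esub> \<phi> g"
      using ring_hom_add[OF hom r[of f] r[of g]] by (simp add: A_def \<phi>_def restr_add)
    show "\<phi> (f * g) = \<phi> f \<otimes>\<^bsub>A\<^esub> \<phi> g"
      using ring_hom_mult[OF hom r[of f] r[of g]] by (simp add: A_def \<phi>_def restr_mult)
    show "\<phi> 1 = \<one>\<^bsub>A\<^esub>"
      using ring_hom_one[OF hom] by (simp add: A_def \<phi>_def restr_one)
    show "\<phi> ` UNIV = carrier A"
    proof
      show "\<phi> ` UNIV \<subseteq> carrier A"
        using ring_hom_closed[OF hom r] by (auto simp: A_def \<phi>_def)
      show "carrier A \<subseteq> \<phi> ` UNIV"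
      proof
        fix X assume "X \<in> carrier A"
        then obtain f where "f \<in> carrier (poly_ring S)" "X = a_r_coset (poly_ring S) (polys L) f"
          by (auto simp: A_def FactRing_def A_RCOSETS_def')
        then have "X = \<phi> f" by (simp add: \<phi>_def restr_self)
        then show "X \<in> \<phi> ` UNIV" by blast
      qed
    qed
  qed
  have zero: "\<zero>\<^bsub>A\<^esub> = polys L" by (simp add: A_def FactRing_def)
  interpret R: cring "poly_ring S :: 'k mpoly ring" by (rule poly_ring_cring)
  interpret J: ideal "polys L :: 'k mpoly set" "poly_ring S" by (rule J)
  have "\<phi> f = polys L \<longleftrightarrow> restr S f \<in> polys L" for f
  proof
    assume "\<phi> f = polys L"
    then show "restr S f \<in> polys L" using J.a_rcos_self[OF r[of f]] by (simp add: \<phi>_def)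
  next
    assume "restr S f \<in> polys L"
    then show "\<phi> f = polys L" unfolding \<phi>_def by (rule J.a_rcos_const)
  qed
  then show "\<phi> -` {\<zero>\<^bsub>A\<^esub>} = {f. restr S f \<in> polys L}" unfolding zero by auto
qed

text \<open>The variables in \<open>V\<close> generate the associated prime \<open>(J : w)\<close> and those in \<open>V0\<close> generate a
  prime containing \<open>J\<close>. At the irrelevant ideal the depth is at most \<open>card (S - V)\<close>: otherwise a
  polynomial relation modulo \<open>(J : w)\<close> between the members of a regular sequence kills \<open>w\<close>. The
  codimension is at least \<open>card (S - V0)\<close>.\<close>

theorem cohen_macaulay_unmixed:
  assumes S: "finite S" and L: "upset S L"
    and CM: "cohen_macaulay (poly_ring S Quot (polys L :: 'k::field mpoly set))"
    and w: "w \<in> mons_in S" "w \<notin> L" and V: "V \<subseteq> S" "\<And>y. y \<in> V \<Longrightarrow> single y 1 + w \<in> L"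
    and V0: "V0 \<subseteq> S" "\<And>u. u \<in> L \<Longrightarrow> keys u \<inter> V0 \<noteq> {}"
  shows "card V \<le> card V0"
proof -
  define A where "A = poly_ring S Quot (polys L :: 'k mpoly set)"
  define \<phi> where "\<phi> = (\<lambda>f. a_r_coset (poly_ring S) (polys L) (restr S f :: 'k mpoly))"
  have CM': "cring A" "noetherian_ring A" "\<And>M. maximalideal M A \<Longrightarrow> depth A M = codim A M"
    using CM by (auto simp: A_def cohen_macaulay_def)
  interpret ring_quotient A \<phi>
    unfolding A_def \<phi>_def by (rule quotient_map[OF L CM'(1)[unfolded A_def]])
  have ker: "\<phi> -` {\<zero>\<^bsub>A\<^esub>} = {f. restr S f \<in> polys L}"
    unfolding A_def \<phi>_def by (rule quotient_map[OF L CM'(1)[unfolded A_def]])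
  \<comment> \<open>The variables outside \<open>S\<close> have to be in \<open>W\<close> because
    \<open>restr S\<close> sends them to 0, so that they lie in the kernel.\<close>
  have ker_W: "\<phi> -` {\<zero>\<^bsub>A\<^esub>} \<subseteq> var_prime W" if W: "V0 \<subseteq> W" "- S \<subseteq> W" for W
  proof
    fix f assume "f \<in> \<phi> -` {\<zero>\<^bsub>A\<^esub>}"
    then have f: "keys f \<inter> mons_in S \<subseteq> L" by (simp add: ker polys_def keys_restr)
    have "keys u \<inter> W \<noteq> {}" if "u \<in> keys f" for u
    proof (cases "u \<in> mons_in S")
      case True
      then have "keys u \<inter> V0 \<noteq> {}" using f that V0(2) by blast
      then show ?thesis using W(1) by blast
    next
      case False
      then show ?thesis using W(2) by (auto simp: mons_in_def)
    qed
    then show "f \<in> var_prime W" by (simp add: var_prime_iff)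
  qed
  let ?M = "var_prime UNIV :: 'k mpoly set"
  have kerM: "\<phi> -` {\<zero>\<^bsub>A\<^esub>} \<subseteq> ?M" by (rule ker_W) auto
  have vimM: "\<phi> -` (\<phi> ` ?M) = ?M" by (rule vimage_image[OF idl_var_prime kerM])
  have max: "maximalideal (\<phi> ` ?M) A"
  proof (rule maximalidealI)
    show "ideal (\<phi> ` ?M) A" by (rule ideal_image[OF idl_var_prime])
    have "1 \<notin> \<phi> -` (\<phi> ` ?M)" unfolding vimM by (rule one_var_prime)
    then have "\<phi> 1 \<notin> \<phi> ` ?M" by (simp only: vimage_eq not_False_eq_True)
    then show "carrier A \<noteq> \<phi> ` ?M" by (metis hom_closed)
    fix K assume K: "ideal K A" "\<phi> ` ?M \<subseteq> K" "K \<subseteq> carrier A"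
    show "K = \<phi> ` ?M \<or> K = carrier A"
    proof (cases "K \<subseteq> \<phi> ` ?M")
      case False
      then obtain k where k: "k \<in> K" "k \<notin> \<phi> ` ?M" by blast
      have "k \<in> \<phi> ` UNIV" unfolding surj using k(1) K(3) by (rule rev_subsetD)
      then obtain f where "k = \<phi> f" by (rule imageE)
      then have f: "\<phi> f \<in> K" "f \<notin> ?M" using k by auto
      have idK: "idl (\<phi> -` K)" by (rule idl_vimage[OF K(1)])
      let ?a = "lookup f 0"
      have a: "?a \<noteq> 0" using f(2) by (simp add: var_prime_UNIV)
      have "f - single 0 ?a \<in> ?M" by (simp add: var_prime_UNIV lookup_minus)
      then have fa: "f - single 0 ?a \<in> \<phi> -` K" using K(2) by blast
      have "f \<in> \<phi> -` K" using f(1) by simp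
      then have "f - (f - single 0 ?a) \<in> \<phi> -` K" using fa by (rule idl_diff[OF idK])
      then have "single 0 (inverse ?a) * single 0 ?a \<in> \<phi> -` K" by (intro idl_mult[OF idK]) simp
      then have "1 \<in> \<phi> -` K" using a by (simp add: mult_single)
      then have "x \<in> \<phi> -` K" for x using idl_mult[OF idK, of 1 x] by simp
      then have "\<phi> ` UNIV \<subseteq> K" by auto
      then show ?thesis using K(3) unfolding surj by simp
    qed (use K(2) in blast)
  qed
  interpret noetherian_at_prime ?M "\<phi> -` {\<zero>\<^bsub>A\<^esub>}"
  proof
    show "idl ?M" by (rule idl_var_prime)
    show "1 \<notin> ?M" by (rule one_var_prime)
    show "x \<in> ?M \<or> y \<in> ?M" if "x * y \<in> ?M" for x y using that by (rule prime_var_prime)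
    show "\<exists>I\<in>F. \<forall>I'\<in>F. I \<subseteq> I' \<longrightarrow> I' = I"
      if "F \<noteq> {}" "\<And>I. I \<in> F \<Longrightarrow> idl I \<and> \<phi> -` {\<zero>\<^bsub>A\<^esub>} \<subseteq> I" for F
      by (rule noetherian_maximal[OF CM'(2) that])
  qed
  let ?J = "\<phi> -` {\<zero>\<^bsub>A\<^esub>}"
  have idJ: "idl ?J" by (rule idl_vimage[OF zeroideal])
  \<comment> \<open>A factor with nonzero constant term keeps w among the monomials of the
    product.\<close>
  have wJ: "to_poly w \<notin> sat ?J"
  proof
    assume "to_poly w \<in> sat ?J"
    then obtain f where f: "lookup f 0 \<noteq> 0" "f * to_poly w \<in> ?J"
      by (auto simp: sat_def var_prime_UNIV)
    have "w \<in> (\<lambda>u. u + w) ` keys f" using f(1) by (force simp: in_keys_iff)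
    then have "w \<in> keys (restr S (f * to_poly w))" using w(1) by (simp add: keys_restr keys_times_single)
    then show False using f(2) w(2) unfolding ker polys_def by blast
  qed
  have "length xs \<le> card (S - V)" if xs: "set xs \<subseteq> \<phi> ` ?M" "regular_sequence A xs" for xs
  proof (rule ccontr)
    assume "\<not> length xs \<le> card (S - V)"
    define fs where "fs = map (inv_into ?M \<phi>) xs"
    have map: "map \<phi> fs = xs"
      unfolding fs_def map_map using xs(1) by (intro map_idI) (auto simp: f_inv_into_f)
    have fsM: "set fs \<subseteq> ?M" using xs(1) by (auto simp: fs_def inv_into_into)
    have len: "card (S - V) < length fs"
      using \<open>\<not> length xs \<le> card (S - V)\<close> by (simp add: fs_def)
    have "regular (\<phi> -` genideal A {}) fs"
    proof (rule regular_lift)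
      fix l a assume "l < length fs" "a \<in> carrier A"
        "\<phi> (fs ! l) \<otimes>\<^bsub>A\<^esub> a \<in> genideal A ({} \<union> set (take l (map \<phi> fs)))"
      then show "a \<in> genideal A ({} \<union> set (take l (map \<phi> fs)))"
        using xs(2) unfolding regular_sequence_def map[symmetric] by simp
    qed simp
    then have reg: "regular ?J fs" by (simp only: vimage_genideal_empty)
    \<comment> \<open>Setting the variables in \<open>V\<close> and those outside \<open>S\<close>
      to 0 leaves \<open>card (S - V)\<close> variables, fewer than the sequence is long.\<close>
    let ?r = "restr (S - V)"
    have kr: "keys f \<subseteq> mons_in (S - V)" if "f \<in> set (map ?r fs)" for f
      using that by (auto simp: keys_restr)
    have "card (S - V) < length (map ?r fs)" using len by simp
    from algebraic_dependence[OF finite_Diff[OF S] this kr]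
    obtain X a where X: "finite X" "X \<noteq> {}" "\<And>\<alpha>. \<alpha> \<in> X \<Longrightarrow> length \<alpha> = length fs \<and> a \<alpha> \<noteq> 0"
      and dep: "(\<Sum>\<alpha>\<in>X. single 0 (a \<alpha>) * power_prod (map ?r fs) \<alpha>) = 0"
      by auto
    have rp: "?r (f ^ n) = ?r f ^ n" for f :: "'k mpoly" and n
      by (induction n) (simp_all add: restr_one restr_mult)
    have rpp: "power_prod (map ?r gs) \<alpha> = ?r (power_prod gs \<alpha>)" for gs :: "'k mpoly list" and \<alpha>
      by (induction gs arbitrary: \<alpha>) (simp_all add: restr_one restr_mult rp)
    define F where "F = (\<Sum>\<alpha>\<in>X. single 0 (a \<alpha>) * power_prod fs \<alpha>)"
    have "restr (S - V) (single 0 (a \<alpha>)) = single 0 (a \<alpha>)" for \<alpha>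
      by (rule restr_self) simp
    then have "?r F = 0" using dep by (simp add: F_def restr_sum restr_mult rpp)
    have "F * to_poly w \<in> ?J"
      unfolding ker polys_def mem_Collect_eq
    proof
      fix v assume "v \<in> keys (restr S (F * to_poly w))"
      then obtain u where u: "v = u + w" "u \<in> keys F" "u \<in> mons_in S"
        by (auto simp: keys_restr keys_times_single)
      \<comment> \<open>Since \<open>F\<close> becomes 0 under this substitution, each of its
        monomials in the variables \<open>S\<close> involves some y in \<open>V\<close>, and y times
        w is in \<open>L\<close>.\<close>
      have "u \<notin> keys (?r F)" using \<open>?r F = 0\<close> by simp
      then obtain y where y: "y \<in> keys u" "y \<in> V"
        using u(2,3) by (auto simp: keys_restr mons_in_def)
      have "mdvd (single y 1) u" using y(1) by (auto simp: mdvd_def lookup_single when_def in_keys_iff)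
      then have "mdvd (single y 1 + w) v" unfolding u(1) by (rule mdvd_add_mono) simp
      then show "v \<in> L" using upsetD[OF L V(2)[OF y(2)]] u w(1) by simp
    qed
    then have "F * to_poly w \<in> sat ?J" by (rule subsetD[OF sat_superset])
    moreover have "F * to_poly w \<notin> sat ?J"
      unfolding F_def
      by (rule regular_independent[OF idJ _ reg fsM wJ X(1,2)]) (use X(3) in \<open>auto simp: var_prime_UNIV\<close>)
    ultimately show False by blast
  qed
  then have depth: "depth A (\<phi> ` ?M) \<le> enat (card (S - V))"
    unfolding depth_def by (intro Sup_least) auto
  have "finite (S - V0)" using S by simp
  then obtain ys where ys: "set ys = S - V0" "distinct ys"
    using finite_distinct_list by blast
  \<comment> \<open>Adjoining one variable at a time leads from the prime generated by
    \<open>V0\<close> to \<open>?M\<close> in \<open>card (S - V0)\<close> strict steps.\<close>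
  define W where "W l = - S \<union> V0 \<union> set (take l ys)" for l
  have W: "V0 \<subseteq> W l" "- S \<subseteq> W l" for l by (auto simp: W_def)
  have "W (length ys) = UNIV" using ys(1) by (auto simp: W_def)
  moreover have "primeideal (\<phi> ` var_prime (W l)) A" for l
    by (rule primeideal_image[OF idl_var_prime ker_W[OF W] one_var_prime prime_var_prime])
  moreover have "\<phi> ` var_prime (W l) \<subset> \<phi> ` var_prime (W (Suc l))" if "l < length ys" for l
  proof -
    have "W l \<subseteq> W (Suc l)" using that by (auto simp: W_def take_Suc_conv_app_nth)
    then have "var_prime (W l) \<subseteq> var_prime (W (Suc l))"
      by (intro subsetI) (simp add: var_prime_iff, blast)
    moreover have "ys ! l \<in> W (Suc l)" using that by (simp add: W_def take_Suc_conv_app_nth)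
    moreover have "ys ! l \<notin> W l"
    proof -
      have "ys ! l \<notin> set (take l ys)"
        using that ys(2) by (auto simp: in_set_conv_nth nth_eq_iff_index_eq)
      moreover have "ys ! l \<in> S - V0" using that ys(1) nth_mem by blast
      ultimately show ?thesis by (auto simp: W_def)
    qed
    ultimately have "var_prime (W l) \<subset> (var_prime (W (Suc l)) :: 'k mpoly set)"
      using var_prime_iff[of "to_poly (single (ys ! l) 1) :: 'k mpoly"] by auto
    moreover have vim: "\<phi> -` (\<phi> ` var_prime (W l)) = var_prime (W l)" for l
      by (rule vimage_image[OF idl_var_prime ker_W[OF W]])
    ultimately show ?thesis by (metis image_mono psubset_eq)
  qed
  ultimately have "\<exists>Q. (\<forall>l\<le>length ys. primeideal (Q l) A) \<and> (\<forall>l<length ys. Q l \<subset> Q (Suc l)) \<and>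
      Q (length ys) = \<phi> ` ?M"
    by (intro exI[of _ "\<lambda>l. \<phi> ` var_prime (W l)"]) simp
  then have "enat (length ys) \<le> codim A (\<phi> ` ?M)"
    unfolding codim_def by (intro Sup_upper) blast
  also have "\<dots> \<le> enat (card (S - V))" using depth CM'(3)[OF max] by simp
  finally have "card (S - V0) \<le> card (S - V)"
    using distinct_card[OF ys(2)] ys(1) by simp
  moreover have "card (S - V0) = card S - card V0" "card (S - V) = card S - card V"
    using S V(1) V0(1) by (simp_all add: card_Diff_subset finite_subset)
  moreover have "card V \<le> card S" by (rule card_mono[OF S V(1)])
  ultimately show ?thesis by linarith
qed


section \<open>Independent sets modulo an ideal and its initial ideals\<close>

lemma finite_sets_separated:
  fixes A B :: "real set"
  assumes "finite A" "finite B" "\<And>a b. a \<in> A \<Longrightarrow> b \<in> B \<Longrightarrow> a < b"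
  shows "\<exists>t. (\<forall>a\<in>A. a < t) \<and> (\<forall>b\<in>B. t < b)"
proof -
  consider "A = {}" | "B = {}" | "A \<noteq> {}" "B \<noteq> {}" by blast
  then show ?thesis
  proof cases
    case 1
    have "Min (insert 0 B) - 1 < b" if "b \<in> B" for b
    proof -
      have "Min (insert 0 B) \<le> b" using that assms(2) by (intro Min_le) auto
      then show ?thesis by linarith
    qed
    then show ?thesis using 1 by blast
  next
    case 2
    have "a < Max (insert 0 A) + 1" if "a \<in> A" for a
    proof -
      have "a \<le> Max (insert 0 A)" using that assms(1) by (intro Max_ge) auto
      then show ?thesis by linarith
    qed
    then show ?thesis using 2 by blast
  next
    case 3
    then have "Max A < Min B" using assms by simp
    then obtain t where "Max A < t" "t < Min B" using dense by blast
    then show ?thesis using assms(1,2) 3 by (intro exI[of _ t]) auto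
  qed
qed

text \<open>Fourier--Motzkin elimination: a coordinate is eliminated by combining vectors on which it has
  opposite signs; all combinations stay in the semigroup, which does not contain 0.\<close>

lemma positive_functional:
  fixes P :: "('x \<Rightarrow> int) set"
  assumes add: "\<And>p q. p \<in> P \<Longrightarrow> q \<in> P \<Longrightarrow> (\<lambda>x. p x + q x) \<in> P" and zero: "(\<lambda>_. 0) \<notin> P"
    and S: "finite S" and D: "finite D" "D \<subseteq> P" "\<And>d x. d \<in> D \<Longrightarrow> x \<notin> S \<Longrightarrow> d x = 0"
  shows "\<exists>\<omega> :: 'x \<Rightarrow> real. \<forall>d\<in>D. 0 < (\<Sum>x\<in>S. \<omega> x * d x)"
  using S D
proof (induction S arbitrary: D rule: finite_induct)
  case empty
  have "D = {}"
  proof (rule ccontr)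
    assume "D \<noteq> {}"
    then obtain d where d: "d \<in> D" by blast
    then have "d = (\<lambda>_. 0)" using empty.prems(3) by auto
    then show False using d empty.prems(2) zero by blast
  qed
  then show ?case by simp
next
  case (insert s S)
  have mult: "(\<lambda>x. int (Suc n) * p x) \<in> P" if p: "p \<in> P" for p n
  proof (induction n)
    case (Suc n)
    have "(\<lambda>x. p x + int (Suc n) * p x) \<in> P" by (rule add[OF p Suc])
    then show ?case by (simp add: algebra_simps)
  qed (use p in simp)
  have mult': "(\<lambda>x. k * p x) \<in> P" if p: "p \<in> P" and k: "0 < k" for p k
  proof -
    obtain n where "k = int (Suc n)" using k by (metis gr0_implies_Suc pos_int_cases)
    then show ?thesis using mult[OF p] by simp
  qed
  let ?Dp = "{d \<in> D. 0 < d s}" and ?Dn = "{d \<in> D. d s < 0}" and ?D0 = "{d \<in> D. d s = 0}"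
  \<comment> \<open>The coefficients are positive for p in \<open>?Dp\<close> and q in
    \<open>?Dn\<close>, and coordinate s cancels.\<close>
  define cmb where "cmb p q = (\<lambda>x. - q s * p x + p s * q x)" for p q :: "'x \<Rightarrow> int"
  have cmbP: "cmb p q \<in> P" if pq: "p \<in> P" "q \<in> P" "0 < p s" "q s < 0" for p q
    unfolding cmb_def
  proof (rule add)
    show "(\<lambda>x. - q s * p x) \<in> P" by (rule mult'[OF pq(1)]) (use pq(4) in simp)
    show "(\<lambda>x. p s * q x) \<in> P" by (rule mult'[OF pq(2,3)])
  qed
  let ?C = "(\<lambda>(p, q). cmb p q) ` (?Dp \<times> ?Dn)"
  have "\<exists>\<omega> :: 'x \<Rightarrow> real. \<forall>d\<in>?D0 \<union> ?C. 0 < (\<Sum>x\<in>S. \<omega> x * d x)"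
  proof (rule insert.IH)
    show "finite (?D0 \<union> ?C)" using insert.prems(1) by simp
    show "?D0 \<union> ?C \<subseteq> P"
      using insert.prems(2) cmbP by auto
    show "d x = 0" if d: "d \<in> ?D0 \<union> ?C" "x \<notin> S" for d x
    proof -
      have z: "p x = 0" if "p \<in> D" "x \<noteq> s" for p
        by (rule insert.prems(3)) (use that d(2) in simp_all)
      show ?thesis
      proof (cases "d \<in> ?D0")
        case True
        then show ?thesis using z[of d] by (cases "x = s") auto
      next
        case False
        then obtain p q where pq: "p \<in> D" "q \<in> D" "d = cmb p q" using d(1) by auto
        then show ?thesis using z[of p] z[of q] by (cases "x = s") (simp_all add: cmb_def)
      qed
    qed
  qed
  then obtain \<omega> :: "'x \<Rightarrow> real" where pos: "\<forall>d\<in>?D0 \<union> ?C. 0 < (\<Sum>x\<in>S. \<omega> x * d x)"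
    by (rule exE)
  have \<omega>: "0 < (\<Sum>x\<in>S. \<omega> x * d x)" if "d \<in> ?D0 \<union> ?C" for d
    using pos that by (rule bspec)
  define ev where "ev d = (\<Sum>x\<in>S. \<omega> x * of_int (d x))" for d :: "'x \<Rightarrow> int"
  have ev_cmb: "ev (cmb p q) = - of_int (q s) * ev p + of_int (p s) * ev q" for p q
    by (simp add: ev_def cmb_def sum_distrib_left algebra_simps sum_subtractf sum_negf)
  \<comment> \<open>The weight t of s must satisfy \<open>t * d s + ev d > 0\<close> for all d: a
    lower bound from each d in \<open>?Dp\<close>, an upper bound from each d in \<open>?Dn\<close>.
    Positivity on the combinations makes these bounds compatible.\<close>
  have "\<exists>t. (\<forall>a\<in>(\<lambda>d. - ev d / of_int (d s)) ` ?Dp. a < t) \<and> (\<forall>b\<in>(\<lambda>d. - ev d / of_int (d s)) ` ?Dn. t < b)"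
  proof (rule finite_sets_separated)
    show "finite ((\<lambda>d. - ev d / of_int (d s)) ` ?Dp)" "finite ((\<lambda>d. - ev d / of_int (d s)) ` ?Dn)"
      using insert.prems(1) by auto
    fix a b assume "a \<in> (\<lambda>d. - ev d / of_int (d s)) ` ?Dp" "b \<in> (\<lambda>d. - ev d / of_int (d s)) ` ?Dn"
    then obtain p q where p: "p \<in> ?Dp" "a = - ev p / of_int (p s)"
      and q: "q \<in> ?Dn" "b = - ev q / of_int (q s)" by blast
    have "cmb p q \<in> ?C" using p(1) q(1) by force
    then have "0 < ev (cmb p q)" using \<omega>[of "cmb p q"] by (simp add: ev_def)
    moreover have P: "0 < real_of_int (p s)" "real_of_int (q s) < 0" using p(1) q(1) by auto
    have "(b - a) * (of_int (p s) * - of_int (q s)) = ev (cmb p q)"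
      using P unfolding p(2) q(2) ev_cmb by (simp add: field_simps)
    ultimately have "0 < (b - a) * (of_int (p s) * - of_int (q s))" by simp
    moreover have "0 < real_of_int (p s) * - of_int (q s)" using P by (simp add: mult_pos_neg)
    ultimately have "0 < b - a" by (rule zero_less_mult_pos2)
    then show "a < b" by simp
  qed
  then obtain t where sep: "(\<forall>a\<in>(\<lambda>d. - ev d / of_int (d s)) ` ?Dp. a < t) \<and>
      (\<forall>b\<in>(\<lambda>d. - ev d / of_int (d s)) ` ?Dn. t < b)"
    by (rule exE)
  have t: "- ev d / of_int (d s) < t" if "d \<in> D" "0 < d s" for d
    using sep that by simp
  have t': "t < - ev d / of_int (d s)" if "d \<in> D" "d s < 0" for d
    using sep that by simp
  define \<omega>' where "\<omega>' = \<omega>(s := t)"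
  have ev': "(\<Sum>x\<in>insert s S. \<omega>' x * d x) = t * of_int (d s) + ev d" for d :: "'x \<Rightarrow> int"
  proof -
    have "(\<Sum>x\<in>S. \<omega>' x * d x) = ev d"
      unfolding ev_def by (rule sum.cong) (use insert.hyps in \<open>auto simp: \<omega>'_def\<close>)
    then show ?thesis using insert.hyps by (simp add: \<omega>'_def)
  qed
  have "0 < (\<Sum>x\<in>insert s S. \<omega>' x * d x)" if d: "d \<in> D" for d
  proof -
    consider "0 < d s" | "d s < 0" | "d s = 0" by linarith
    then have "0 < t * of_int (d s) + ev d"
    proof cases
      case 1
      then show ?thesis using t[OF d] by (simp add: field_simps)
    next
      case 2
      then show ?thesis using t'[OF d] by (simp add: field_simps)
    next
      case 3
      then show ?thesis using \<omega>[of d] d by (simp add: ev_def)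
    qed
    then show ?thesis by (simp only: ev')
  qed
  then show ?case by blast
qed

definition weight :: "(nat \<times> nat) set \<Rightarrow> (nat \<times> nat \<Rightarrow> real) \<Rightarrow> mon \<Rightarrow> real" where
  "weight S \<omega> u = (\<Sum>x\<in>S. \<omega> x * real (lookup u x))"

lemma weight_add: "weight S \<omega> (u + v) = weight S \<omega> u + weight S \<omega> v"
  by (simp add: weight_def lookup_add algebra_simps sum.distrib)

text \<open>The exponent vectors of quotients u / v with v below u are closed under addition and
  never 0, so \<open>positive_functional\<close> applies to the finitely many that matter. The unit
  vectors are included to make every weight positive.\<close>

lemma weight_exists:
  fixes G :: "'k::field mpoly set"
  assumes ord: "monomial_order c ord" and S: "finite S" "S \<subseteq> {1..c} \<times> {1..}"
    and G: "finite G" "\<And>g. g \<in> G \<Longrightarrow> g \<noteq> 0 \<and> keys g \<subseteq> mons_in S"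
  shows "\<exists>\<omega>. (\<forall>x\<in>S. 0 < \<omega> x) \<and>
    (\<forall>g\<in>G. \<forall>v\<in>keys g. weight S \<omega> v \<le> weight S \<omega> (lead_mon ord g))"
proof -
  have Sm: "mons_in S \<subseteq> mons c" using S(2) by (auto simp: mons_def mons_in_def)
  have tr: "trans ord"
    using ord by (simp add: monomial_order_def linear_order_on_def partial_order_on_def preorder_on_def)
  define diff where "diff u v = (\<lambda>x. int (lookup u x) - int (lookup v x))" for u v :: mon
  let ?P = "{diff u v | u v. u \<in> mons c \<and> v \<in> mons c \<and> (v, u) \<in> ord \<and> u \<noteq> v}"
  have addmon: "u + v \<in> mons c" if "u \<in> mons c" "v \<in> mons c" for u v
    using that by (simp add: mons_def)
  have ordadd: "(u + w, v + w) \<in> ord" if "u \<in> mons c" "v \<in> mons c" "w \<in> mons c" "(u, v) \<in> ord" for u v w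
    using ord that unfolding monomial_order_def by blast
  let ?D = "(\<Union>g\<in>G. (\<lambda>v. diff (lead_mon ord g) v) ` (keys g - {lead_mon ord g}))
      \<union> (\<lambda>x. diff (single x 1) 0) ` S"
  have "\<exists>\<omega> :: nat \<times> nat \<Rightarrow> real. \<forall>d\<in>?D. 0 < (\<Sum>x\<in>S. \<omega> x * d x)"
  proof (rule positive_functional[of ?P])
    fix p q assume "p \<in> ?P" "q \<in> ?P"
    then obtain u v u' v' where p: "p = diff u v" "u \<in> mons c" "v \<in> mons c" "(v, u) \<in> ord" "u \<noteq> v"
      and q: "q = diff u' v'" "u' \<in> mons c" "v' \<in> mons c" "(v', u') \<in> ord" "u' \<noteq> v'"
      by blast
    have 1: "(v + v', u + v') \<in> ord" by (rule ordadd[OF p(3,2) q(3) p(4)])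
    have 2: "(u + v', u + u') \<in> ord" using ordadd[OF q(3,2) p(2) q(4)] by (simp add: add.commute)
    have "u + u' \<noteq> v + v'"
    proof
      assume "u + u' = v + v'"
      then have "v + v' = u + v'" using ord_antisym[OF ord 1] 2 by simp
      then show False using p(5) by simp
    qed
    moreover have "(\<lambda>x. p x + q x) = diff (u + u') (v + v')"
      by (auto simp: p(1) q(1) diff_def lookup_add)
    ultimately show "(\<lambda>x. p x + q x) \<in> ?P"
      using addmon[OF p(2) q(2)] addmon[OF p(3) q(3)] transD[OF tr 1 2] by blast
  next
    show "(\<lambda>_. 0) \<notin> ?P"
    proof
      assume "(\<lambda>_. 0) \<in> ?P"
      then obtain u v where uv: "(\<lambda>_. 0) = diff u v" "u \<noteq> v" by blast
      have "lookup u x = lookup v x" for x using fun_cong[OF uv(1), of x] by (simp add: diff_def)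
      then show False using uv(2) poly_mapping_eqI by blast
    qed
  next
    show "finite S" by (rule S(1))
    show "finite ?D" using S(1) G(1) by simp
  next
    show "?D \<subseteq> ?P"
    proof
      fix d assume "d \<in> ?D"
      then consider g v where "g \<in> G" "v \<in> keys g" "v \<noteq> lead_mon ord g" "d = diff (lead_mon ord g) v"
        | x where "x \<in> S" "d = diff (single x 1) 0" by blast
      then show "d \<in> ?P"
      proof cases
        case 1
        have k: "keys g \<subseteq> mons c" "g \<noteq> 0" using G(2)[OF 1(1)] Sm by auto
        have "lead_mon ord g \<in> mons c" "v \<in> mons c" using lead_mon(1)[OF ord k] k(1) 1(2) by auto
        then show ?thesis using lead_mon(2)[OF ord k 1(2)] 1(3,4) by blast
      next
        case 2
        have "single x 1 \<in> mons c" using Sm 2(1) by (simp add: mons_in_def subset_iff)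
        moreover have "(0, single x 1) \<in> ord"
          using ord calculation unfolding monomial_order_def by blast
        moreover have "0 \<in> mons c" by (simp add: mons_def)
        moreover have "single x (1::nat) \<noteq> 0" by (metis lookup_single_eq lookup_zero one_neq_zero)
        ultimately show ?thesis using 2(2) by blast
      qed
    qed
  next
    fix d x assume d: "d \<in> ?D" and x: "x \<notin> S"
    have look: "lookup u x = 0" if "u \<in> mons_in S" for u :: mon
      using that x by (auto simp: mons_in_def in_keys_iff)
    from d consider g v where "g \<in> G" "v \<in> keys g" "d = diff (lead_mon ord g) v"
        | y where "y \<in> S" "d = diff (single y 1) 0" by blast
    then show "d x = 0"
    proof cases
      case 1
      have k: "keys g \<subseteq> mons_in S" "keys g \<subseteq> mons c" "g \<noteq> 0" using G(2)[OF 1(1)] Sm by auto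
      then have "v \<in> mons_in S" "lead_mon ord g \<in> mons_in S"
        using 1(2) lead_mon(1)[OF ord k(2,3)] by auto
      then show ?thesis using 1(3) look by (simp add: diff_def)
    next
      case 2
      then show ?thesis using x by (auto simp: diff_def lookup_single when_def)
    qed
  qed
  then obtain \<omega> :: "nat \<times> nat \<Rightarrow> real" where pos: "\<forall>d\<in>?D. 0 < (\<Sum>x\<in>S. \<omega> x * d x)"
    by (rule exE)
  have \<omega>: "0 < (\<Sum>x\<in>S. \<omega> x * d x)" if "d \<in> ?D" for d
    using pos that by (rule bspec)
  have dw: "(\<Sum>x\<in>S. \<omega> x * diff u v x) = weight S \<omega> u - weight S \<omega> v" for u v
    by (simp add: diff_def weight_def algebra_simps sum_subtractf)
  have "0 < \<omega> x" if "x \<in> S" for x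
  proof -
    have "0 < weight S \<omega> (single x 1) - weight S \<omega> 0"
      unfolding dw[symmetric] by (rule \<omega>) (use that in blast)
    also have "weight S \<omega> 0 = 0" by (simp add: weight_def)
    also have "weight S \<omega> (single x 1) = (\<Sum>y\<in>S. if y = x then \<omega> x else 0)"
      unfolding weight_def by (rule sum.cong) (auto simp: lookup_single when_def)
    finally show ?thesis using that S(1) by simp
  qed
  moreover have "weight S \<omega> v \<le> weight S \<omega> (lead_mon ord g)" if "g \<in> G" "v \<in> keys g" for g v
  proof (cases "v = lead_mon ord g")
    case False
    have "0 < weight S \<omega> (lead_mon ord g) - weight S \<omega> v"
      unfolding dw[symmetric] by (rule \<omega>) (use that False in blast)
    then show ?thesis by simp
  qed simp
  ultimately show ?thesis by blast
qed

section \<open>Counting standard monomials\<close>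

lemma monomials_finite_basis:
  assumes "finite S" "L \<subseteq> mons_in S"
  shows "\<exists>B. finite B \<and> B \<subseteq> L \<and> (\<forall>u\<in>L. \<exists>b\<in>B. mdvd b u)"
proof -
  have "wqo_on mdvd (mons_in S)"
  proof (rule wqo_on_transfer[OF dickson[OF assms(1)], where R = "\<lambda>y u. y = lookup u \<and> u \<in> mons_in S"])
    show "mdvd u v" if "\<forall>x\<in>S. y x \<le> y' x" "y = lookup u \<and> u \<in> mons_in S" "y' = lookup v \<and> v \<in> mons_in S"
      for y y' u v
      unfolding mdvd_def
    proof
      fix x show "lookup u x \<le> lookup v x"
      proof (cases "x \<in> S")
        case False
        then have "x \<notin> keys u" using that(2) by (auto simp: mons_in_def)
        then show ?thesis by (simp add: in_keys_iff)
      qed (use that in simp)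
    qed
  qed auto
  from wqo_on_finite_basis[OF wqo_on_subset[OF this assms(2)]] show ?thesis .
qed

text \<open>Outside a monomial ideal \<open>L\<close> whose generators have exponents at most \<open>N\<close>, the variables with
  exponent above \<open>N\<close> form an independent set.\<close>

lemma card_standard_monomials:
  assumes S: "finite S" and L: "upset S L"
    and d: "\<And>U. U \<subseteq> S \<Longrightarrow> (\<And>u. u \<in> L \<Longrightarrow> \<not> keys u \<subseteq> U) \<Longrightarrow> card U < d"
  shows "\<exists>N. \<forall>E. card {u \<in> mons_in S - L. \<forall>x\<in>S. lookup u x \<le> E} \<le> N * Suc E ^ (d - 1)"
proof -
  have "L \<subseteq> mons_in S" using L by (simp add: upset_def)
  from monomials_finite_basis[OF S this] obtain B where B: "finite B" "B \<subseteq> L"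
    and basis: "\<And>u. u \<in> L \<Longrightarrow> \<exists>b\<in>B. mdvd b u" by auto
  define N where "N = (\<Sum>b\<in>B. mdeg b)"
  have N: "lookup b x \<le> N" if "b \<in> B" for b x
  proof -
    have "lookup b x \<le> mdeg b"
    proof (cases "x \<in> keys b")
      case True
      then show ?thesis unfolding mdeg_def by (intro member_le_sum) auto
    qed (simp add: in_keys_iff)
    also have "\<dots> \<le> N" unfolding N_def by (rule member_le_sum[OF that]) (use B(1) in auto)
    finally show ?thesis .
  qed
  have "card {u \<in> mons_in S - L. \<forall>x\<in>S. lookup u x \<le> E} \<le> 2 ^ card S * Suc N ^ card S * Suc E ^ (d - 1)" for E
  proof -
    \<comment> \<open>Standard monomials are sorted by the set \<open>T\<close> of variables with
      exponent above N; there are at most \<open>2 ^ card S\<close> such sets, each with fewer than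
      d elements.\<close>
    let ?Box = "\<lambda>T. {u \<in> mons_in S. \<forall>x\<in>S. lookup u x \<le> (if x \<in> T then E else N)}"
    let ?T = "{T \<in> Pow S. card T < d}"
    have "{u \<in> mons_in S - L. \<forall>x\<in>S. lookup u x \<le> E} \<subseteq> (\<Union>T\<in>?T. ?Box T)"
    proof
      fix u assume u: "u \<in> {u \<in> mons_in S - L. \<forall>x\<in>S. lookup u x \<le> E}"
      let ?U = "{x \<in> S. N < lookup u x}"
      have "card ?U < d"
      proof (rule d)
        fix v assume "v \<in> L"
        then obtain b where b: "b \<in> B" "mdvd b v" using basis by blast
        show "\<not> keys v \<subseteq> ?U"
        proof
          assume "keys v \<subseteq> ?U"
          then have kb: "keys b \<subseteq> ?U" using mdvd_keys[OF b(2)] by blast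
          have "lookup b x \<le> lookup u x" for x
          proof (cases "x \<in> keys b")
            case True
            then show ?thesis using N[OF b(1), of x] kb by auto
          qed (simp add: in_keys_iff)
          then have "mdvd b u" by (simp add: mdvd_def)
          then have "u \<in> L" using upsetD[OF L] b(1) B(2) u by blast
          then show False using u by blast
        qed
      qed simp
      then have "?U \<in> ?T" by simp
      moreover have "u \<in> ?Box ?U" using u by auto
      ultimately show "u \<in> (\<Union>T\<in>?T. ?Box T)" by blast
    qed
    moreover have fin: "finite ?T" using S by simp
    moreover have "finite (\<Union>T\<in>?T. ?Box T)" using fin card_mons_box(1)[OF S] by auto
    ultimately have "card {u \<in> mons_in S - L. \<forall>x\<in>S. lookup u x \<le> E} \<le> card (\<Union>T\<in>?T. ?Box T)"
      by (intro card_mono)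
    also have "\<dots> \<le> (\<Sum>T\<in>?T. card (?Box T))" by (rule card_UN_le[OF fin])
    also have "\<dots> \<le> (\<Sum>T\<in>?T. Suc N ^ card S * Suc E ^ (d - 1))"
    proof (rule sum_mono)
      fix T assume T: "T \<in> ?T"
      have "card (?Box T) = (\<Prod>x\<in>S. Suc (if x \<in> T then E else N))" by (rule card_mons_box(2)[OF S])
      also have "\<dots> = (\<Prod>x\<in>S. if x \<in> T then Suc E else Suc N)" by (rule prod.cong) auto
      also have "\<dots> = Suc E ^ card (S \<inter> T) * Suc N ^ card (S \<inter> - T)"
        using S by (simp add: prod.If_cases)
      also have "S \<inter> T = T" using T by auto
      also have "Suc E ^ card T * Suc N ^ card (S \<inter> - T) \<le> Suc E ^ (d - 1) * Suc N ^ card S"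
        using T S by (intro mult_mono power_increasing card_mono) auto
      finally show "card (?Box T) \<le> Suc N ^ card S * Suc E ^ (d - 1)" by (simp add: mult.commute)
    qed
    also have "\<dots> = card ?T * (Suc N ^ card S * Suc E ^ (d - 1))" by simp
    also have "\<dots> \<le> 2 ^ card S * (Suc N ^ card S * Suc E ^ (d - 1))"
      using card_mono[of "Pow S" ?T] S by (intro mult_right_mono) (auto simp: card_Pow)
    finally show ?thesis by (simp add: mult.assoc)
  qed
  then show ?thesis by blast
qed

text \<open>One weight need not suit the leading monomials of all polynomials in \<open>J\<close>.
  It is adapted to finitely many whose leading monomials generate the initial ideal, and f t is
  taken as a monomial multiple of one of these.\<close>

lemma weighted_division:
  fixes J :: "'k::field mpoly set"
  assumes ord: "monomial_order c ord" and J: "ideal J (poly_ring (vars c n))"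
  shows "\<exists>\<omega> f. (\<forall>x\<in>vars c n. 0 < \<omega> x) \<and> (\<forall>t\<in>leads ord J. f t \<in> J \<and> f t \<noteq> 0 \<and>
    lead_mon ord (f t) = t \<and> (\<forall>v\<in>keys (f t). weight (vars c n) \<omega> v \<le> weight (vars c n) \<omega> t))"
proof -
  let ?S = "vars c n"
  have L: "upset ?S (leads ord J)" by (rule upset_leads[OF ord J])
  then have "leads ord J \<subseteq> mons_in ?S" by (simp add: upset_def)
  from monomials_finite_basis[OF _ this] obtain B where B: "finite B" "B \<subseteq> leads ord J"
    and basis: "\<And>u. u \<in> leads ord J \<Longrightarrow> \<exists>b\<in>B. mdvd b u" by auto
  have "\<forall>b\<in>B. \<exists>g. g \<in> J \<and> g \<noteq> 0 \<and> lead_mon ord g = b" using B(2) by (auto simp: leads_def)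
  then obtain g where g: "\<And>b. b \<in> B \<Longrightarrow> g b \<in> J \<and> g b \<noteq> 0 \<and> lead_mon ord (g b) = b" by metis
  have kg: "keys (g b) \<subseteq> mons_in ?S" if "b \<in> B" for b using ideal_carrier[OF J] g[OF that] by blast
  have "?S \<subseteq> {1..c} \<times> {1..}" by auto
  moreover have "g' \<noteq> 0 \<and> keys g' \<subseteq> mons_in ?S" if g': "g' \<in> g ` B" for g'
  proof -
    obtain b where "g' = g b" "b \<in> B" using g' by (rule imageE)
    then show ?thesis using g[of b] kg[of b] by simp
  qed
  ultimately obtain \<omega> where \<omega>1: "\<forall>x\<in>?S. 0 < \<omega> x"
    and \<omega>2: "\<forall>g'\<in>g ` B. \<forall>v\<in>keys g'. weight ?S \<omega> v \<le> weight ?S \<omega> (lead_mon ord g')"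
    using weight_exists[OF ord, of ?S "g ` B"] B(1) by auto
  have \<omega>: "weight ?S \<omega> v \<le> weight ?S \<omega> b" if "b \<in> B" "v \<in> keys (g b)" for b v
    using \<omega>2 that g[OF that(1)] by force
  have "\<exists>h. h \<in> J \<and> h \<noteq> 0 \<and> lead_mon ord h = t \<and> (\<forall>v\<in>keys h. weight ?S \<omega> v \<le> weight ?S \<omega> t)"
    if t: "t \<in> leads ord J" for t
  proof -
    obtain b where b: "b \<in> B" "mdvd b t" using basis[OF t] by blast
    have tm: "t - b \<in> mons_in ?S" by (rule mons_in_diff[OF upset_mons[OF L t]])
    let ?h = "to_poly (t - b) * g b"
    have tb: "t - b + b = t" using mdvd_diff[OF b(2)] by (simp add: add.commute)
    have "keys (g b) \<subseteq> mons c" using kg[OF b(1)] mons_in_vars_mons by blast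
    then have "lead_mon ord ?h = t"
      using lead_mon_single_times[OF ord, of "g b" "t - b"] g[OF b(1)] tm mons_in_vars_mons tb by auto
    moreover have "?h \<in> J" by (rule ideal_times[OF J]) (use g[OF b(1)] tm in auto)
    moreover have "to_poly (t - b) \<noteq> (0 :: 'k mpoly)"
      by (metis keys_single keys_zero insert_not_empty one_neq_zero)
    then have "?h \<noteq> 0" using g[OF b(1)] by simp
    moreover have "weight ?S \<omega> v \<le> weight ?S \<omega> t" if v: "v \<in> keys ?h" for v
    proof -
      obtain u where u: "v = t - b + u" "u \<in> keys (g b)" using v by (auto simp: keys_single_times)
      have "weight ?S \<omega> v \<le> weight ?S \<omega> (t - b) + weight ?S \<omega> b"
        using \<omega>[OF b(1) u(2)] by (simp add: u(1) weight_add)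
      also have "\<dots> = weight ?S \<omega> t" unfolding weight_add[symmetric] tb ..
      finally show ?thesis .
    qed
    ultimately show ?thesis by blast
  qed
  then have "\<forall>t\<in>leads ord J. \<exists>h. h \<in> J \<and> h \<noteq> 0 \<and> lead_mon ord h = t \<and>
      (\<forall>v\<in>keys h. weight ?S \<omega> v \<le> weight ?S \<omega> t)" by blast
  from bchoice[OF this] show ?thesis using \<omega>1 by blast
qed

text \<open>Comparing, for a suitable weight, the monomials of bounded weight in the variables \<open>V\<close> with
  the standard monomials: the former are linearly independent modulo \<open>J\<close>.\<close>

theorem independent_set_transfer:
  fixes J :: "'k::field mpoly set"
  assumes ord: "monomial_order c ord" and J: "ideal J (poly_ring (vars c n))"
    and V: "V \<subseteq> vars c n" "\<And>f. f \<in> J \<Longrightarrow> keys f \<subseteq> mons_in V \<Longrightarrow> f = 0"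
  shows "\<exists>U\<subseteq>vars c n. card V \<le> card U \<and> (\<forall>u\<in>leads ord J. \<not> keys u \<subseteq> U)"
proof (rule ccontr)
  assume neg: "\<not> ?thesis"
  let ?S = "vars c n" and ?d = "card V" and ?L = "leads ord J"
  have S: "finite ?S" by simp
  have finV: "finite V" using V(1) S finite_subset by blast
  have L: "upset ?S ?L" by (rule upset_leads[OF ord J])
  have "card U < ?d" if "U \<subseteq> ?S" "\<And>u. u \<in> ?L \<Longrightarrow> \<not> keys u \<subseteq> U" for U
    using neg that by (meson not_less)
  from card_standard_monomials[OF S L this] obtain N where
    N: "\<And>E. card {u \<in> mons_in ?S - ?L. \<forall>x\<in>?S. lookup u x \<le> E} \<le> N * Suc E ^ (?d - 1)" by blast
  \<comment> \<open>If \<open>V\<close> were empty, \<open>U = {}\<close> would do: a leading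
    monomial 1 would give a nonzero constant in \<open>J\<close>, against the independence of
    \<open>V\<close>.\<close>
  have d: "0 < ?d"
  proof -
    have "\<not> keys u \<subseteq> {}" if "u \<in> ?L" for u
    proof
      assume "keys u \<subseteq> {}"
      then have "u = 0" by simp
      then have "0 \<in> ?L" using that by simp
      obtain f where f: "f \<in> J" "f \<noteq> 0" "lead_mon ord f = 0" using \<open>0 \<in> ?L\<close> by (auto simp: leads_def)
      have "keys f \<subseteq> mons c" using ideal_carrier[OF J f(1)] mons_in_vars_mons by blast
      from lead_mon_eq_0[OF ord this f(2,3)]
      have "keys f \<subseteq> {0}" .
      then have "keys f \<subseteq> mons_in V" by (rule order_trans) simp
      then show False using V(2) f by blast
    qed
    then have "\<forall>u\<in>?L. \<not> keys u \<subseteq> {}" by blast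
    then show ?thesis using neg by (metis card.empty empty_subsetI le_zero_eq neq0_conv order_refl)
  qed
  obtain \<omega> f where \<omega>: "\<forall>x\<in>?S. 0 < \<omega> x" and f: "\<And>t. t \<in> ?L \<Longrightarrow> f t \<in> J \<and> f t \<noteq> 0 \<and>
      lead_mon ord (f t) = t \<and> (\<forall>v\<in>keys (f t). weight ?S \<omega> v \<le> weight ?S \<omega> t)"
    using weighted_division[OF ord J] by blast
  define \<Omega> where "\<Omega> = (\<Sum>x\<in>?S. \<omega> x)"
  \<comment> \<open>Chosen so that weight at most \<open>q * \<Omega>\<close> forces all exponents
    to be at most \<open>q * b\<close>, whereas exponents at most q keep the weight within
    \<open>q * \<Omega>\<close>.\<close>
  define b where "b = (\<Sum>x\<in>?S. nat \<lceil>\<Omega> / \<omega> x\<rceil>)"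
  have b: "\<Omega> \<le> real b * \<omega> x" if "x \<in> ?S" for x
  proof -
    have "nat \<lceil>\<Omega> / \<omega> x\<rceil> \<le> b" unfolding b_def by (rule member_le_sum[OF that]) auto
    then have "\<Omega> / \<omega> x \<le> real b" by linarith
    moreover have "0 < \<omega> x" using \<omega> that by (rule bspec)
    ultimately show ?thesis by (simp only: pos_divide_le_eq)
  qed
  \<comment> \<open>Makes \<open>N * (q b + 1) ^ (d - 1)\<close> at most
    \<open>q * (q + 1) ^ (d - 1)\<close>, which is less than \<open>(q + 1) ^ d\<close>, the number
    of monomials in \<open>MV\<close>.\<close>
  define q where "q = N * Suc b ^ (?d - 1)"
  define W where "W = {u \<in> mons_in ?S. weight ?S \<omega> u \<le> real q * \<Omega>}"
  have Wbox: "lookup u x \<le> q * b" if "u \<in> W" "x \<in> ?S" for u x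
  proof -
    have "\<omega> x * real (lookup u x) \<le> weight ?S \<omega> u"
      unfolding weight_def by (rule member_le_sum[OF that(2)]) (use bspec[OF \<omega>] in \<open>simp_all add: less_imp_le\<close>)
    also have "\<dots> \<le> real q * \<Omega>" using that(1) by (simp add: W_def)
    also have "\<dots> \<le> real q * (real b * \<omega> x)" using b[OF that(2)] by (intro mult_left_mono) auto
    finally have "\<omega> x * real (lookup u x) \<le> \<omega> x * real (q * b)" by (simp add: mult_ac)
    then have "real (lookup u x) \<le> real (q * b)" using \<omega> that(2) by (simp only: mult_le_cancel_left_pos)
    then show ?thesis by linarith
  qed
  then have "W \<subseteq> {u \<in> mons_in ?S. \<forall>x\<in>?S. lookup u x \<le> q * b}" by (auto simp: W_def)
  then have finW: "finite W" by (rule finite_subset) (rule card_mons_box(1)[OF S])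
  define MV where "MV = {u \<in> mons_in V. \<forall>x\<in>V. lookup u x \<le> q}"
  have finMV: "finite MV" and cardMV: "card MV = Suc q ^ ?d"
    unfolding MV_def using card_mons_box[OF finV, of "\<lambda>_. q"] by simp_all
  have MVW: "MV \<subseteq> W"
  proof
    fix u assume u: "u \<in> MV"
    have "weight ?S \<omega> u \<le> (\<Sum>x\<in>?S. \<omega> x * real q)"
      unfolding weight_def
    proof (rule sum_mono)
      fix x assume x: "x \<in> ?S"
      have "lookup u x \<le> q"
      proof (cases "x \<in> V")
        case False
        then have "x \<notin> keys u" using u by (auto simp: MV_def mons_in_def)
        then show ?thesis by (simp add: in_keys_iff)
      qed (use u in \<open>simp add: MV_def\<close>)
      then show "\<omega> x * real (lookup u x) \<le> \<omega> x * real q"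
        using \<omega> x by (intro mult_left_mono) (auto intro: less_imp_le)
    qed
    also have "\<dots> = real q * \<Omega>" by (simp add: \<Omega>_def sum_distrib_right mult.commute flip: sum_distrib_left)
    finally show "u \<in> W" using u V(1) mons_in_mono by (auto simp: W_def MV_def)
  qed
  have "card (W - ?L) \<le> card {u \<in> mons_in ?S - ?L. \<forall>x\<in>?S. lookup u x \<le> q * b}"
  proof (rule card_mono)
    show "finite {u \<in> mons_in ?S - ?L. \<forall>x\<in>?S. lookup u x \<le> q * b}"
      by (rule finite_subset[OF _ card_mons_box(1)[OF S, of "\<lambda>_. q * b"]]) auto
    show "W - ?L \<subseteq> {u \<in> mons_in ?S - ?L. \<forall>x\<in>?S. lookup u x \<le> q * b}"
      using Wbox by (auto simp: W_def)
  qed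
  also have "\<dots> \<le> N * Suc (q * b) ^ (?d - 1)" by (rule N)
  also have "\<dots> \<le> N * (Suc q * Suc b) ^ (?d - 1)" by (intro mult_left_mono power_mono) auto
  also have "\<dots> = q * Suc q ^ (?d - 1)" by (simp only: q_def power_mult_distrib mult_ac)
  also have "\<dots> < Suc q * Suc q ^ (?d - 1)" by simp
  also have "\<dots> = card MV" unfolding cardMV using d by (metis Suc_diff_1 power_Suc)
  finally have lt: "card (W - ?L) < card MV" .
  \<comment> \<open>One unknown for each monomial in \<open>MV\<close> and one for each f t with t
    in \<open>W \<inter> ?L\<close>. All these polynomials have their monomials in \<open>W\<close>,
    and they outnumber \<open>W\<close>. A relation splits into \<open>P1\<close> in the variables
    \<open>V\<close> and \<open>P2\<close> in \<open>J\<close>, so that independence of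
    \<open>V\<close> forces \<open>P1 = 0\<close>.\<close>
  let ?Y = "Inl ` MV \<union> Inr ` (W \<inter> ?L)"
  define p where "p y = (case y of Inl v \<Rightarrow> to_poly v | Inr t \<Rightarrow> f t)" for y :: "mon + mon"
  have "card ?Y = card MV + card (W \<inter> ?L)"
    using finMV finW by (subst card_Un_disjoint) (auto simp: card_image)
  moreover have "card W = card (W - ?L) + card (W \<inter> ?L)"
    using finW by (metis card_Diff_subset_Int card_mono finite_Int inf_le1 le_add_diff_inverse2)
  ultimately have "card W < card ?Y" using lt by simp
  moreover have finY: "finite ?Y" using finMV finW by simp
  ultimately obtain x where x: "\<exists>y\<in>?Y. x y \<noteq> 0" "\<forall>u\<in>W. (\<Sum>y\<in>?Y. lookup (p y) u * x y) = 0"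
    using underdetermined_system[OF finW finY, of "\<lambda>u y. lookup (p y) u"] by blast
  have kp: "keys (p y) \<subseteq> W" if "y \<in> ?Y" for y
  proof (cases y)
    case (Inl v)
    then show ?thesis using that MVW by (auto simp: p_def)
  next
    case (Inr t)
    then have t: "t \<in> ?L" "t \<in> W" using that by auto
    have "keys (f t) \<subseteq> mons_in ?S" using ideal_carrier[OF J] f[OF t(1)] by blast
    then show ?thesis using f[OF t(1)] t(2) Inr by (fastforce simp: p_def W_def)
  qed
  have zero: "(\<Sum>y\<in>?Y. lookup (p y) u * x y) = 0" for u
  proof (cases "u \<in> W")
    case False
    then have "lookup (p y) u = 0" if "y \<in> ?Y" for y using kp[OF that] by (auto simp: in_keys_iff)
    then show ?thesis by simp
  qed (use x(2) in blast)
  define P1 where "P1 = (\<Sum>v\<in>MV. single v (x (Inl v)))"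
  define P2 where "P2 = (\<Sum>t\<in>W \<inter> ?L. single 0 (x (Inr t)) * f t)"
  have l1: "lookup P1 u = (\<Sum>v\<in>MV. lookup (p (Inl v)) u * x (Inl v))" for u
    unfolding P1_def lookup_sum by (rule sum.cong) (auto simp: p_def lookup_single when_def)
  have l2: "lookup P2 u = (\<Sum>t\<in>W \<inter> ?L. lookup (p (Inr t)) u * x (Inr t))" for u
    unfolding P2_def lookup_sum using lookup_single_times_add[of 0 _ _ u]
    by (intro sum.cong) (auto simp: p_def mult.commute)
  have sum0: "P1 + P2 = 0"
  proof (rule poly_mapping_eqI)
    fix u
    have "(\<Sum>y\<in>?Y. lookup (p y) u * x y) = (\<Sum>y\<in>Inl ` MV. lookup (p y) u * x y)
        + (\<Sum>y\<in>Inr ` (W \<inter> ?L). lookup (p y) u * x y)"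
      by (rule sum.union_disjoint) (use finMV finW in auto)
    also have "\<dots> = lookup P1 u + lookup P2 u" by (simp add: l1 l2 sum.reindex)
    finally show "lookup (P1 + P2) u = lookup 0 u" using zero[of u] by (simp add: lookup_add)
  qed
  have "P2 \<in> J"
    unfolding P2_def
    by (rule ideal_sum[OF J], rule ideal_times[OF J]) (use f in simp_all)
  then have "single 0 (- 1) * P2 \<in> J" by (rule ideal_times[OF J]) simp
  moreover have "single 0 (- 1) * P2 = P1"
    using minus_unique[of P2 P1] sum0 by (simp add: single_uminus add.commute)
  moreover have "keys P1 \<subseteq> mons_in V"
    unfolding P1_def by (rule order_trans[OF keys_sum_subset]) (auto simp: MV_def)
  ultimately have P1: "P1 = 0" using V(2) by simp
  have x1: "x (Inl v) = 0" if "v \<in> MV" for v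
  proof -
    have "lookup P1 v = (\<Sum>v'\<in>MV. if v' = v then x (Inl v) else 0)"
      unfolding P1_def lookup_sum by (rule sum.cong) (auto simp: lookup_single when_def)
    also have "\<dots> = x (Inl v)" using that finMV by simp
    finally show ?thesis by (simp add: P1)
  qed
  have P2: "P2 = 0" using sum0 P1 by simp
  let ?T = "{t \<in> W \<inter> ?L. x (Inr t) \<noteq> 0}"
  have "?T \<noteq> {}" using x(1) x1 by auto
  moreover have "?T \<subseteq> mons c" using mons_in_vars_mons by (auto simp: W_def)
  \<comment> \<open>What remains is a non-trivial combination of polynomials with different leading
    monomials, the largest of which cannot cancel.\<close>
  ultimately obtain t where t: "t \<in> ?T" "\<forall>s\<in>?T. (s, t) \<in> ord"
    using ord_max[OF ord, of ?T] finW by auto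
  have kc: "keys (f s) \<subseteq> mons c" if "s \<in> ?L" for s
    using ideal_carrier[OF J] f[OF that] mons_in_vars_mons by blast
  have "lookup P2 t = (\<Sum>s\<in>W \<inter> ?L. if s = t then x (Inr t) * lookup (f t) t else 0)"
    unfolding P2_def lookup_sum
  proof (rule sum.cong)
    fix s assume s: "s \<in> W \<inter> ?L"
    show "lookup (single 0 (x (Inr s)) * f s) t = (if s = t then x (Inr t) * lookup (f t) t else 0)"
    proof (cases "s = t \<or> x (Inr s) = 0")
      case True
      then show ?thesis using lookup_single_times_add[of 0 "x (Inr s)" "f s" t] by auto
    next
      case False
      have "t \<notin> keys (f s)"
      proof
        assume "t \<in> keys (f s)"
        then have "(t, s) \<in> ord" using lead_mon(2)[OF ord kc, of s t] f[of s] s by auto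
        moreover have "(s, t) \<in> ord" using t(2) s False by blast
        ultimately show False using ord_antisym[OF ord] False by blast
      qed
      then show ?thesis
        using False lookup_single_times_add[of 0 "x (Inr s)" "f s" t] by (simp add: in_keys_iff)
    qed
  qed simp
  also have "\<dots> = x (Inr t) * lookup (f t) t" using t(1) finW by simp
  finally have "lookup (f t) t = 0" using t(1) P2 by simp
  moreover have "t \<in> keys (f t)" using lead_mon(1)[OF ord kc, of t] f[of t] t(1) by auto
  ultimately show False by (simp add: in_keys_iff)
qed


section \<open>Comparison of the invariants\<close>

text \<open>The rows outside \<open>C1\<close>, in the columns after i, are independent modulo
  \<open>I n\<close>, since a polynomial in these variables would have its
  \<open>ord1\<close>-leading monomial there. \<open>independent_set_transfer\<close> turns them
  into an equally large set for \<open>ord2\<close>, whose size grows at most like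
  \<open>(c - card C2) * n\<close>.\<close>

lemma min_cover_leads_le:
  fixes I :: "nat \<Rightarrow> 'k::field mpoly set"
  assumes I: "inc_invariant_chain c i I"
    and ord1: "monomial_order c ord1" and ord2: "monomial_order c ord2" "respects_Inc c i ord2"
    and C1: "min_cover c i (\<lambda>n. leads ord1 (I n)) C1" and C2: "min_cover c i (\<lambda>n. leads ord2 (I n)) C2"
  shows "card C2 \<le> card C1"
proof -
  obtain B where "\<forall>n\<ge>1. \<forall>U\<subseteq>vars c n. (\<forall>u\<in>leads ord2 (I n). \<not> keys u \<subseteq> U) \<longrightarrow>
      card U + card C2 * n \<le> c * n + B"
    using card_independent_le[OF mchain_leads[OF ord2 I] C2] by (rule exE)
  then have B: "card U + card C2 * n \<le> c * n + B"
    if "1 \<le> n" "U \<subseteq> vars c n" "\<And>u. u \<in> leads ord2 (I n) \<Longrightarrow> \<not> keys u \<subseteq> U" for n U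
    using that by simp
  have C1c: "C1 \<subseteq> {1..c}" "free i (\<lambda>n. leads ord1 (I n)) ({1..c} - C1)"
    using C1 by (auto simp: min_cover_def)
  have g1: "card C1 \<le> c" using card_mono[OF _ C1c(1)] by simp
  \<comment> \<open>Large enough for a difference of slopes to exceed the error
    \<open>c * i + B\<close>; the summand i keeps \<open>n - i\<close> from being truncated.\<close>
  define n where "n = Suc (i + c * i + B)"
  have n: "1 \<le> n" by (simp add: n_def)
  have J: "ideal (I n) (poly_ring (vars c n))"
    using I n by (simp add: inc_invariant_chain_def R_fin_poly_ring)
  let ?V = "({1..c} - C1) \<times> {Suc i..n}"
  have V: "?V \<subseteq> vars c n" by auto
  have "f = 0" if f: "f \<in> I n" "keys f \<subseteq> mons_in ?V" for f
  proof (rule ccontr)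
    assume "f \<noteq> 0"
    have "keys f \<subseteq> mons c" using ideal_carrier[OF J f(1)] mons_in_vars_mons by blast
    then have "lead_mon ord1 f \<in> mons_in ?V"
      using lead_mon(1)[OF ord1 _ \<open>f \<noteq> 0\<close>] f(2) by blast
    then have "keys (lead_mon ord1 f) \<subseteq> ({1..c} - C1) \<times> {i<..}" by (auto simp: mons_in_def)
    moreover have "lead_mon ord1 f \<in> leads ord1 (I n)" using f(1) \<open>f \<noteq> 0\<close> by (auto simp: leads_def)
    ultimately show False using C1c(2) n unfolding free_def by blast
  qed
  from independent_set_transfer[OF ord2(1) J V this]
  obtain U where U: "U \<subseteq> vars c n" "card ?V \<le> card U" "\<And>u. u \<in> leads ord2 (I n) \<Longrightarrow> \<not> keys u \<subseteq> U"
    by blast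
  have "card ?V = (c - card C1) * (n - i)"
    using C1c(1) by (simp add: card_cartesian_product card_Diff_subset finite_subset)
  then have le: "(c - card C1) * (n - i) + card C2 * n \<le> c * n + B"
    using B[OF n U(1,3)] U(2) by linarith
  show ?thesis
  proof (rule ccontr)
    assume "\<not> ?thesis"
    then have "Suc (card C1) * n \<le> card C2 * n" by (intro mult_right_mono) auto
    moreover have "c * n \<le> (c - card C1) * (n - i) + card C1 * n + c * i"
    proof -
      have "c * n = (c - card C1) * n + card C1 * n" using g1 by (simp flip: add_mult_distrib)
      also have "n = (n - i) + i" by (simp add: n_def)
      then have "(c - card C1) * n = (c - card C1) * (n - i) + (c - card C1) * i"
        by (metis add_mult_distrib2)
      also have "(c - card C1) * i \<le> c * i" by simp
      finally show ?thesis by simp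
    qed
    ultimately have "n \<le> c * i + B" using le by simp
    then show False by (simp add: n_def)
  qed
qed

lemma gamma_chain_eq:
  fixes I :: "nat \<Rightarrow> 'k::field mpoly set"
  assumes I: "inc_invariant_chain c i I" "\<forall>n\<ge>1. I n \<noteq> carrier (R_fin c n)"
    and ord: "monomial_order c ord" "respects_Inc c i ord"
  shows "gamma_chain c i I = gamma_mon_chain c i (initial_chain c ord I)"
proof -
  have ex: "\<exists>C. min_cover c i (\<lambda>n. leads ord (I n)) C \<and>
      gamma_mon_chain c i (initial_chain c ord I) = enat (card C)"
    if ord: "monomial_order c ord" "respects_Inc c i ord" for ord
  proof (rule gamma_mon_chain_eq)
    show "mchain c i (\<lambda>n. leads ord (I n))" by (rule mchain_leads[OF ord I(1)])
    show "proper (\<lambda>n. leads ord (I n))" by (rule proper_leads[OF ord(1) I])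
    show "initial_chain c ord I n = polys (leads ord (I n))" if "1 \<le> n" for n
      by (rule initial_chain_eq[OF ord(1)])
        (use I(1) that in \<open>simp add: inc_invariant_chain_def R_fin_poly_ring\<close>)
  qed
  have eq: "gamma_mon_chain c i (initial_chain c ord' I) = gamma_mon_chain c i (initial_chain c ord I)"
    if ord': "monomial_order c ord'" "respects_Inc c i ord'" for ord'
  proof -
    obtain C where C: "min_cover c i (\<lambda>n. leads ord (I n)) C"
      "gamma_mon_chain c i (initial_chain c ord I) = enat (card C)" using ex[OF ord] by blast
    obtain C' where C': "min_cover c i (\<lambda>n. leads ord' (I n)) C'"
      "gamma_mon_chain c i (initial_chain c ord' I) = enat (card C')" using ex[OF ord'] by blast
    show ?thesis
      using min_cover_leads_le[OF I(1) ord(1) ord' C(1) C'(1)]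
        min_cover_leads_le[OF I(1) ord'(1) ord C'(1) C(1)] C(2) C'(2) by simp
  qed
  show ?thesis
    unfolding gamma_chain_def
  proof (rule the_equality)
    show "\<forall>ord'. monomial_order c ord' \<and> respects_Inc c i ord' \<longrightarrow>
        gamma_mon_chain c i (initial_chain c ord' I) = gamma_mon_chain c i (initial_chain c ord I)"
      using eq by blast
    show "g = gamma_mon_chain c i (initial_chain c ord I)"
      if "\<forall>ord'. monomial_order c ord' \<and> respects_Inc c i ord' \<longrightarrow>
        gamma_mon_chain c i (initial_chain c ord' I) = g" for g
      using that ord by blast
  qed
qed

text \<open>\<open>V\<close> generates an associated prime of \<open>L\<close> that contains \<open>(L : w1)\<close>.\<close>

lemma associated_prime_exists:
  assumes S: "finite S" and L: "upset S L" and w1: "w1 \<in> mons_in S" "w1 \<notin> L"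
  shows "\<exists>w V. V \<subseteq> S \<and> w \<in> mons_in S \<and> w \<notin> L \<and> (\<forall>y\<in>V. single y 1 + w \<in> L) \<and>
    (\<forall>u. keys u \<subseteq> S - V \<longrightarrow> w1 + u \<notin> L)"
proof -
  \<comment> \<open>The complement of a largest such \<open>U\<close> generates a prime over (L :
    w1) of least codimension among those generated by variables.\<close>
  let ?P = "\<lambda>U. U \<subseteq> S \<and> (\<forall>u\<in>mons_in U. w1 + u \<notin> L)"
  have "?P {}" using w1(2) by (auto simp: mons_in_def)
  moreover have "\<forall>U. ?P U \<longrightarrow> card U \<le> card S" using S card_mono by blast
  ultimately have "\<exists>U. ?P U \<and> (\<forall>U'. ?P U' \<longrightarrow> card U' \<le> card U)"
    by (intro ex_has_greatest_nat[of ?P "{}" card "Suc (card S)"]) (simp_all add: less_Suc_eq_le)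
  then obtain U where "?P U \<and> (\<forall>U'. ?P U' \<longrightarrow> card U' \<le> card U)"
    by (rule exE)
  then have U: "?P U" and maxU: "\<forall>U'. ?P U' \<longrightarrow> card U' \<le> card U"
    by (rule conjunct1, rule conjunct2)
  have finU: "finite U" using U S finite_subset by blast
  let ?V = "S - U"
  have Umons: "u \<in> mons_in S" if "u \<in> mons_in U" for u using that U mons_in_mono by blast
  have "\<exists>u\<in>mons_in (insert y U). w1 + u \<in> L" if y: "y \<in> ?V" for y
  proof (rule ccontr)
    assume "\<not> ?thesis"
    then have "?P (insert y U)" using U y by blast
    from maxU[rule_format, OF this] show False using y finU by simp
  qed
  then obtain h where h: "\<And>y. y \<in> ?V \<Longrightarrow> h y \<in> mons_in (insert y U) \<and> w1 + h y \<in> L" by metis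
  \<comment> \<open>The monomials in \<open>?V\<close> that stay outside (L : w1) when the variables
    in \<open>U\<close> are inverted. By \<open>bound\<close> they are finitely many, and one of
    largest degree is a socle element: every variable in \<open>?V\<close> sends it into the ideal
    after inversion.\<close>
  let ?Z = "{z \<in> mons_in ?V. \<forall>u\<in>mons_in U. w1 + z + u \<notin> L}"
  have bound: "lookup z y \<le> lookup (h y) y" if z: "z \<in> ?Z" and y: "y \<in> ?V" for z y
  proof (rule ccontr)
    assume "\<not> lookup z y \<le> lookup (h y) y"
    then have gt: "lookup (h y) y < lookup z y" by simp
    let ?u = "h y - single y (lookup (h y) y)"
    have lu: "lookup ?u x = (if x = y then 0 else lookup (h y) x)" for x
      by (simp add: lookup_minus lookup_single when_def)
    have "x \<in> U" if x: "x \<in> keys ?u" for x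
    proof -
      have "x \<noteq> y" "x \<in> keys (h y)" using x by (simp_all add: in_keys_iff lu split: if_splits)
      then show ?thesis using h[OF y] by (auto simp: mons_in_def)
    qed
    then have u: "?u \<in> mons_in U" by (auto simp: mons_in_def)
    have "mdvd (h y) (z + ?u)"
      unfolding mdvd_def
    proof
      fix x show "lookup (h y) x \<le> lookup (z + ?u) x" using gt by (simp add: lookup_add lu)
    qed
    then have dvd: "mdvd (w1 + h y) (w1 + (z + ?u))" by (intro mdvd_add_mono) simp_all
    have "w1 + (z + ?u) \<in> mons_in S" using w1(1) Umons[OF u] z mons_in_mono[of z ?V S] by auto
    from upsetD[OF L _ this dvd] have "w1 + z + ?u \<in> L" using h[OF y] by (simp add: add.assoc)
    then show False using z u by blast
  qed
  have "?Z \<subseteq> {z \<in> mons_in ?V. \<forall>x\<in>?V. lookup z x \<le> lookup (h x) x}" using bound by blast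
  moreover have "finite {z \<in> mons_in ?V. \<forall>x\<in>?V. lookup z x \<le> lookup (h x) x}"
    by (rule card_mons_box(1)) (use S in simp)
  ultimately have finZ: "finite ?Z" by (rule finite_subset)
  have "0 \<in> ?Z" using U by simp
  moreover have "\<forall>z. z \<in> ?Z \<longrightarrow> mdeg z < Suc (Max (mdeg ` ?Z))"
    using finZ by (auto simp only: less_Suc_eq_le intro!: Max_ge)
  ultimately have "\<exists>z. z \<in> ?Z \<and> (\<forall>z'. z' \<in> ?Z \<longrightarrow> mdeg z' \<le> mdeg z)"
    by (rule ex_has_greatest_nat)
  then obtain z where z: "z \<in> ?Z" and maxZ: "\<forall>z'. z' \<in> ?Z \<longrightarrow> mdeg z' \<le> mdeg z"
    by (elim exE conjE)
  have "\<exists>u\<in>mons_in U. w1 + (z + single y 1) + u \<in> L" if y: "y \<in> ?V" for y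
  proof (rule ccontr)
    assume "\<not> ?thesis"
    moreover have "z + single y 1 \<in> mons_in ?V" using z y by (auto intro: mons_in_singleI)
    ultimately have "z + single y 1 \<in> ?Z" by blast
    from maxZ[rule_format, OF this] have "mdeg (single y 1) = 0" by (simp add: mdeg_add)
    then show False by (metis lookup_single_eq lookup_zero mdeg_eq_0 one_neq_zero)
  qed
  then obtain k where k: "\<And>y. y \<in> ?V \<Longrightarrow> k y \<in> mons_in U \<and> w1 + (z + single y 1) + k y \<in> L" by metis
  \<comment> \<open>A common denominator: multiplying by s serves all y in \<open>?V\<close> at
    once, and as a monomial in \<open>U\<close> it keeps \<open>w1 + z\<close> outside
    \<open>L\<close>.\<close>
  define s where "s = (\<Sum>y\<in>?V. k y)"
  have sU: "s \<in> mons_in U"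
  proof -
    have "keys s \<subseteq> (\<Union>y\<in>?V. keys (k y))" unfolding s_def by (rule keys_sum_subset)
    also have "\<dots> \<subseteq> U"
    proof (rule UN_least)
      show "keys (k y) \<subseteq> U" if "y \<in> ?V" for y using k[OF that] by (simp add: mons_in_def)
    qed
    finally show ?thesis by (simp add: mons_in_def)
  qed
  have zS: "z \<in> mons_in S" using z mons_in_mono[of z ?V S] by blast
  have "w1 + z + s \<notin> L" using z sU by blast
  moreover have wS: "w1 + z + s \<in> mons_in S" using w1(1) zS Umons[OF sU] by simp
  moreover have "single y 1 + (w1 + z + s) \<in> L" if y: "y \<in> ?V" for y
  proof (rule upsetD[OF L])
    show "w1 + (z + single y 1) + k y \<in> L" using k[OF y] by blast
    show "single y 1 + (w1 + z + s) \<in> mons_in S" using wS y by (auto intro: mons_in_singleI)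
    have "s = k y + (\<Sum>y\<in>?V - {y}. k y)" unfolding s_def by (rule sum.remove) (use S y in auto)
    then show "mdvd (w1 + (z + single y 1) + k y) (single y 1 + (w1 + z + s))"
      by (simp add: mdvd_def lookup_add)
  qed
  moreover have "w1 + u \<notin> L" if "keys u \<subseteq> S - ?V" for u
    using that U by (auto simp: mons_in_def)
  ultimately show ?thesis
    by (intro exI[of _ "w1 + z + s"] exI[of _ ?V]) blast
qed

text \<open>By unmixedness the associated prime \<open>V\<close> over the colon by \<open>?W\<close>
  has no more variables than \<open>?V0\<close>, about \<open>card C * n\<close>. Its complement,
  less the columns of the colon steps, is independent for the iterated chain, so it has at most
  about \<open>(c - card C') * n\<close> variables.\<close>

lemma min_cover_iter_le:
  assumes L: "mchain c i L"
    and CM: "\<forall>\<^sub>F n in sequentially. cohen_macaulay (poly_ring (vars c n) Quot (polys (L n) :: 'k::field mpoly set))"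
    and C: "min_cover c i L C"
    and pr: "proper (iter_mons c i L es)" and C': "min_cover c (i + length es) (iter_mons c i L es) C'"
  shows "card C' \<le> card C"
proof (rule ccontr)
  assume neg: "\<not> ?thesis"
  let ?k = "length es" and ?M = "iter_mons c i L es" and ?W = "iter_mon c i es"
  obtain B where "\<forall>n\<ge>1. \<forall>U\<subseteq>vars c n. (\<forall>u\<in>?M n. \<not> keys u \<subseteq> U) \<longrightarrow>
      card U + card C' * n \<le> c * n + B"
    using card_independent_le[OF mchain_iter_mons[OF L] C'] by (rule exE)
  then have B: "card U + card C' * n \<le> c * n + B"
    if "1 \<le> n" "U \<subseteq> vars c n" "\<And>u. u \<in> ?M n \<Longrightarrow> \<not> keys u \<subseteq> U" for n U
    using that by simp
  obtain n0 where n0: "\<And>n. n0 \<le> n \<Longrightarrow> cohen_macaulay (poly_ring (vars c n) Quot (polys (L n) :: 'k mpoly set))"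
    using CM unfolding eventually_sequentially by blast
  \<comment> \<open>Beyond \<open>n0\<close> the quotient is Cohen-Macaulay, and n exceeds the total
    error: \<open>c * i\<close> for the fixed columns, \<open>c * ?k\<close> for those of the colon
    steps, and \<open>B\<close>.\<close>
  define n where "n = Suc (n0 + i + ?k + c * i + c * ?k + B)"
  have n: "1 \<le> n" "n0 \<le> n" "i + ?k \<le> n" by (simp_all add: n_def)
  let ?S = "vars c n"
  have up: "upset ?S (L n)" by (rule mchain_upset[OF L n(1)])
  have W: "?W \<in> mons_in ?S" using keys_iter_mon[of c i es] n(3) by (fastforce simp: mons_in_def)
  have "0 \<notin> ?M n" using pr n(1) by (simp add: proper_def)
  then have WL: "?W \<notin> L n" using iter_mons_iff[OF L n(1), of 0 es] mdvd_refl[of ?W] by auto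
  have S: "finite ?S" by simp
  from associated_prime_exists[OF S up W WL]
  obtain w V where V: "V \<subseteq> ?S" "w \<in> mons_in ?S" "w \<notin> L n" "\<And>y. y \<in> V \<Longrightarrow> single y 1 + w \<in> L n"
    "\<And>u. keys u \<subseteq> ?S - V \<Longrightarrow> ?W + u \<notin> L n" by blast
  \<comment> \<open>Generates a prime containing \<open>L n\<close>: a monomial avoiding the first i
    columns must meet a row in \<open>C\<close>, because the other rows are free.\<close>
  let ?V0 = "C \<times> {1..n} \<union> {1..c} \<times> {1..i}"
  have Cc: "C \<subseteq> {1..c}" and free: "free i L ({1..c} - C)" using C by (auto simp: min_cover_def)
  have V0S: "?V0 \<subseteq> ?S" using Cc n(3) by auto
  have "keys u \<inter> ?V0 \<noteq> {}" if u: "u \<in> L n" for u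
  proof
    assume *: "keys u \<inter> ?V0 = {}"
    have "keys u \<subseteq> ?S" using upset_mons[OF up u] by (simp add: mons_in_def)
    then have "keys u \<subseteq> ({1..c} - C) \<times> {i<..}" using * by fastforce
    then show False using free n(1) u by (auto simp: free_def)
  qed
  from cohen_macaulay_unmixed[OF S up n0[OF n(2)] V(2,3,1,4) V0S this]
  have "card V \<le> card ?V0" .
  also have "\<dots> \<le> card (C \<times> {1..n}) + card ({1..c} \<times> {1..i})" by (rule card_Un_le)
  finally have cardV: "card V \<le> card C * n + c * i" by (simp add: card_cartesian_product)
  let ?cols = "{1..c} \<times> {i<..i + ?k}"
  \<comment> \<open>The variables in \<open>?cols\<close> belong to the iterated ideal and have to
    be left out; without them its monomials are those of the colon by \<open>?W\<close>.\<close>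
  let ?U = "?S - V - ?cols"
  have "\<not> keys u \<subseteq> ?U" if u: "u \<in> ?M n" for u
  proof
    assume *: "keys u \<subseteq> ?U"
    then have uS: "u \<in> mons_in ?S" by (auto simp: mons_in_def)
    have "\<not> (\<exists>k\<in>{1..c}. \<exists>l\<in>{i<..i + ?k}. (k, l) \<in> keys u)" using * by blast
    then obtain v where v: "v \<in> L n" "mdvd v (u + ?W)"
      using iter_mons_iff[OF L n(1) uS, of es] u by blast
    then have "?W + u \<in> L n" using upsetD[OF up v(1) _ v(2)] uS W by (simp add: add.commute)
    moreover have "keys u \<subseteq> ?S - V" using * by blast
    ultimately show False using V(5) by blast
  qed
  moreover have "?U \<subseteq> ?S" by blast
  ultimately have le: "card ?U + card C' * n \<le> c * n + B" using B[OF n(1)] by blast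
  have "card ?S = card V + card (?S - V)"
    using card_mono[OF S V(1)] V(1) S by (simp add: card_Diff_subset finite_subset)
  moreover have "card (?S - V) \<le> card ?U + card ?cols"
    using diff_card_le_card_Diff[of ?cols "?S - V"] by simp
  ultimately have "c * n \<le> card V + card ?U + c * ?k" by (simp add: card_cartesian_product)
  then have "card C' * n \<le> card C * n + c * i + c * ?k + B" using le cardV by linarith
  moreover have "Suc (card C) * n \<le> card C' * n" using neg by (intro mult_right_mono) auto
  ultimately have "n \<le> c * i + c * ?k + B" by simp
  then show False by (simp add: n_def)
qed

text \<open>Skipping column i + 1 moves a monomial supported after column i away from the adjoined
  variables without changing its rows; its image lies in the new chain because the colon is by
  1.\<close>

lemma min_cover_le_zero_step:
  assumes L: "mchain c i L" and C: "min_cover c i L C"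
    and C': "min_cover c (Suc i) (iter_mons c i L [\<lambda>_. 0]) C'"
  shows "card C \<le> card C'"
proof -
  have C'c: "C' \<subseteq> {1..c}" "free (Suc i) (iter_mons c i L [\<lambda>_. 0]) ({1..c} - C')"
    using C' by (auto simp: min_cover_def)
  have "free i L ({1..c} - C')"
    unfolding free_def
  proof (intro allI impI ballI notI)
    fix n u assume n: "1 \<le> n" and u: "u \<in> L n" "keys u \<subseteq> ({1..c} - C') \<times> {i<..}"
    define \<sigma> where "\<sigma> l = (if l \<le> i then l else Suc l)" for l
    have seg: "\<sigma> \<in> Inc_seg i n (Suc n)" by (auto simp: \<sigma>_def Inc_seg_def Inc_def strict_mono_def)
    have v: "act_mon \<sigma> u \<in> L (Suc n)" by (rule mchain_act[OF L n seg u(1)])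
    have "act_mon \<sigma> u \<in> iter_mons c i L [\<lambda>_. 0] (Suc n)"
      using iter_mons_iff[OF L _ upset_mons[OF mchain_upset[OF L] v], of "[\<lambda>_. 0]"] v
      by (auto intro: bexI[OF _ v])
    moreover have "keys (act_mon \<sigma> u) \<subseteq> ({1..c} - C') \<times> {Suc i<..}"
      using u(2) by (auto simp: keys_act_mon[OF Inc_inj[OF Inc_seg_Inc[OF seg]]] \<sigma>_def)
    ultimately show False using C'c(2) by (auto simp: free_def)
  qed
  then show ?thesis using C C'c(1) by (simp add: min_cover_def)
qed

text \<open>This is why \<open>E_set\<close> tests level r + k: if 1 occurs at any level,
  \<open>divisor_in_early_member\<close> produces a divisor of the product of column monomials
  already in \<open>L (r + k)\<close>.\<close>

lemma proper_iter_mons: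
  assumes L: "mchain c i L" and R: "stable c i L R" "R \<le> r"
    and n: "0 \<notin> iter_mons c i L es (r + length es)"
  shows "proper (iter_mons c i L es)"
  unfolding proper_def
proof (intro allI impI notI)
  let ?k = "length es"
  fix m :: nat assume m: "1 \<le> m" "0 \<in> iter_mons c i L es m"
  have R1: "1 \<le> R" using R(1) by (simp add: stable_def)
  obtain v where v: "v \<in> L m" "mdvd v (iter_mon c i es)"
    using iter_mons_iff[OF L m(1), of 0 es] m(2) by auto
  have "keys (iter_mon c i es) \<subseteq> {1..c} \<times> {..i + ?k}" using keys_iter_mon[of c i es] by auto
  from divisor_in_early_member[OF L R(1) this m(1) v]
  obtain u where u: "u \<in> L (R + ?k)" "mdvd u (iter_mon c i es)" by blast
  have "u \<in> L (r + ?k)" using mchain_mono[OF L, of "R + ?k" "r + ?k"] R1 R(2) u(1) by auto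
  then have "0 \<in> iter_mons c i L es (r + ?k)"
    using iter_mons_iff[OF L, of "r + ?k" 0 es] R1 R(2) u(2) by auto
  then show False using n by blast
qed

lemma iter_mon_zero: "iter_mon c j (replicate k (\<lambda>_. 0)) = 0"
  by (induction k arbitrary: j) (simp_all add: column_mon_def)

theorem corollary4p7:
  fixes c i r :: nat and I :: "nat \<Rightarrow> 'k::field mpoly set" and ord :: "mon rel"
  assumes "1 \<le> c"
    and "inc_invariant_chain c i I"
    and "\<forall>n\<ge>1. I n \<noteq> carrier (R_fin c n)"
    and "monomial_order c ord"
    and "respects_Inc c i ord"
    and "\<forall>\<^sub>F n in sequentially. cohen_macaulay (R_fin c n Quot initial_chain c ord I n)"
    and "ind c i (initial_chain c ord I) \<le> r"
  shows "gamma_chain c i I = Gamma c i r (initial_chain c ord I)"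
proof -
  define H where "H = initial_chain c ord I"
  define L where "L n = leads ord (I n)" for n
  have L: "mchain c i L" unfolding L_def by (rule mchain_leads[OF assms(4,5,2)])
  have pr: "proper L" unfolding L_def by (rule proper_leads[OF assms(4,2,3)])
  have H: "H n = polys (L n)" if "1 \<le> n" for n
    unfolding H_def L_def
    by (rule initial_chain_eq[OF assms(4)])
      (use assms(2) that in \<open>simp add: inc_invariant_chain_def R_fin_poly_ring\<close>)
  have CM: "\<forall>\<^sub>F n in sequentially. cohen_macaulay (poly_ring (vars c n) Quot (polys (L n) :: 'k mpoly set))"
    using assms(6) eventually_ge_at_top[of 1]
    by eventually_elim (simp add: H[symmetric] R_fin_poly_ring flip: H_def)
  have R: "stable c i L (ind c i H)"
    using LeastI_ex[OF stable_exists[OF L]] ind_eq_Least[OF L H] by simp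
  have Rr: "ind c i H \<le> r" using assms(7) by (simp add: H_def)
  obtain C where C: "min_cover c i L C" and gH: "gamma_mon_chain c i H = enat (card C)"
    using gamma_mon_chain_eq[OF L pr H] by blast
  have r: "1 \<le> r + k" for k using R Rr by (simp add: stable_def)
  have it: "iter_chain c i H es n = polys (iter_mons c i L es n)" if "1 \<le> n" for es n
    by (rule iter_chain_polys[OF L H that])
  have car: "iter_chain c i H es (r + k) = carrier (R_fin c (r + k)) \<longleftrightarrow> 0 \<in> iter_mons c i L es (r + k)"
    for es k
    unfolding it[OF r] R_fin_poly_ring
    by (rule polys_carrier_iff[OF mchain_upset[OF mchain_iter_mons[OF L] r]])
  have val: "\<exists>C'. min_cover c (i + length es) (iter_mons c i L es) C' \<and>
      gamma_mon_chain c (i + length es) (iter_chain c i H es) = enat (card C') \<and> card C' \<le> card C"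
    if es: "admissible c i r H es" "es \<noteq> []" for es
  proof -
    \<comment> \<open>Admissibility is tested for every prefix; the test for the last vector
      concerns the whole list and gives properness of the iterated chain.\<close>
    let ?l = "length es - 1"
    have l: "?l < length es" "Suc ?l = length es" using es(2) by (cases es; simp)+
    have "es ! ?l \<in> E_set c i r H (take ?l es)" using es(1) l(1) by (simp add: admissible_def)
    moreover have "take ?l es @ [es ! ?l] = es" using l take_Suc_conv_app_nth[OF l(1)] by simp
    moreover have "Suc (length (take ?l es)) = length es" using l by simp
    ultimately have "iter_chain c i H es (r + length es) \<noteq> carrier (R_fin c (r + length es))"
      by (simp only: E_set_def mem_Collect_eq not_False_eq_True)
    then have "0 \<notin> iter_mons c i L es (r + length es)" by (simp add: car)
    then have pr': "proper (iter_mons c i L es)" by (rule proper_iter_mons[OF L R Rr])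
    obtain C' where "min_cover c (i + length es) (iter_mons c i L es) C'"
      "gamma_mon_chain c (i + length es) (iter_chain c i H es) = enat (card C')"
      using gamma_mon_chain_eq[OF mchain_iter_mons[OF L] pr' it] by blast
    then show ?thesis using min_cover_iter_le[OF L CM C pr'] by blast
  qed
  \<comment> \<open>Zero vectors give colons by 1, which keep a proper chain proper; so none of the
    sets under \<open>Max\<close> is empty.\<close>
  have adm0: "admissible c i r H (replicate k (\<lambda>_. 0))" for k
    unfolding admissible_def E_set_def
  proof (intro allI impI, rule CollectI, rule notI)
    fix l assume l: "l < length (replicate k (\<lambda>_::nat. 0::nat))"
    let ?es = "replicate (Suc l) (\<lambda>_::nat. 0::nat)"
    assume eq: "iter_chain c i H (take l (replicate k (\<lambda>_. 0)) @ [replicate k (\<lambda>_. 0) ! l])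
        (r + Suc (length (take l (replicate k (\<lambda>_. 0))))) =
        carrier (R_fin c (r + Suc (length (take l (replicate k (\<lambda>_::nat. 0::nat))))))"
    have "take l (replicate k (\<lambda>_. 0)) @ [replicate k (\<lambda>_. 0) ! l] = ?es"
      using l by (simp add: min_def replicate_append_same)
    then have "iter_chain c i H ?es (r + Suc l) = carrier (R_fin c (r + Suc l))"
      using eq l by (simp add: min_def)
    then have "0 \<in> iter_mons c i L ?es (r + Suc l)" by (simp only: car)
    then obtain v where v: "v \<in> L (r + Suc l)" "mdvd v 0"
      using iter_mons_iff[OF L r, of 0 "Suc l" ?es] iter_mon_zero[of c i "Suc l"] by auto
    then have "v = 0" using mdvd_antisym by simp
    then show False using v(1) pr r[of "Suc l"] by (simp add: proper_def)
  qed
  let ?Vals = "\<lambda>k. {gamma_mon_chain c (i + k) (iter_chain c i H es) | es. length es = k \<and> admissible c i r H es}"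
  \<comment> \<open>The lists \<open>es\<close> may be infinitely many, but \<open>val\<close>
    confines their values to a finite range.\<close>
  have vals: "?Vals k \<subseteq> enat ` {..card C}" if "1 \<le> k" for k
  proof
    fix x assume "x \<in> ?Vals k"
    then obtain es where es: "x = gamma_mon_chain c (i + length es) (iter_chain c i H es)"
      "length es = k" "admissible c i r H es" by blast
    have "es \<noteq> []" using es(2) that by auto
    then show "x \<in> enat ` {..card C}" using val[OF es(3)] es(1) by auto
  qed
  then have fin: "finite (?Vals k)" if "1 \<le> k" for k
    using that finite_subset[of "?Vals k" "enat ` {..card C}"] by simp
  have mem: "gamma_max c i r H k \<in> enat ` {..card C}" if "1 \<le> k" for k
  proof -
    have "?Vals k \<noteq> {}" using adm0[of k] by (auto intro!: exI[of _ "replicate k (\<lambda>_. 0)"])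
    with fin[OF that] have "Max (?Vals k) \<in> ?Vals k" by (rule Max_in)
    then show ?thesis unfolding gamma_max_def using vals[OF that] by blast
  qed
  have low: "enat (card C) \<le> gamma_max c i r H 1"
  proof -
    let ?es = "[\<lambda>_::nat. 0::nat]"
    have adm: "admissible c i r H ?es" using adm0[of 1] by simp
    then obtain C' where C': "min_cover c (i + length ?es) (iter_mons c i L ?es) C'"
      "gamma_mon_chain c (i + length ?es) (iter_chain c i H ?es) = enat (card C')"
      using val[of ?es] by blast
    have "card C \<le> card C'" by (rule min_cover_le_zero_step[OF L C]) (use C'(1) in simp)
    moreover have "gamma_mon_chain c (i + 1) (iter_chain c i H ?es) \<in> ?Vals 1"
      using adm by (intro CollectI exI[of _ ?es]) simp
    then have "gamma_mon_chain c (i + 1) (iter_chain c i H ?es) \<le> gamma_max c i r H 1"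
      unfolding gamma_max_def by (rule Max_ge[OF fin[OF order_refl]])
    ultimately show ?thesis using C'(2) by (auto intro: order_trans[rotated])
  qed
  let ?G = "{gamma_max c i r H k | k. 1 \<le> k}"
  have sub: "?G \<subseteq> enat ` {..card C}" using mem by blast
  have finG: "finite ?G" by (rule finite_subset[OF sub]) simp
  have "gamma_max c i r H 1 \<in> ?G" by blast
  then have "gamma_max c i r H 1 \<le> Max ?G" "Max ?G \<in> ?G" using finG Max_in[OF finG] by (auto intro: Max_ge)
  moreover have "x \<le> enat (card C)" if "x \<in> ?G" for x using subsetD[OF sub that] by auto
  ultimately have "Max ?G = enat (card C)" using low by (meson order_antisym order_trans)
  then have "Gamma c i r H = enat (card C)" by (simp add: Gamma_def)
  moreover have "gamma_chain c i I = gamma_mon_chain c i H"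
    unfolding H_def by (rule gamma_chain_eq[OF assms(2-5)])
  ultimately show ?thesis using gH by (simp add: H_def)
qed

end
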